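(* For any path $\alpha:[0,1]\to\mathrm{Mult}_n(\mathbb{C})$ and any $[p]\in\mathrm{Poly}_d^{mt}(\mathbb{C})$ with $\mathrm{LL}([p])=\mathbf{cvl}(p)=\alpha(0)$, there exists a path $\widetilde\alpha:[0,1]\to\mathrm{Poly}_d^{mt}(\mathbb{C})$ with $\widetilde\alpha(0)=[p]$ and $\mathrm{LL}\circ\widetilde\alpha=\alpha$, and this lifted path is unique when $\alpha$ has weakly increasing shape.
   Context: $d\ge2$, $n=d-1$. For a degree-$d$ polynomial $p$, $\mathbf{cvl}(p)$ is the $n$-element multiset of values of $p$ at the roots of $p'$ (with multiplicity). $\mathrm{Poly}_d^{mt}(\mathbb{C})$ is the space of monic degree-$d$ polynomials modulo $p(z)\sim p(z+b)$, topologized via coefficients of the centered representative; $\mathrm{Mult}_n(\mathbb{C})=\mathbb{C}^n/\mathrm{Sym}_n$; $\mathrm{LL}:[p]\mapsto\mathbf{cvl}(p)$. Shape of a multiset: integer partition of its multiplicities; $\lambda\le\mu$ iff $\mu$ is obtained by summing the parts of $\lambda$ within blocks of some partition of those parts. $\alpha$ has weakly increasing shape if $s\le t$ implies $\mathrm{Shape}(\alpha(s))\le\mathrm{Shape}(\alpha(t))$. *)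

theory Defs
  imports "HOL-Analysis.Analysis" "HOL-Computational_Algebra.Polynomial" "HOL-Library.Multiset"
begin

definition quotient_topology :: "'a topology \<Rightarrow> ('a \<Rightarrow> 'b) \<Rightarrow> 'b topology" where
  "quotient_topology X q =
     topology (\<lambda>U. U \<subseteq> q ` topspace X \<and> openin X {x \<in> topspace X. q x \<in> U})"

lemma istopology_quotient:
  "istopology (\<lambda>U. U \<subseteq> q ` topspace X \<and> openin X {x \<in> topspace X. q x \<in> U})"
proof -
  have int: "{x \<in> topspace X. q x \<in> S \<inter> T} =
             {x \<in> topspace X. q x \<in> S} \<inter> {x \<in> topspace X. q x \<in> T}" for S T by auto
  have un: "{x \<in> topspace X. q x \<in> \<Union>K} = (\<Union>S\<in>K. {x \<in> topspace X. q x \<in> S})" for K by auto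
  have 1: "\<forall>S T. (S \<subseteq> q ` topspace X \<and> openin X {x \<in> topspace X. q x \<in> S}) \<and>
                 (T \<subseteq> q ` topspace X \<and> openin X {x \<in> topspace X. q x \<in> T}) \<longrightarrow>
                 (S \<inter> T \<subseteq> q ` topspace X \<and> openin X {x \<in> topspace X. q x \<in> S \<inter> T})"
    unfolding int by auto
  have 2: "\<forall>K. (\<forall>S\<in>K. S \<subseteq> q ` topspace X \<and> openin X {x \<in> topspace X. q x \<in> S}) \<longrightarrow>
                 (\<Union>K \<subseteq> q ` topspace X \<and> openin X {x \<in> topspace X. q x \<in> \<Union>K})"
    unfolding un by auto
  show ?thesis unfolding istopology_def using 1 2 by blast
qed

lemma openin_quotient_topology:
  "openin (quotient_topology X q) U \<longleftrightarrow>
     U \<subseteq> q ` topspace X \<and> openin X {x \<in> topspace X. q x \<in> U}"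
  unfolding quotient_topology_def topology_inverse'[OF istopology_quotient] by simp

text \<open>C^n is modelled as the functions {..<n} -> complex (extensional), with the
  product topology; the quotient map sends a tuple to the multiset of its entries.\<close>

definition tuple_to_mset :: "nat \<Rightarrow> (nat \<Rightarrow> complex) \<Rightarrow> complex multiset" where
  "tuple_to_mset n f = image_mset f (mset_set {..<n})"

definition Mult_top :: "nat \<Rightarrow> complex multiset topology" where
  "Mult_top n = quotient_topology (product_topology (\<lambda>_. euclidean) {..<n}) (tuple_to_mset n)"

definition monic_deg :: "nat \<Rightarrow> complex poly \<Rightarrow> bool" where
  "monic_deg d p \<longleftrightarrow> degree p = d \<and> lead_coeff p = 1"

text \<open>Centered representative: monic of degree d with vanishing z^(d-1) coefficient.
  Every class [p] (p(z) ~ p(z+b)) contains exactly one such polynomial.\<close>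
definition centered_monic :: "nat \<Rightarrow> complex poly \<Rightarrow> bool" where
  "centered_monic d p \<longleftrightarrow> monic_deg d p \<and> coeff p (d - 1) = 0"

definition translate_equiv :: "complex poly \<Rightarrow> complex poly \<Rightarrow> bool" where
  "translate_equiv p q \<longleftrightarrow> (\<exists>b. q = pcompose p [:b, 1:])"

definition Poly_mt_top :: "nat \<Rightarrow> complex poly topology" where
  "Poly_mt_top d = pullback_topology {p. centered_monic d p} (\<lambda>p i. coeff p i)
                     (product_topology (\<lambda>_. euclidean) UNIV)"

definition cvl :: "complex poly \<Rightarrow> complex multiset" where
  "cvl p = (\<Sum>c \<in> {c. poly (pderiv p) c = 0}.
              replicate_mset (order c (pderiv p)) (poly p c))"

definition Shape :: "'a multiset \<Rightarrow> nat multiset" where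
  "Shape M = image_mset (count M) (mset_set (set_mset M))"

definition shape_le :: "nat multiset \<Rightarrow> nat multiset \<Rightarrow> bool" where
  "shape_le lam mu \<longleftrightarrow>
     (\<exists>P :: nat multiset multiset. (\<forall>B \<in># P. B \<noteq> {#}) \<and> sum_mset P = lam
        \<and> image_mset sum_mset P = mu)"

definition weakly_increasing_shape :: "(real \<Rightarrow> 'a multiset) \<Rightarrow> bool" where
  "weakly_increasing_shape \<alpha> \<longleftrightarrow>
     (\<forall>s t. 0 \<le> s \<and> s \<le> t \<and> t \<le> 1 \<longrightarrow> shape_le (Shape (\<alpha> s)) (Shape (\<alpha> t)))"

end

theory Submission
  imports Defs "HOL-Computational_Algebra.Fundamental_Theorem_Algebra" "HOL-Combinatorics.Permutations"
begin

text \<open>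
  A centered monic polynomial is written through its critical points \<open>x\<^sub>i\<close> (of sum 0) and its constant
  term. The map sending these data to the tuple of critical values is proper, by homogeneity, because
  a polynomial whose critical values all coincide has a single critical point. Its derivative is
  injective on directions that respect the coincidences among the \<open>x\<^sub>i\<close>: the infinitesimal deformation
  \<open>H\<close> of the polynomial has degree below \<open>n\<close> and would be divisible by \<open>\<Prod>(X - x\<^sub>i)\<close>. Hence fibres are finite,
  and the map is open where the critical points are distinct; openness everywhere follows because
  tuples of distinct values are dense and stay connected along complex lines.

  A proper open map with finite fibres has the path lifting property, which gives existence. If the shape
  of \<open>\<alpha>\<close> weakly increases, then to the right of any time at which two lifts agree the number of distinct
  values is constant, so critical points that coincide keep coinciding, and rigidity forces
  the two lifts to agree a little longer.
\<close>

section \<open>Continuous selections of finite-valued families\<close>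

text \<open>Local inverses cannot carry the argument. Where critical points coincide, the derivative
  of the labelled values kills every direction whose sum vanishes on each group of coinciding points
  and whose entry for the constant term is 0, so the map is branched. Already for
  \<open>d = 3\<close> the path of multisets {2t, -2t} starting at \<open>z^3\<close> has the three
  lifts \<open>z^3 - 3 a^2 z\<close> with \<open>a^3 = t\<close>. Existence therefore rests on
  topological properties that survive branching, and uniqueness has to prevent coinciding critical
  points from separating.

  Labels on critical points and values make linear algebra possible. The symmetric group comes back
  only through local orderings of a multiset; no continuous ordering of the whole path is chosen in
  advance. Since neither of two lifts stands still, rigidity compares two moving sequences with a
  common limit, and difference quotients are taken between them instead of from the limit.\<close>

lemma finite_separation:
  fixes A :: "'a::metric_space set"
  assumes "finite A"
  obtains r where "r > 0" "\<And>x y. x \<in> A \<Longrightarrow> y \<in> A \<Longrightarrow> dist x y < r \<Longrightarrow> x = y"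
proof -
  have "\<exists>r>0. \<forall>x\<in>A. \<forall>y\<in>A. dist x y < r \<longrightarrow> x = y"
    using assms
  proof (induction A rule: finite_induct)
    case empty
    show ?case by (intro exI[of _ 1]) auto
  next
    case (insert a A)
    obtain r where r: "r > 0" "\<forall>x\<in>A. \<forall>y\<in>A. dist x y < r \<longrightarrow> x = y" using insert.IH by blast
    obtain d where d: "d > 0" "\<forall>x\<in>A. x \<noteq> a \<longrightarrow> d \<le> dist a x"
      using finite_set_avoid[OF insert.hyps(1), of a] by blast
    have "\<forall>x\<in>insert a A. \<forall>y\<in>insert a A. dist x y < min r d \<longrightarrow> x = y"
      using r d by (auto simp: dist_commute)
    then show ?case using r(1) d(1) by (intro exI[of _ "min r d"]) auto
  qed
  then show ?thesis using that by blast
qed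

text \<open>Selections along finer and finer meshes with small jumps cannot move between the clusters
  around the finite set \<open>F t\<close>. This makes them locally equicontinuous in the limit, so any cluster point
  in the product space (compact by Tychonoff) is continuous.\<close>
lemma finite_valued_path_selection:
  fixes F :: "real \<Rightarrow> 'a::metric_space set"
  assumes comp: "compact (SIGMA t:{0..1}. F t)"
    and fin: "\<And>t. t \<in> {0..1} \<Longrightarrow> finite (F t)"
    and opn: "\<And>t x e. t \<in> {0..1} \<Longrightarrow> x \<in> F t \<Longrightarrow> e > 0 \<Longrightarrow>
                \<exists>\<delta>>0. \<forall>s\<in>{0..1}. \<bar>s - t\<bar> < \<delta> \<longrightarrow> (\<exists>y\<in>F s. dist x y < e)"
    and x0: "x0 \<in> F 0"
  shows "\<exists>g. continuous_on {0..1} g \<and> g 0 = x0 \<and> (\<forall>t\<in>{0..1}. g t \<in> F t)"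
proof -
  define E where "E = (SIGMA t:{0..1::real}. F t)"
  have seqE: "\<exists>t x r. t \<in> {0..1} \<and> x \<in> F t \<and> strict_mono r \<and> (\<lambda>k::nat. tt (r k)) \<longlonglongrightarrow> t \<and> (\<lambda>k. xx (r k)) \<longlonglongrightarrow> x"
    if "\<And>k. tt k \<in> {0..1}" "\<And>k. xx k \<in> F (tt k)" for tt :: "nat \<Rightarrow> real" and xx
  proof -
    have "\<forall>k. (tt k, xx k) \<in> E" using that by (auto simp: E_def)
    moreover have "seq_compact E" using comp by (simp add: E_def compact_imp_seq_compact)
    ultimately obtain l r where l: "l \<in> E" "strict_mono r" "((\<lambda>k. (tt k, xx k)) \<circ> r) \<longlonglongrightarrow> l"
      by (rule_tac seq_compactE) blast+
    obtain t x where tx: "l = (t,x)" by (cases l)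
    have "(\<lambda>k. tt (r k)) \<longlonglongrightarrow> t" using tendsto_fst[OF l(3)] by (simp add: tx o_def)
    moreover have "(\<lambda>k. xx (r k)) \<longlonglongrightarrow> x" using tendsto_snd[OF l(3)] by (simp add: tx o_def)
    ultimately show ?thesis using l tx by (auto simp: E_def)
  qed
  \<comment> \<open>Failures at ever smaller scales would accumulate, by compactness of the graph,
    at some \<open>x\<close> in \<open>F t\<close>, where \<open>opn\<close> supplies a neighbour;
    the other \<open>e/2\<close> covers the distance to the limit.\<close>
  have unif: "\<exists>\<delta>>0. \<forall>s\<in>{0..1}. \<forall>t\<in>{0..1}. \<forall>x\<in>F t. \<bar>s - t\<bar> < \<delta> \<longrightarrow> (\<exists>y\<in>F s. dist x y < e)"
    if e: "e > 0" for e
  proof (rule ccontr)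
    assume neg: "\<not> ?thesis"
    have "\<forall>k::nat. \<exists>s t x. s \<in> {0..1} \<and> t \<in> {0..1} \<and> x \<in> F t \<and> \<bar>s - t\<bar> < inverse (real (Suc k)) \<and> \<not> (\<exists>y\<in>F s. dist x y < e)"
    proof
      fix k :: nat
      have "inverse (real (Suc k)) > 0" by simp
      then show "\<exists>s t x. s \<in> {0..1} \<and> t \<in> {0..1} \<and> x \<in> F t \<and> \<bar>s - t\<bar> < inverse (real (Suc k)) \<and> \<not> (\<exists>y\<in>F s. dist x y < e)"
        using neg by blast
    qed
    then obtain ss tt xx where sq: "\<And>k. ss k \<in> {0..1}" "\<And>k. tt k \<in> {0..1}" "\<And>k. xx k \<in> F (tt k)"
      "\<And>k::nat. \<bar>ss k - tt k\<bar> < inverse (real (Suc k))" "\<And>k. \<not> (\<exists>y\<in>F (ss k). dist (xx k) y < e)"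
      by metis
    obtain t x r where l: "t \<in> {0..1}" "x \<in> F t" "strict_mono r" "(\<lambda>k. tt (r k)) \<longlonglongrightarrow> t" "(\<lambda>k. xx (r k)) \<longlonglongrightarrow> x"
      using seqE[of tt xx] sq(2,3) by blast
    obtain \<delta> where d: "\<delta> > 0" "\<And>s. s\<in>{0..1} \<Longrightarrow> \<bar>s - t\<bar> < \<delta> \<Longrightarrow> (\<exists>y\<in>F s. dist x y < e/2)"
      using opn[OF l(1,2), of "e/2"] e by auto
    have "(\<lambda>k. inverse (real (Suc (r k)))) \<longlonglongrightarrow> 0"
      using LIMSEQ_subseq_LIMSEQ[OF LIMSEQ_inverse_real_of_nat l(3)] by (simp add: o_def)
    then have "(\<lambda>k. ss (r k) - tt (r k)) \<longlonglongrightarrow> 0"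
      by (rule Lim_null_comparison[rotated]) (use sq(4) in \<open>auto intro!: eventuallyI less_imp_le\<close>)
    from tendsto_add[OF this l(4)] have "(\<lambda>k. ss (r k)) \<longlonglongrightarrow> t" by simp
    then have "\<forall>\<^sub>F k in sequentially. dist (ss (r k)) t < \<delta>" using d(1) tendstoD by blast
    moreover have "\<forall>\<^sub>F k in sequentially. dist (xx (r k)) x < e/2" using l(5) e tendstoD half_gt_zero by blast
    ultimately have "\<forall>\<^sub>F k in sequentially. dist (ss (r k)) t < \<delta> \<and> dist (xx (r k)) x < e/2"
      by (rule eventually_conj)
    then obtain k where k: "dist (ss (r k)) t < \<delta>" "dist (xx (r k)) x < e/2"
      using eventually_happens'[OF sequentially_bot] by blast
    obtain y where y: "y \<in> F (ss (r k))" "dist x y < e/2" using d(2)[OF sq(1)] k(1) by (auto simp: dist_real_def)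
    have "dist (xx (r k)) y < e" using dist_triangle_half_l[of "xx (r k)" x e y] k(2) y(2)
      by (simp add: dist_commute)
    then show False using sq(5) y(1) by blast
  qed
  have usc: "\<exists>\<delta>>0. \<forall>s\<in>{0..1}. \<bar>s - t\<bar> < \<delta> \<longrightarrow> (\<forall>y\<in>F s. \<exists>x\<in>F t. dist y x < \<rho>)"
    if t: "t \<in> {0..1}" and r: "\<rho> > 0" for t \<rho>
  proof (rule ccontr)
    assume neg: "\<not> ?thesis"
    have "\<forall>k::nat. \<exists>s y. s \<in> {0..1} \<and> y \<in> F s \<and> \<bar>s - t\<bar> < inverse (real (Suc k)) \<and> \<not> (\<exists>x\<in>F t. dist y x < \<rho>)"
    proof
      fix k :: nat
      have "inverse (real (Suc k)) > 0" by simp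
      then show "\<exists>s y. s \<in> {0..1} \<and> y \<in> F s \<and> \<bar>s - t\<bar> < inverse (real (Suc k)) \<and> \<not> (\<exists>x\<in>F t. dist y x < \<rho>)"
        using neg by blast
    qed
    then obtain ss yy where sq: "\<And>k. ss k \<in> {0..1}" "\<And>k. yy k \<in> F (ss k)"
      "\<And>k::nat. \<bar>ss k - t\<bar> < inverse (real (Suc k))" "\<And>k. \<not> (\<exists>x\<in>F t. dist (yy k) x < \<rho>)"
      by metis
    obtain t' x r' where l: "t' \<in> {0..1}" "x \<in> F t'" "strict_mono r'" "(\<lambda>k. ss (r' k)) \<longlonglongrightarrow> t'" "(\<lambda>k. yy (r' k)) \<longlonglongrightarrow> x"
      using seqE[of ss yy] sq(1,2) by blast
    have "(\<lambda>k. ss k - t) \<longlonglongrightarrow> 0"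
      by (rule Lim_null_comparison[OF _ LIMSEQ_inverse_real_of_nat]) (use sq(3) in \<open>auto intro!: eventuallyI less_imp_le\<close>)
    then have "ss \<longlonglongrightarrow> t" using LIM_zero_iff by blast
    then have "(\<lambda>k. ss (r' k)) \<longlonglongrightarrow> t" using LIMSEQ_subseq_LIMSEQ[OF _ l(3)] by (simp add: o_def)
    then have "t' = t" using l(4) LIMSEQ_unique by blast
    moreover have "\<forall>\<^sub>F k in sequentially. dist (yy (r' k)) x < \<rho>" using l(5) r tendstoD by blast
    then obtain k where "dist (yy (r' k)) x < \<rho>" using eventually_happens'[OF sequentially_bot] by blast
    ultimately show False using sq(4) l(2) by blast
  qed
  \<comment> \<open>One application of \<open>unif\<close> per mesh step. Time is frozen at 1, so
    the chain can be indexed by all natural numbers and dependent choice applies.\<close>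
  have chain: "\<exists>c h. 0 < h \<and> h < inverse (real (Suc N)) \<and> c 0 = x0 \<and>
      (\<forall>j::nat. c j \<in> F (min 1 (real j * h)) \<and> dist (c j) (c (Suc j)) < inverse (real (Suc N)))" for N
  proof -
    obtain \<delta> where d: "\<delta> > 0" "\<And>s t x. s\<in>{0..1} \<Longrightarrow> t\<in>{0..1} \<Longrightarrow> x\<in>F t \<Longrightarrow> \<bar>s - t\<bar> < \<delta> \<Longrightarrow> (\<exists>y\<in>F s. dist x y < inverse (real (Suc N)))"
      using unif[of "inverse (real (Suc N))"] by auto
    define h where "h = min \<delta> (inverse (real (Suc N))) / 2"
    have "min \<delta> (inverse (real (Suc N))) > 0" using d(1) by simp
    then have h: "0 < h" "h < \<delta>" "h < inverse (real (Suc N))" unfolding h_def by linarith+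
    have "\<exists>f. \<forall>j. (f j \<in> F (min 1 (real j * h)) \<and> (j = 0 \<longrightarrow> f j = x0)) \<and> dist (f j) (f (Suc j)) < inverse (real (Suc N))"
    proof (rule dependent_nat_choice)
      show "\<exists>x. x \<in> F (min 1 (real 0 * h)) \<and> ((0::nat) = 0 \<longrightarrow> x = x0)" using x0 by auto
    next
      fix x and j :: nat
      assume "x \<in> F (min 1 (real j * h)) \<and> (j = 0 \<longrightarrow> x = x0)"
      moreover have "\<bar>min 1 (real (Suc j) * h) - min 1 (real j * h)\<bar> < \<delta>"
        using h by (auto simp: min_def algebra_simps)
      moreover have "min 1 (real (Suc j) * h) \<in> {0..1}" "min 1 (real j * h) \<in> {0..1}" using h(1) by auto
      ultimately obtain y where "y \<in> F (min 1 (real (Suc j) * h))" "dist x y < inverse (real (Suc N))"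
        using d(2) by blast
      then show "\<exists>y. (y \<in> F (min 1 (real (Suc j) * h)) \<and> (Suc j = 0 \<longrightarrow> y = x0)) \<and> dist x y < inverse (real (Suc N))"
        by auto
    qed
    then show ?thesis using h by blast
  qed
  then obtain c h where ch: "\<And>N. 0 < h N" "\<And>N. h N < inverse (real (Suc N))" "\<And>N. c N 0 = x0"
     "\<And>N j. c N j \<in> F (min 1 (real j * h N))" "\<And>N j. dist (c N j) (c N (Suc j)) < inverse (real (Suc N))"
    by metis
  define j where "j N t = nat \<lfloor>t / h N\<rfloor>" for N and t :: real
  define G where "G N t = c N (j N t)" for N t
  have jdist: "\<bar>min 1 (real (j N t) * h N) - t\<bar> < inverse (real (Suc N))" if "t \<in> {0..1}" for N t
  proof -
    have "real (j N t) = of_int \<lfloor>t / h N\<rfloor>" using that ch(1)[of N] by (simp add: j_def)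
    then have "real (j N t) \<le> t / h N" "t / h N < real (j N t) + 1" by linarith+
    then have "real (j N t) * h N \<le> t" "t < real (j N t) * h N + h N"
      using ch(1)[of N] by (simp_all add: field_simps)
    then show ?thesis using ch(2)[of N] that by auto
  qed
  have small: "\<exists>N0. \<forall>N\<ge>N0. inverse (real (Suc N)) < e" if "e > 0" for e
    using order_tendstoD(2)[OF LIMSEQ_inverse_real_of_nat that] by (simp add: eventually_sequentially)
  have equi: "\<exists>\<delta>>0. \<exists>N0. \<forall>N\<ge>N0. \<forall>s\<in>{0..1}. \<forall>s'\<in>{0..1}. \<bar>s - t\<bar> < \<delta> \<longrightarrow> \<bar>s' - t\<bar> < \<delta> \<longrightarrow> dist (G N s) (G N s') < \<rho>"
    if t: "t \<in> {0..1}" and r: "\<rho> > 0" for t \<rho>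
  proof -
    obtain r0 where r0: "r0 > 0" "\<And>x y. x \<in> F t \<Longrightarrow> y \<in> F t \<Longrightarrow> dist x y < r0 \<Longrightarrow> x = y"
      using finite_separation[OF fin[OF t]] by blast
    \<comment> \<open>Two cluster radii and one jump add up to less than \<open>r0\<close>, so
      consecutive chain points stay in the same cluster.\<close>
    define q where "q = min \<rho> r0 / 3"
    have q: "q > 0" "3 * q \<le> \<rho>" "3 * q \<le> r0" using r r0(1) by (auto simp: q_def)
    obtain \<delta> where d: "\<delta> > 0" "\<And>s y. s\<in>{0..1} \<Longrightarrow> \<bar>s - t\<bar> < \<delta> \<Longrightarrow> y\<in>F s \<Longrightarrow> \<exists>x\<in>F t. dist y x < q"
      using usc[OF t q(1)] by blast
    \<comment> \<open>The mesh error stays below \<open>\<delta>/2\<close>, so all mesh times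
      between two arguments within \<open>\<delta>/2\<close> of \<open>t\<close> are within
      \<open>\<delta>\<close> of \<open>t\<close>.\<close>
    obtain N0 where N0: "\<And>N. N \<ge> N0 \<Longrightarrow> inverse (real (Suc N)) < min q (\<delta>/2)"
      using small[of "min q (\<delta>/2)"] q d by auto
    have main: "dist (G N s) (G N s') < \<rho>" if N: "N \<ge> N0" and s: "s \<in> {0..1}" "s' \<in> {0..1}" "s \<le> s'"
      "\<bar>s - t\<bar> < \<delta>/2" "\<bar>s' - t\<bar> < \<delta>/2" for N s s'
    proof -
      define u where "u i = min 1 (real i * h N)" for i
      have uI: "u i \<in> {0..1}" for i using ch(1)[of N] by (simp add: u_def)
      have jj: "j N s \<le> j N s'" unfolding j_def
        using s(3) ch(1)[of N] by (intro nat_mono floor_mono divide_right_mono) auto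
      have ub: "\<bar>u i - t\<bar> < \<delta>" if "j N s \<le> i" "i \<le> j N s'" for i
      proof -
        have "u a \<le> u b" if "a \<le> b" for a b
          unfolding u_def using that ch(1)[of N] by (intro min.mono mult_right_mono) auto
        then have "u (j N s) \<le> u i" "u i \<le> u (j N s')" using that by blast+
        moreover have "\<bar>u (j N s) - s\<bar> < \<delta>/2" "\<bar>u (j N s') - s'\<bar> < \<delta>/2"
          using jdist[OF s(1), of N] jdist[OF s(2), of N] N0[OF N] unfolding u_def by linarith+
        ultimately show ?thesis using s by linarith
      qed
      have near: "\<exists>x\<in>F t. dist (c N i) x < q" if "j N s \<le> i" "i \<le> j N s'" for i
        using d(2)[OF uI ub[OF that]] ch(4)[of N i] by (simp add: u_def)
      obtain x where x: "x \<in> F t" "dist (c N (j N s)) x < q" using near[of "j N s"] jj by auto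
      have "i \<le> j N s' \<longrightarrow> dist (c N i) x < q" if "j N s \<le> i" for i
        using that
      proof (induction i rule: dec_induct)
        case base
        show ?case using x by simp
      next
        case (step i)
        show ?case
        proof
          assume le: "Suc i \<le> j N s'"
          then obtain x' where x': "x' \<in> F t" "dist (c N (Suc i)) x' < q" using near[of "Suc i"] step.hyps by auto
          have "dist x x' \<le> dist (c N i) x + (dist (c N i) (c N (Suc i)) + dist (c N (Suc i)) x')"
            using dist_triangle3[of x x' "c N i"] dist_triangle[of "c N i" x' "c N (Suc i)"] by linarith
          also have "\<dots> < q + (q + q)"
            using step.IH le x'(2) ch(5)[of N i] N0[OF N] by auto
          finally have "x = x'" using r0(2)[OF x(1) x'(1)] q(3) by simp
          then show "dist (c N (Suc i)) x < q" using x' by simp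
        qed
      qed
      then have "dist (c N (j N s')) x < q" using jj by blast
      then show ?thesis unfolding G_def using x(2) q dist_triangle2[of "c N (j N s)" "c N (j N s')" x]
        by linarith
    qed
    have "\<forall>N\<ge>N0. \<forall>s\<in>{0..1}. \<forall>s'\<in>{0..1}. \<bar>s - t\<bar> < \<delta>/2 \<longrightarrow> \<bar>s' - t\<bar> < \<delta>/2 \<longrightarrow> dist (G N s) (G N s') < \<rho>"
    proof (intro allI ballI impI)
      fix N s s' assume *: "N0 \<le> N" "s \<in> {0..1}" "s' \<in> {0..1}" "\<bar>s - t\<bar> < \<delta>/2" "\<bar>s' - t\<bar> < \<delta>/2"
      show "dist (G N s) (G N s') < \<rho>"
        using main[OF *(1,2,3) _ *(4,5)] main[OF *(1,3,2) _ *(5,4)] by (metis dist_commute linear)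
    qed
    then show ?thesis using d(1) by (intro exI[of _ "\<delta>/2"]) auto
  qed
  define K where "K = snd ` E"
  have "compact K" unfolding K_def
    using comp by (auto simp: E_def intro!: compact_continuous_image continuous_on_snd continuous_on_id)
  then have "compactin (product_topology (\<lambda>_. euclidean) UNIV) (Pi\<^sub>E UNIV (\<lambda>_::real. K))"
    unfolding compactin_PiE by (simp add: compactin_euclidean_iff)
  then have cK: "compact (Pi\<^sub>E UNIV (\<lambda>_::real. K))"
    by (simp add: euclidean_product_topology compactin_euclidean_iff)
  have GK: "G N \<in> Pi\<^sub>E UNIV (\<lambda>_. K)" for N
  proof -
    have "G N t \<in> K" for t unfolding K_def E_def G_def
      by (rule image_eqI[of _ _ "(min 1 (real (j N t) * h N), c N (j N t))"])
         (use ch(1)[of N] ch(4) in auto)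
    then show ?thesis by auto
  qed
  \<comment> \<open>The index set is uncountable, so a cluster point of the filter takes the place
    of a convergent subsequence.\<close>
  obtain g where g: "inf (nhds g) (filtermap G sequentially) \<noteq> bot"
    using cK[unfolded compact_filter, rule_format, of "filtermap G sequentially"] GK
    by (auto simp: filtermap_bot_iff eventually_filtermap)
  \<comment> \<open>Two coordinates at once, because continuity compares \<open>g s\<close> with
    \<open>g t\<close> through one and the same \<open>G N\<close>.\<close>
  have clus: "\<exists>N\<ge>N0. dist (G N s) (g s) < e \<and> dist (G N t) (g t) < e" if e: "e > 0" for s t e N0
  proof -
    define U where "U = {f. \<forall>i\<in>{s,t}. f i \<in> ball (g i) e}"
    have "open U" unfolding U_def by (rule product_topology_basis') auto
    moreover have "g \<in> U" using e by (simp add: U_def)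
    ultimately have 1: "\<forall>\<^sub>F f in nhds g. f \<in> U" by (rule eventually_nhds_in_open)
    show ?thesis
    proof (rule ccontr)
      assume neg: "\<not> ?thesis"
      have "\<forall>\<^sub>F N in sequentially. G N \<notin> U"
        unfolding eventually_sequentially using neg
        by (intro exI[of _ N0]) (auto simp: U_def dist_commute)
      then have 2: "\<forall>\<^sub>F f in filtermap G sequentially. f \<notin> U" by (simp add: eventually_filtermap)
      have "\<forall>\<^sub>F f in inf (nhds g) (filtermap G sequentially). False"
        unfolding eventually_inf using 1 2 by blast
      then show False using g by (simp add: eventually_False)
    qed
  qed
  have gF: "g t \<in> F t" if t: "t \<in> {0..1}" for t
  proof -
    have "\<exists>x\<in>F t. dist x (g t) < \<rho>" if r: "\<rho> > 0" for \<rho>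
    proof -
      obtain \<delta> where d: "\<delta> > 0" "\<And>s y. s\<in>{0..1} \<Longrightarrow> \<bar>s - t\<bar> < \<delta> \<Longrightarrow> y\<in>F s \<Longrightarrow> \<exists>x\<in>F t. dist y x < \<rho>/2"
        using usc[OF t, of "\<rho>/2"] r by auto
      obtain N0 where N0: "\<And>N. N \<ge> N0 \<Longrightarrow> inverse (real (Suc N)) < \<delta>" using small[OF d(1)] by auto
      obtain N where N: "N \<ge> N0" "dist (G N t) (g t) < \<rho>/2" using clus[of "\<rho>/2" N0 t t] r by auto
      have "\<exists>x\<in>F t. dist (G N t) x < \<rho>/2"
        by (rule d(2)[of "min 1 (real (j N t) * h N)"])
           (use jdist[OF t, of N] N0[OF N(1)] ch(1)[of N] ch(4) in \<open>auto simp: G_def\<close>)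
      then obtain x where "x \<in> F t" "dist (G N t) x < \<rho>/2" by blast
      then show ?thesis using N(2) dist_triangle_half_r[of "G N t" x \<rho> "g t"] by auto
    qed
    then have "g t \<in> closure (F t)" unfolding closure_approachable by blast
    then show ?thesis using fin[OF t] by (simp add: finite_imp_closed)
  qed
  have g0: "g 0 = x0"
  proof (rule ccontr)
    assume "g 0 \<noteq> x0"
    then have "dist x0 (g 0) > 0" by simp
    from clus[OF this, of 0 0 0] show False by (auto simp: G_def j_def ch(3))
  qed
  have "continuous_on {0..1} g"
    unfolding continuous_on_iff
  proof (intro ballI allI impI)
    fix t \<rho> :: real assume t: "t \<in> {0..1}" and r: "\<rho> > 0"
    have r3: "\<rho>/3 > 0" using r by simp
    obtain \<delta> N0 where d: "\<delta> > 0" "\<And>N s s'. N\<ge>N0 \<Longrightarrow> s\<in>{0..1} \<Longrightarrow> s'\<in>{0..1} \<Longrightarrow> \<bar>s - t\<bar> < \<delta> \<Longrightarrow> \<bar>s' - t\<bar> < \<delta> \<Longrightarrow> dist (G N s) (G N s') < \<rho>/3"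
      using equi[OF t r3] by blast
    have "dist (g s) (g t) < \<rho>" if s: "s \<in> {0..1}" "dist s t < \<delta>" for s
    proof -
      obtain N where N: "N \<ge> N0" "dist (G N s) (g s) < \<rho>/3" "dist (G N t) (g t) < \<rho>/3"
        using clus[of "\<rho>/3" N0 s t] r by auto
      have "dist (G N s) (G N t) < \<rho>/3" using d(2)[OF N(1) s(1) t] s(2) d(1) by (simp add: dist_real_def)
      then show ?thesis using N dist_triangle3[of "g s" "G N t" "G N s"] dist_triangle[of "g s" "g t" "G N t"]
        by linarith
    qed
    then show "\<exists>d>0. \<forall>s\<in>{0..1}. dist s t < d \<longrightarrow> dist (g s) (g t) < \<rho>" using d(1) by blast
  qed
  then show ?thesis using g0 gF by blast
qed

section \<open>Polynomials parametrized by their critical points\<close>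

definition coeffs_tendsto :: "('a \<Rightarrow> complex poly) \<Rightarrow> complex poly \<Rightarrow> 'a filter \<Rightarrow> bool" where
  "coeffs_tendsto P p F \<longleftrightarrow> (\<forall>i. ((\<lambda>k. coeff (P k) i) \<longlongrightarrow> coeff p i) F)"

lemma coeffs_tendsto_const: "coeffs_tendsto (\<lambda>_. p) p F"
  by (simp add: coeffs_tendsto_def)

lemma coeffs_tendsto_add:
  "coeffs_tendsto P p F \<Longrightarrow> coeffs_tendsto Q q F \<Longrightarrow> coeffs_tendsto (\<lambda>k. P k + Q k) (p + q) F"
  by (simp add: coeffs_tendsto_def tendsto_add)

lemma coeffs_tendsto_diff:
  "coeffs_tendsto P p F \<Longrightarrow> coeffs_tendsto Q q F \<Longrightarrow> coeffs_tendsto (\<lambda>k. P k - Q k) (p - q) F"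
  by (simp add: coeffs_tendsto_def tendsto_diff)

lemma coeffs_tendsto_mult:
  "coeffs_tendsto P p F \<Longrightarrow> coeffs_tendsto Q q F \<Longrightarrow> coeffs_tendsto (\<lambda>k. P k * Q k) (p * q) F"
  by (auto simp: coeffs_tendsto_def coeff_mult intro!: tendsto_sum tendsto_mult)

lemma coeffs_tendsto_smult:
  "(f \<longlongrightarrow> a) F \<Longrightarrow> coeffs_tendsto P p F \<Longrightarrow> coeffs_tendsto (\<lambda>k. smult (f k) (P k)) (smult a p) F"
  by (auto simp: coeffs_tendsto_def intro!: tendsto_mult)

lemma coeffs_tendsto_pCons:
  "(f \<longlongrightarrow> a) F \<Longrightarrow> coeffs_tendsto P p F \<Longrightarrow> coeffs_tendsto (\<lambda>k. pCons (f k) (P k)) (pCons a p) F"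
  by (auto simp: coeffs_tendsto_def coeff_pCons split: nat.split)

lemma coeffs_tendsto_prod:
  "(\<And>i. i \<in> A \<Longrightarrow> coeffs_tendsto (P i) (p i) F) \<Longrightarrow>
     coeffs_tendsto (\<lambda>k. \<Prod>i\<in>A. P i k) (\<Prod>i\<in>A. p i) F"
  by (induction A rule: infinite_finite_induct) (auto intro: coeffs_tendsto_const coeffs_tendsto_mult)

text \<open>The common degree bound turns evaluation into a sum of fixed length; the point of
  evaluation may move as well.\<close>

lemma coeffs_tendsto_poly:
  assumes "coeffs_tendsto P p F" "\<And>k. degree (P k) \<le> N" "degree p \<le> N" "(z \<longlongrightarrow> a) F"
  shows "((\<lambda>k. poly (P k) (z k)) \<longlongrightarrow> poly p a) F"
proof -
  have eq: "poly q w = (\<Sum>i\<le>N. coeff q i * w ^ i)" if "degree q \<le> N" for q :: "complex poly" and w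
    unfolding poly_altdef using that
    by (intro sum.mono_neutral_left) (auto simp: coeff_eq_0)
  have "((\<lambda>k. \<Sum>i\<le>N. coeff (P k) i * z k ^ i) \<longlongrightarrow> (\<Sum>i\<le>N. coeff p i * a ^ i)) F"
    using assms(1,4) by (intro tendsto_intros) (auto simp: coeffs_tendsto_def)
  then show ?thesis using assms(2,3) by (simp add: eq)
qed

lemma coeff_synthetic_div:
  fixes p :: "complex poly"
  shows "coeff (synthetic_div p c) m = coeff p (Suc m) + c * coeff (synthetic_div p c) (Suc m)"
  using arg_cong[OF synthetic_div_correct[of p c], of "\<lambda>q. coeff q (Suc m)"] by simp

text \<open>Horner's scheme gives each coefficient of the quotient from the next higher one, so
  convergence descends from index \<open>N\<close>, where all of them vanish.\<close>

lemma coeffs_tendsto_synthetic_div: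
  assumes P: "coeffs_tendsto P p F" "\<And>k. degree (P k) \<le> N" "degree p \<le> N" "(z \<longlongrightarrow> a) F"
  shows "coeffs_tendsto (\<lambda>k. synthetic_div (P k) (z k)) (synthetic_div p a) F"
proof -
  have big: "coeff (synthetic_div q w) m = 0" if "degree q \<le> N" "m \<ge> N" for q :: "complex poly" and w m
  proof (cases "degree q = 0")
    case True
    then show ?thesis by (metis coeff_0 synthetic_div_eq_0_iff)
  next
    case False
    then show ?thesis using that by (intro coeff_eq_0) (simp add: degree_synthetic_div)
  qed
  have "((\<lambda>k. coeff (synthetic_div (P k) (z k)) m) \<longlongrightarrow> coeff (synthetic_div p a) m) F" for m
  proof (induction "N - m" arbitrary: m)
    case 0
    then show ?case using P by (simp add: big)
  next
    case (Suc j)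
    have "((\<lambda>k. coeff (P k) (Suc m) + z k * coeff (synthetic_div (P k) (z k)) (Suc m)) \<longlongrightarrow>
        coeff p (Suc m) + a * coeff (synthetic_div p a) (Suc m)) F"
      using P(1,4) Suc.hyps(1)[of "Suc m"] Suc.hyps(2)
      by (intro tendsto_intros) (auto simp: coeffs_tendsto_def)
    then show ?case by (subst (1 2) coeff_synthetic_div)
  qed
  then show ?thesis by (simp add: coeffs_tendsto_def)
qed

lemma poly_synthetic_div_self:
  fixes p :: "complex poly"
  shows "poly (synthetic_div p c) c = poly (pderiv p) c"
proof -
  have "pderiv ([:-c, 1:] * q + [:r:]) = [:-c, 1:] * pderiv q + q * pderiv [:-c, 1:] + pderiv [:r:]" for q r
    by (simp only: pderiv_add pderiv_mult)
  then have "poly (pderiv ([:-c, 1:] * q + [:r:])) c = poly q c" for q r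
    by (simp add: pderiv_pCons)
  from this[of "synthetic_div p c" "poly p c"] show ?thesis
    by (simp only: synthetic_div_correct')
qed

text \<open>Roots that converge to \<open>a\<close> add up their multiplicities in the limit. One
  moving linear factor is divided off at a time, which keeps the coefficients convergent. A list is
  used because one root may have to be counted several times.\<close>

lemma power_dvd_of_limit:
  fixes fs :: "('k \<Rightarrow> complex) list"
  assumes "\<And>f. f \<in> set fs \<Longrightarrow> (f \<longlongrightarrow> a) F"
    and "\<And>k. (\<Prod>f\<leftarrow>fs. [:- f k, 1:]) dvd P k"
    and "coeffs_tendsto P p F" "\<And>k. degree (P k) \<le> N" "degree p \<le> N" "F \<noteq> bot"
  shows "[:- a, 1:] ^ length fs dvd p"
  using assms
proof (induction fs arbitrary: P p)
  case (Cons f fs)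
  define q where "q k = synthetic_div (P k) (f k)" for k
  have root: "poly (P k) (f k) = 0" for k
    using Cons.prems(2)[of k] unfolding poly_eq_0_iff_dvd list.map prod_list.Cons by (rule dvd_mult_left)
  have Pq: "P k = [:- f k, 1:] * q k" for k
    using synthetic_div_correct'[of "f k" "P k"] root by (simp add: q_def)
  have fa: "(f \<longlongrightarrow> a) F" using Cons.prems(1) by simp
  have "((\<lambda>k. poly (P k) (f k)) \<longlongrightarrow> poly p a) F"
    by (rule coeffs_tendsto_poly[OF Cons.prems(3-5) fa])
  then have "poly p a = 0"
    using root tendsto_unique[OF Cons.prems(6) _ tendsto_const[of 0 F]] by simp
  then have pq: "p = [:- a, 1:] * synthetic_div p a"
    using synthetic_div_correct'[of a p] by simp
  have "[:- a, 1:] ^ length fs dvd synthetic_div p a"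
  proof (rule Cons.IH)
    show "(\<Prod>f\<leftarrow>fs. [:- f k, 1:]) dvd q k" for k
    proof -
      have "[:- f k, 1:] * (\<Prod>f\<leftarrow>fs. [:- f k, 1:]) dvd [:- f k, 1:] * q k"
        using Cons.prems(2)[of k] by (simp only: Pq[symmetric] list.map prod_list.Cons)
      then show ?thesis
        by (simp only: dvd_mult_cancel_left pCons_eq_0_iff one_neq_zero simp_thms)
    qed
    show "coeffs_tendsto q (synthetic_div p a) F"
      unfolding q_def by (rule coeffs_tendsto_synthetic_div[OF Cons.prems(3-5) fa])
    show "degree (q k) \<le> N" for k using Cons.prems(4)[of k] by (simp add: q_def degree_synthetic_div)
    show "degree (synthetic_div p a) \<le> N" using Cons.prems(5) by (simp add: degree_synthetic_div)
    show "(g \<longlongrightarrow> a) F" if "g \<in> set fs" for g using Cons.prems(1) that by simp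
    show "F \<noteq> bot" by (rule Cons.prems(6))
  qed
  then have "[:- a, 1:] * [:- a, 1:] ^ length fs dvd [:- a, 1:] * synthetic_div p a"
    by (rule mult_dvd_mono[OF dvd_refl])
  then show ?case by (subst pq) (simp only: length_Cons power_Suc)
qed simp

section \<open>Polynomials with prescribed critical points\<close>

definition integral_poly :: "complex poly \<Rightarrow> complex poly" where
  "integral_poly q = (\<Sum>i\<le>degree q. monom (coeff q i / of_nat (Suc i)) (Suc i))"

lemma coeff_integral_poly:
  "coeff (integral_poly q) m = (case m of 0 \<Rightarrow> 0 | Suc i \<Rightarrow> coeff q i / of_nat (Suc i))"
  by (auto simp: integral_poly_def coeff_sum coeff_eq_0 split: nat.split)

lemma pderiv_integral_poly [simp]: "pderiv (integral_poly q) = q"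
  by (rule poly_eqI) (simp add: coeff_pderiv coeff_integral_poly del: of_nat_Suc)

lemma integral_poly_pderiv: "integral_poly (pderiv p) = p - [:coeff p 0:]"
  by (rule poly_eqI) (auto simp: coeff_integral_poly coeff_pderiv coeff_pCons simp del: of_nat_Suc split: nat.split)

lemma coeffs_tendsto_integral_poly:
  "coeffs_tendsto P p F \<Longrightarrow> coeffs_tendsto (\<lambda>k. integral_poly (P k)) (integral_poly p) F"
  by (auto simp: coeffs_tendsto_def coeff_integral_poly simp del: of_nat_Suc
      intro!: tendsto_divide tendsto_const split: nat.split)

definition root_poly :: "nat \<Rightarrow> (nat \<Rightarrow> complex) \<Rightarrow> complex poly" where
  "root_poly n x = (\<Prod>i<n. [:- x i, 1:])"

definition crit_poly :: "nat \<Rightarrow> (nat \<Rightarrow> complex) \<Rightarrow> complex poly" where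
  "crit_poly n x = [:x n:] + integral_poly (smult (of_nat (Suc n)) (root_poly n x))"

definition crit_val :: "nat \<Rightarrow> (nat \<Rightarrow> complex) \<Rightarrow> nat \<Rightarrow> complex" where
  "crit_val n x i = poly (crit_poly n x) (x i)"

text \<open>Tuples \<open>x\<close> of \<open>n\<close> critical points with sum 0, followed by a constant term \<open>x n\<close>, parametrize
  the centered monic polynomials of degree \<open>n + 1\<close> through \<open>crit_poly\<close>.\<close>
definition crit_space :: "nat \<Rightarrow> (nat \<Rightarrow> complex) set" where
  "crit_space n = {x. (\<forall>i>n. x i = 0) \<and> (\<Sum>i<n. x i) = 0}"

text \<open>The directional derivative of \<open>root_poly n\<close> at \<open>c\<close> along
  \<open>u\<close>, by the product rule: moving \<open>c j\<close> by \<open>u j\<close> changes its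
  linear factor by \<open>- u j\<close>.\<close>

definition root_poly_deriv :: "nat \<Rightarrow> (nat \<Rightarrow> complex) \<Rightarrow> (nat \<Rightarrow> complex) \<Rightarrow> complex poly" where
  "root_poly_deriv n c u = - (\<Sum>j<n. smult (u j) (\<Prod>l\<in>{..<n}-{j}. [:- c l, 1:]))"

text \<open>The deformation \<open>H\<close> of the overview, that is, the first variation of
  \<open>crit_poly n\<close> including that of the constant term.\<close>

definition crit_poly_deriv :: "nat \<Rightarrow> (nat \<Rightarrow> complex) \<Rightarrow> (nat \<Rightarrow> complex) \<Rightarrow> complex poly" where
  "crit_poly_deriv n c u = [:u n:] + integral_poly (smult (of_nat (Suc n)) (root_poly_deriv n c u))"

lemma root_poly_nz [simp]: "root_poly n x \<noteq> 0"
  by (simp add: root_poly_def prod_zero_iff)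

lemma degree_root_poly [simp]: "degree (root_poly n x) = n"
  unfolding root_poly_def by (subst degree_prod_eq_sum_degree) auto

lemma lead_coeff_root_poly [simp]: "coeff (root_poly n x) n = 1"
proof -
  have "lead_coeff (root_poly n x) = 1" unfolding root_poly_def by (simp only: lead_coeff_prod) simp
  then show ?thesis by simp
qed

lemma poly_root_poly: "poly (root_poly n x) z = (\<Prod>i<n. z - x i)"
  by (simp add: root_poly_def poly_prod)

lemma proots_root_poly: "proots (root_poly n x) = image_mset x (mset_set {..<n})"
  unfolding root_poly_def by (subst proots_prod) (auto simp: sum_unfold_sum_mset multiset.map_comp o_def)

lemma pderiv_crit_poly [simp]: "pderiv (crit_poly n x) = smult (of_nat (Suc n)) (root_poly n x)"
  by (simp add: crit_poly_def pderiv_add pderiv_pCons)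

lemma coeff_crit_poly:
  "coeff (crit_poly n x) m = (case m of 0 \<Rightarrow> x n | Suc i \<Rightarrow> of_nat (Suc n) * coeff (root_poly n x) i / of_nat (Suc i))"
  by (auto simp: crit_poly_def coeff_integral_poly split: nat.split)

lemma lead_coeff_crit_poly [simp]: "coeff (crit_poly n x) (Suc n) = 1"
  by (simp add: coeff_crit_poly del: of_nat_Suc)

lemma degree_crit_poly [simp]: "degree (crit_poly n x) = Suc n"
proof (rule antisym)
  show "degree (crit_poly n x) \<le> Suc n"
    by (rule degree_le) (auto simp: coeff_crit_poly coeff_eq_0 split: nat.split)
  show "Suc n \<le> degree (crit_poly n x)" by (rule le_degree) simp
qed

lemma root_poly_Suc: "root_poly (Suc n) x = root_poly n x * [:- x n, 1:]"
  by (simp add: root_poly_def)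

lemma root_poly_deriv_Suc:
  "root_poly_deriv (Suc n) c u = root_poly_deriv n c u * [:- c n, 1:] - smult (u n) (root_poly n c)"
proof -
  have "(\<Prod>l\<in>{..<Suc n}-{j}. [:- c l, 1:]) = (\<Prod>l\<in>{..<n}-{j}. [:- c l, 1:]) * [:- c n, 1:]" if "j < n" for j
  proof -
    have "{..<Suc n}-{j} = insert n ({..<n}-{j})" using that by auto
    then show ?thesis by (simp add: mult.commute)
  qed
  moreover have "{..<Suc n} - {n} = {..<n}" by auto
  ultimately show ?thesis
    by (simp add: root_poly_deriv_def root_poly_def sum_distrib_right minus_mult_left[symmetric] del: mult_pCons_right)
qed

section \<open>Continuity and first variation of the critical values\<close>

lemma coeffs_tendsto_root_poly:
  assumes "\<And>i. i < n \<Longrightarrow> ((\<lambda>k. x k i) \<longlongrightarrow> c i) F"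
  shows "coeffs_tendsto (\<lambda>k. root_poly n (x k)) (root_poly n c) F"
  unfolding root_poly_def using assms
  by (intro coeffs_tendsto_prod coeffs_tendsto_pCons coeffs_tendsto_const tendsto_intros) auto

lemma coeffs_tendsto_crit_poly:
  assumes "\<And>i. i \<le> n \<Longrightarrow> ((\<lambda>k. x k i) \<longlongrightarrow> c i) F"
  shows "coeffs_tendsto (\<lambda>k. crit_poly n (x k)) (crit_poly n c) F"
  unfolding crit_poly_def using assms
  by (intro coeffs_tendsto_add coeffs_tendsto_pCons coeffs_tendsto_const coeffs_tendsto_integral_poly
       coeffs_tendsto_smult coeffs_tendsto_root_poly tendsto_const) auto

lemma tendsto_crit_val:
  assumes "\<And>i. i \<le> n \<Longrightarrow> ((\<lambda>k. x k i) \<longlongrightarrow> c i) F" "i < n"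
  shows "((\<lambda>k. crit_val n (x k) i) \<longlongrightarrow> crit_val n c i) F"
  unfolding crit_val_def
  by (rule coeffs_tendsto_poly[OF coeffs_tendsto_crit_poly]) (use assms in auto)

text \<open>Both end points move, so this is strict differentiability, the form needed to compare
  two lifts. The induction is the product rule for the last linear factor.\<close>

lemma root_poly_difference_quotient:
  fixes \<delta> :: "'k \<Rightarrow> complex"
  assumes "\<And>i. i < n \<Longrightarrow> ((\<lambda>k. (x k i - y k i) / \<delta> k) \<longlongrightarrow> u i) F"
    and "\<And>i. i < n \<Longrightarrow> ((\<lambda>k. x k i) \<longlongrightarrow> c i) F" "\<And>i. i < n \<Longrightarrow> ((\<lambda>k. y k i) \<longlongrightarrow> c i) F"
  shows "coeffs_tendsto (\<lambda>k. smult (1 / \<delta> k) (root_poly n (x k) - root_poly n (y k))) (root_poly_deriv n c u) F"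
  using assms
proof (induction n)
  case 0
  show ?case by (simp add: root_poly_def root_poly_deriv_def coeffs_tendsto_const)
next
  case (Suc n)
  have eq: "smult (1 / \<delta> k) (root_poly (Suc n) (x k) - root_poly (Suc n) (y k)) =
     smult (1 / \<delta> k) (root_poly n (x k) - root_poly n (y k)) * [:- x k n, 1:]
       - smult ((x k n - y k n) / \<delta> k) (root_poly n (y k))" for k
  proof -
    have "[:- y k n, 1:] = [:- x k n, 1:] + [:x k n - y k n:]" by simp
    then have "root_poly (Suc n) (x k) - root_poly (Suc n) (y k) =
      (root_poly n (x k) - root_poly n (y k)) * [:- x k n, 1:] - smult (x k n - y k n) (root_poly n (y k))"
      unfolding root_poly_Suc by (simp only: left_diff_distrib distrib_left) simp
    moreover have "smult a (p * b - smult e r) = smult a p * b - smult (e * a) r" for a e and p b r :: "complex poly"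
      by (simp add: smult_diff_right mult.commute)
    ultimately show ?thesis by (simp only: times_divide_eq_right mult_1_right)
  qed
  have "coeffs_tendsto (\<lambda>k. [:- x k n, 1:]) [:- c n, 1:] F"
    by (intro coeffs_tendsto_pCons coeffs_tendsto_const tendsto_intros Suc.prems) auto
  moreover have "coeffs_tendsto (\<lambda>k. smult (1 / \<delta> k) (root_poly n (x k) - root_poly n (y k))) (root_poly_deriv n c u) F"
    by (rule Suc.IH) (use Suc.prems in auto)
  moreover have "coeffs_tendsto (\<lambda>k. smult ((x k n - y k n) / \<delta> k) (root_poly n (y k))) (smult (u n) (root_poly n c)) F"
    by (intro coeffs_tendsto_smult coeffs_tendsto_root_poly Suc.prems) auto
  ultimately show ?case unfolding eq root_poly_deriv_Suc
    by (intro coeffs_tendsto_diff coeffs_tendsto_mult)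
qed

lemma degree_root_poly_deriv: "degree (root_poly_deriv n c u) \<le> n"
proof -
  have "degree (smult (u j) (\<Prod>l\<in>{..<n}-{j}. [:- c l, 1:])) \<le> n" if "j < n" for j
    by (rule order_trans[OF degree_smult_le], subst degree_prod_eq_sum_degree) (use that in auto)
  then show ?thesis unfolding root_poly_deriv_def degree_minus by (intro degree_sum_le) auto
qed

lemma degree_integral_poly_le: "degree p \<le> n \<Longrightarrow> degree (integral_poly p) \<le> Suc n"
  by (rule degree_le) (auto simp: coeff_integral_poly coeff_eq_0 split: nat.split)

lemma degree_crit_poly_deriv: "degree (crit_poly_deriv n c u) \<le> Suc n"
  unfolding crit_poly_deriv_def
  by (intro degree_add_le degree_integral_poly_le order_trans[OF degree_smult_le] degree_root_poly_deriv) auto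

text \<open>The point of evaluation moves along with the polynomial, but its contribution tends to
  \<open>u i\<close> times the derivative at the critical point \<open>c i\<close>, which is 0. Only
  the deformation of the polynomial remains.\<close>

lemma crit_val_difference_quotient:
  fixes \<delta> :: "'k \<Rightarrow> complex"
  assumes u: "\<And>i. i \<le> n \<Longrightarrow> ((\<lambda>k. (x k i - y k i) / \<delta> k) \<longlongrightarrow> u i) F"
    and x: "\<And>i. i \<le> n \<Longrightarrow> ((\<lambda>k. x k i) \<longlongrightarrow> c i) F" and y: "\<And>i. i \<le> n \<Longrightarrow> ((\<lambda>k. y k i) \<longlongrightarrow> c i) F"
    and i: "i < n"
  shows "((\<lambda>k. (crit_val n (x k) i - crit_val n (y k) i) / \<delta> k) \<longlongrightarrow> poly (crit_poly_deriv n c u) (c i)) F"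
proof -
  define P where "P k = crit_poly n (x k)" for k
  define R where "R k = crit_poly n (y k)" for k
  have pq: "poly p a - poly p b = (a - b) * poly (synthetic_div p b) a" for p :: "complex poly" and a b
    using arg_cong[OF synthetic_div_correct'[of b p], of "\<lambda>q. poly q a"]
    by (simp add: algebra_simps)
  have eq: "(crit_val n (x k) i - crit_val n (y k) i) / \<delta> k =
      (x k i - y k i) / \<delta> k * poly (synthetic_div (P k) (y k i)) (x k i)
      + poly (smult (1 / \<delta> k) (P k - R k)) (y k i)" for k
  proof -
    have "crit_val n (x k) i - crit_val n (y k) i
       = (poly (P k) (x k i) - poly (P k) (y k i)) + poly (P k - R k) (y k i)"
      by (simp add: crit_val_def P_def R_def)
    also have "\<dots> = (x k i - y k i) * poly (synthetic_div (P k) (y k i)) (x k i) + poly (P k - R k) (y k i)"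
      by (simp only: pq)
    finally show ?thesis by (simp add: add_divide_distrib)
  qed
  have "((\<lambda>k. poly (synthetic_div (P k) (y k i)) (x k i)) \<longlongrightarrow> poly (synthetic_div (crit_poly n c) (c i)) (c i)) F"
    unfolding P_def
    by (rule coeffs_tendsto_poly[OF coeffs_tendsto_synthetic_div[OF coeffs_tendsto_crit_poly], where N = "Suc n"])
      (use x y i in \<open>auto simp: degree_synthetic_div\<close>)
  moreover have "poly (synthetic_div (crit_poly n c) (c i)) (c i) = 0"
    using i by (simp add: poly_synthetic_div_self poly_root_poly) (auto simp: prod_zero_iff)
  moreover have "((\<lambda>k. poly (smult (1 / \<delta> k) (P k - R k)) (y k i)) \<longlongrightarrow> poly (crit_poly_deriv n c u) (c i)) F"
  proof (rule coeffs_tendsto_poly[where N = "Suc n"])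
    have eq1: "smult (1 / \<delta> k) (P k - R k) = [:(x k n - y k n) / \<delta> k:]
        + integral_poly (smult (of_nat (Suc n)) (smult (1 / \<delta> k) (root_poly n (x k) - root_poly n (y k))))" for k
      by (rule poly_eqI) (auto simp: P_def R_def coeff_crit_poly coeff_integral_poly coeff_pCons
          right_diff_distrib diff_divide_distrib mult.commute simp del: of_nat_Suc split: nat.split)
    have "coeffs_tendsto (\<lambda>k. smult (1 / \<delta> k) (root_poly n (x k) - root_poly n (y k))) (root_poly_deriv n c u) F"
      by (intro root_poly_difference_quotient u x y less_imp_le)
    then have "coeffs_tendsto (\<lambda>k. [:(x k n - y k n) / \<delta> k:]
        + integral_poly (smult (of_nat (Suc n)) (smult (1 / \<delta> k) (root_poly n (x k) - root_poly n (y k)))))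
        (crit_poly_deriv n c u) F"
      unfolding crit_poly_deriv_def
      by (rule coeffs_tendsto_add[OF coeffs_tendsto_pCons[OF u coeffs_tendsto_const]
            coeffs_tendsto_integral_poly[OF coeffs_tendsto_smult[OF tendsto_const]], rotated]) simp
    then show "coeffs_tendsto (\<lambda>k. smult (1 / \<delta> k) (P k - R k)) (crit_poly_deriv n c u) F"
      by (simp only: eq1)
    show "degree (smult (1 / \<delta> k) (P k - R k)) \<le> Suc n" for k
      by (rule order_trans[OF degree_smult_le]) (simp add: P_def R_def degree_diff_le)
    show "((\<lambda>k. y k i) \<longlongrightarrow> c i) F" using y i by simp
  qed (rule degree_crit_poly_deriv)
  ultimately have "((\<lambda>k. (x k i - y k i) / \<delta> k * poly (synthetic_div (P k) (y k i)) (x k i)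
      + poly (smult (1 / \<delta> k) (P k - R k)) (y k i)) \<longlongrightarrow> u i * 0 + poly (crit_poly_deriv n c u) (c i)) F"
    using u[of i] i by (intro tendsto_intros) auto
  then show ?thesis unfolding eq by simp
qed

section \<open>Rigidity of critical values\<close>

lemma poly_eq_if_pderiv_eq:
  fixes p q :: "complex poly"
  assumes "pderiv p = pderiv q" "coeff p 0 = coeff q 0"
  shows "p = q"
  using integral_poly_pderiv[of p] integral_poly_pderiv[of q] assms by (metis diff_add_cancel)

lemma order_root_poly: "order a (root_poly n x) = card {i. i < n \<and> x i = a}"
proof -
  have "order a (root_poly n x) = count (proots (root_poly n x)) a" by simp
  also have "\<dots> = card {i\<in>{..<n}. x i = a}"
    unfolding proots_root_poly by (subst count_image_mset_eq_card_vimage) auto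
  finally show ?thesis by simp
qed

lemma crit_poly_neq_const [simp]: "crit_poly n x \<noteq> [:w:]"
proof
  assume "crit_poly n x = [:w:]"
  then have "degree (crit_poly n x) = degree [:w:]" by simp
  then show False by simp
qed

lemma order_crit_poly_minus:
  assumes "poly (crit_poly n x) a = w"
  shows "order a (crit_poly n x - [:w:]) = Suc (card {i. i < n \<and> x i = a})"
proof -
  have "pderiv (crit_poly n x - [:w:]) = smult (of_nat (Suc n)) (root_poly n x)"
    by (simp add: pderiv_diff pderiv_pCons del: of_nat_Suc)
  moreover have "smult (of_nat (Suc n)) (root_poly n x) \<noteq> 0" by (simp del: of_nat_Suc)
  moreover have "poly (crit_poly n x - [:w:]) a = 0" using assms by simp
  ultimately have "order a (crit_poly n x - [:w:]) = Suc (order a (smult (of_nat (Suc n)) (root_poly n x)))"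
    using order_pderiv[of "crit_poly n x - [:w:]" a] by simp
  then show ?thesis by (simp add: order_smult order_root_poly del: of_nat_Suc)
qed

text \<open>A critical point of multiplicity \<open>m\<close> is a root of multiplicity
  \<open>m + 1\<close> once its value is subtracted. The second summand records this extra copy, one
  for each distinct point.\<close>

lemma crit_points_subset_proots:
  assumes G: "G \<subseteq> {..<n}" and w: "\<And>i. i \<in> G \<Longrightarrow> crit_val n x i = w"
  shows "image_mset x (mset_set G) + mset_set (x ` G) \<subseteq># proots (crit_poly n x - [:w:])"
proof (rule mset_subset_eqI)
  fix a
  have fG: "finite G" using G finite_subset by blast
  show "count (image_mset x (mset_set G) + mset_set (x ` G)) a \<le> count (proots (crit_poly n x - [:w:])) a"
  proof (cases "a \<in> x ` G")
    case True
    then have "poly (crit_poly n x) a = w" using w by (auto simp: crit_val_def)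
    then have "count (proots (crit_poly n x - [:w:])) a = Suc (card {i. i < n \<and> x i = a})"
      by (simp add: order_crit_poly_minus)
    moreover have "card {i\<in>G. x i = a} \<le> card {i. i < n \<and> x i = a}"
      by (rule card_mono) (use G in auto)
    ultimately show ?thesis using True fG by (simp add: count_image_mset_eq_card_vimage)
  next
    case False
    then have "count (image_mset x (mset_set G)) a = 0" using fG by (auto simp: count_eq_zero_iff)
    then show ?thesis using False by simp
  qed
qed

lemma prod_linear_dvd_of_subset_proots:
  fixes p :: "complex poly"
  assumes "M \<subseteq># proots p"
  shows "(\<Prod>a\<in>#M. [:- a, 1:]) dvd p"
proof -
  have "(\<Prod>a\<in>#M. [:- a, 1:]) dvd (\<Prod>a\<in>#proots p. [:- a, 1:])"
    by (intro prod_mset_subset_imp_dvd image_mset_subseteq_mono assms)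
  then have "(\<Prod>a\<in>#M. [:- a, 1:]) dvd smult (lead_coeff p) (\<Prod>a\<in>#proots p. [:- a, 1:])"
    by (rule dvd_smult)
  then show ?thesis by (simp only: complex_poly_decompose_multiset)
qed

text \<open>If two of the critical points near \<open>c i\<close> stayed distinct while their values agree, then in the limit
  the multiplicity of \<open>c i\<close> as a root of the polynomial minus its value would be too large.\<close>
lemma eventually_crit_points_merge:
  fixes x :: "nat \<Rightarrow> nat \<Rightarrow> complex"
  assumes lim: "\<And>l. l \<le> n \<Longrightarrow> (\<lambda>k. x k l) \<longlonglongrightarrow> c l"
    and ij: "i < n" "j < n" "c i = c j"
    and val: "\<And>k l. l < n \<Longrightarrow> c l = c i \<Longrightarrow> crit_val n (x k) l = crit_val n (x k) i"
  shows "\<forall>\<^sub>F k in sequentially. x k i = x k j"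
proof (rule ccontr)
  assume "\<not> ?thesis"
  then obtain r :: "nat \<Rightarrow> nat" where r: "strict_mono r" "\<And>k. x (r k) i \<noteq> x (r k) j"
    by (blast dest: not_eventually_sequentiallyD)
  define G where "G = {l. l < n \<and> c l = c i}"
  have G: "G \<subseteq> {..<n}" "finite G" "i \<in> G" "j \<in> G" using ij by (auto simp: G_def)
  obtain ls where "mset ls = mset_set G" using ex_mset by blast
  then have ls: "mset ls = mset_set G" "set ls = G" "length ls = card G"
    by (auto simp: G(2) simp flip: set_mset_mset size_mset)
  \<comment> \<open>The whole group with \<open>i\<close> and \<open>j\<close> listed once more:
    \<open>card G + 2\<close> roots. Two distinct points of the group yield two extra copies, while
    the limit point \<open>c i\<close> allows only one.\<close>
  define fs where "fs = (\<lambda>k. x (r k) i) # (\<lambda>k. x (r k) j) # map (\<lambda>l k. x (r k) l) ls"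
  define P where "P k = crit_poly n (x (r k)) - [:crit_val n (x (r k)) i:]" for k
  have lim': "(\<lambda>k. x (r k) l) \<longlonglongrightarrow> c l" if "l \<le> n" for l
    using LIMSEQ_subseq_LIMSEQ[OF lim[OF that] r(1)] by (simp add: o_def)
  have "[:- c i, 1:] ^ length fs dvd crit_poly n c - [:crit_val n c i:]"
  proof (rule power_dvd_of_limit)
    show "(f \<longlonglongrightarrow> c i)" if "f \<in> set fs" for f
    proof -
      have "\<exists>l. l < n \<and> c l = c i \<and> f = (\<lambda>k. x (r k) l)"
        using that ij ls by (auto simp: fs_def G_def)
      then show ?thesis using lim' by (metis less_imp_le)
    qed
    show "coeffs_tendsto P (crit_poly n c - [:crit_val n c i:]) sequentially"
      unfolding P_def using lim' ij
      by (intro coeffs_tendsto_diff coeffs_tendsto_crit_poly coeffs_tendsto_pCons coeffs_tendsto_const tendsto_crit_val) auto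
    show "degree (P k) \<le> Suc n" for k unfolding P_def by (rule degree_diff_le) auto
    show "degree (crit_poly n c - [:crit_val n c i:]) \<le> Suc n" by (rule degree_diff_le) auto
    show "(\<Prod>f\<leftarrow>fs. [:- f k, 1:]) dvd P k" for k
    proof -
      have "{#x (r k) i, x (r k) j#} \<subseteq># mset_set (x (r k) ` G)"
      proof -
        have "{#x (r k) i, x (r k) j#} = mset_set {x (r k) i, x (r k) j}"
          using r(2)[of k] by (auto simp: multiset_eq_iff)
        then show ?thesis using G by (simp only:) (intro subset_imp_msubset_mset_set; auto)
      qed
      then have "image_mset (x (r k)) (mset_set G) + {#x (r k) i, x (r k) j#} \<subseteq># image_mset (x (r k)) (mset_set G) + mset_set (x (r k) ` G)"
        by (rule subset_mset.add_left_mono)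
      also have "\<dots> \<subseteq># proots (P k)"
        unfolding P_def
      proof (rule crit_points_subset_proots[OF G(1)])
        show "crit_val n (x (r k)) l = crit_val n (x (r k)) i" if "l \<in> G" for l
          by (rule val) (use that in \<open>auto simp: G_def\<close>)
      qed
      finally have "(\<Prod>a\<in>#image_mset (x (r k)) (mset_set G) + {#x (r k) i, x (r k) j#}. [:- a, 1:]) dvd P k"
        by (rule prod_linear_dvd_of_subset_proots)
      moreover have "image_mset (x (r k)) (mset_set G) + {#x (r k) i, x (r k) j#} = mset (map (\<lambda>f. f k) fs)"
        using ls by (simp add: fs_def o_def mset_map)
      ultimately have "(\<Prod>a\<in>#mset (map (\<lambda>f. f k) fs). [:- a, 1:]) dvd P k" by (simp only:)
      then show ?thesis unfolding mset_map[symmetric] prod_mset_prod_list map_map o_def .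
    qed
  qed simp
  then have "length fs \<le> order (c i) (crit_poly n c - [:crit_val n c i:])"
    by (simp add: order_divides)
  also have "\<dots> = Suc (card G)"
    by (simp add: order_crit_poly_minus crit_val_def G_def)
  finally show False using ls by (simp add: fs_def)
qed

text \<open>After the common value is subtracted, the roots include all \<open>n\<close> critical
  points and an extra copy of each distinct one, but the degree is only \<open>n + 1\<close>. So
  there is a single distinct point, and centring puts it at 0.\<close>

lemma crit_points_zero_if_values_equal:
  assumes x: "x \<in> crit_space n" and w: "\<And>i. i < n \<Longrightarrow> crit_val n x i = w" and i: "i < n"
  shows "x i = 0"
proof -
  have "size (image_mset x (mset_set {..<n}) + mset_set (x ` {..<n})) \<le> size (proots (crit_poly n x - [:w:]))"
    by (intro size_mset_mono crit_points_subset_proots) (use w in auto)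
  also have "\<dots> \<le> degree (crit_poly n x - [:w:])" by (rule size_proots_le)
  also have "\<dots> \<le> Suc n" by (rule degree_diff_le) auto
  finally have "card (x ` {..<n}) \<le> 1" by simp
  then have "\<forall>a\<in>x ` {..<n}. \<forall>b\<in>x ` {..<n}. a = b"
    unfolding One_nat_def card_le_Suc0_iff_eq[OF finite_imageI[OF finite_lessThan]] .
  then have "x j = x i" if "j < n" for j
    using that i by blast
  then have "(\<Sum>j<n. x j) = (\<Sum>j<n. x i)" by (intro sum.cong refl) blast
  then show ?thesis using x i by (simp add: crit_space_def)
qed

text \<open>\<open>R\<close> is the greatest common divisor of \<open>root_poly n c\<close> and its
  derivative. Each product in \<open>root_poly_deriv\<close> omits one factor, so every distinct
  point keeps at least all but one of its copies; what is left involves each distinct point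
  once.\<close>

lemma root_poly_deriv_factorization:
  fixes c u :: "nat \<Rightarrow> complex" and n :: nat
  defines "A \<equiv> c ` {..<n}"
  defines "R \<equiv> (\<Prod>a\<in>A. [:- a, 1:] ^ (card {l. l < n \<and> c l = a} - 1))"
  shows "root_poly_deriv n c u = - (R * (\<Sum>j<n. smult (u j) (\<Prod>b\<in>A - {c j}. [:- b, 1:])))"
proof -
  have A: "finite A" by (simp add: A_def)
  have "root_poly n c = (\<Prod>a\<in>A. \<Prod>l\<in>{l\<in>{..<n}. c l = a}. [:- c l, 1:])"
    unfolding root_poly_def A_def by (rule prod.image_gen) simp
  also have "\<dots> = (\<Prod>a\<in>A. [:- a, 1:] ^ (card {l. l < n \<and> c l = a} - 1) * [:- a, 1:])"
  proof (rule prod.cong[OF refl])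
    fix a assume "a \<in> A"
    then have "card {l. l < n \<and> c l = a} \<noteq> 0" by (auto simp: A_def)
    then obtain m where m: "card {l. l < n \<and> c l = a} = Suc m" using not0_implies_Suc by blast
    have "(\<Prod>l\<in>{l\<in>{..<n}. c l = a}. [:- c l, 1:]) = (\<Prod>l\<in>{l. l < n \<and> c l = a}. [:- a, 1:])"
      by (rule prod.cong) auto
    also have "\<dots> = [:- a, 1:] ^ m * [:- a, 1:]"
      by (simp only: prod_constant m power_Suc2)
    finally show "(\<Prod>l\<in>{l\<in>{..<n}. c l = a}. [:- c l, 1:]) = [:- a, 1:] ^ (card {l. l < n \<and> c l = a} - 1) * [:- a, 1:]"
      by (simp only: m diff_Suc_1)
  qed
  also have "\<dots> = R * (\<Prod>a\<in>A. [:- a, 1:])" by (simp only: prod.distrib R_def)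
  finally have Q: "root_poly n c = R * (\<Prod>a\<in>A. [:- a, 1:])" .
  have "(\<Prod>l\<in>{..<n}-{j}. [:- c l, 1:]) = R * (\<Prod>b\<in>A - {c j}. [:- b, 1:])" if j: "j < n" for j
  proof -
    have "[:- c j, 1:] * (\<Prod>l\<in>{..<n}-{j}. [:- c l, 1:]) = root_poly n c"
      unfolding root_poly_def by (rule prod.remove[symmetric]) (use j in auto)
    also have "(\<Prod>a\<in>A. [:- a, 1:]) = [:- c j, 1:] * (\<Prod>b\<in>A - {c j}. [:- b, 1:])"
      by (rule prod.remove) (use j A in \<open>auto simp: A_def\<close>)
    then have "root_poly n c = [:- c j, 1:] * (R * (\<Prod>b\<in>A - {c j}. [:- b, 1:]))"
      unfolding Q by (simp only: mult.left_commute)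
    finally show ?thesis by (simp only: mult_cancel_left pCons_eq_0_iff one_neq_zero simp_thms)
  qed
  then show ?thesis
    unfolding root_poly_deriv_def sum_distrib_left by (intro arg_cong[of _ _ uminus] sum.cong) auto
qed

text \<open>The coefficient at \<open>n - 1\<close> is minus the sum of the \<open>u i\<close>. A
  centred direction loses it, and so the deformation \<open>H\<close> ends up with a degree below
  \<open>n\<close>.\<close>

lemma coeff_root_poly_deriv:
  assumes "n \<ge> 1" "(\<Sum>i<n. u i) = 0" "m \<ge> n - 1"
  shows "coeff (root_poly_deriv n c u) m = 0"
proof -
  have deg: "degree (\<Prod>l\<in>{..<n}-{j}. [:- c l, 1:]) = n - 1" if "j < n" for j
    using that by (subst degree_prod_eq_sum_degree) auto
  have lc: "lead_coeff (\<Prod>l\<in>{..<n}-{j}. [:- c l, 1:]) = 1" for j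
    by (simp only: lead_coeff_prod) simp
  have "coeff (\<Prod>l\<in>{..<n}-{j}. [:- c l, 1:]) m = (if m = n - 1 then 1 else 0)" if "j < n" for j
    using deg[OF that] lc[of j] assms(3) by (auto simp: coeff_eq_0)
  then have "coeff (root_poly_deriv n c u) m = - (\<Sum>j<n. u j * (if m = n - 1 then 1 else 0))"
    by (simp add: root_poly_deriv_def coeff_sum)
  also have "\<dots> = 0" using assms(2) by (simp add: sum_distrib_right[symmetric])
  finally show ?thesis .
qed

text \<open>At a point \<open>a\<close> of multiplicity \<open>m\<close> the derivative of
  \<open>H\<close> is divisible by \<open>(X - a)^(m-1)\<close> and \<open>H\<close> vanishes, so
  \<open>H\<close> has order at least \<open>m\<close> there; these are too many roots. The
  hypothesis \<open>grp\<close> enters once \<open>H = 0\<close> is known, which by itself only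
  makes the sum of \<open>u\<close> over each group vanish.\<close>

lemma crit_poly_deriv_injective:
  assumes n: "n \<ge> 1" and grp: "\<And>i j. i < n \<Longrightarrow> j < n \<Longrightarrow> c i = c j \<Longrightarrow> u i = u j"
    and sum0: "(\<Sum>i<n. u i) = 0" and root: "\<And>i. i < n \<Longrightarrow> poly (crit_poly_deriv n c u) (c i) = 0"
    and i: "i \<le> n"
  shows "u i = 0"
proof -
  define A where "A = c ` {..<n}"
  define R where "R = (\<Prod>a\<in>A. [:- a, 1:] ^ (card {l. l < n \<and> c l = a} - 1))"
  define S where "S = (\<Sum>j<n. smult (u j) (\<Prod>b\<in>A - {c j}. [:- b, 1:]))"
  define D where "D = root_poly_deriv n c u"
  define H where "H = crit_poly_deriv n c u"
  have A: "finite A" by (simp add: A_def)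
  have D: "D = - (R * S)" unfolding D_def R_def S_def A_def by (rule root_poly_deriv_factorization)
  have coeffH: "coeff H m = (case m of 0 \<Rightarrow> u n | Suc k \<Rightarrow> of_nat (Suc n) * coeff D k / of_nat (Suc k))" for m
    by (auto simp: H_def D_def crit_poly_deriv_def coeff_integral_poly split: nat.split)
  have pdH: "pderiv H = smult (of_nat (Suc n)) D"
    by (simp add: H_def D_def crit_poly_deriv_def pderiv_add pderiv_pCons)
  have H0: "H = 0"
  proof (rule ccontr)
    assume nz: "H \<noteq> 0"
    have D0: "D \<noteq> 0"
    proof
      assume "D = 0"
      then have "H = [:u n:]"
        by (intro poly_eqI) (auto simp: coeffH coeff_pCons split: nat.split)
      then show False using nz root[of 0] n by (simp add: H_def)
    qed
    have "proots (root_poly n c) \<subseteq># proots H"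
    proof (rule mset_subset_eqI)
      fix a
      show "count (proots (root_poly n c)) a \<le> count (proots H) a"
      proof (cases "a \<in> A")
        case True
        then have "poly H a = 0" using root by (auto simp: A_def H_def)
        then have "order a H = Suc (order a D)"
          using order_pderiv[of H a] nz by (simp add: pdH order_smult del: of_nat_Suc)
        moreover have "[:- a, 1:] ^ (card {l. l < n \<and> c l = a} - 1) dvd D"
          unfolding D R_def using True A by (auto intro!: dvd_mult2 dvd_prodI)
        then have "card {l. l < n \<and> c l = a} - 1 \<le> order a D" using D0 by (simp add: order_divides)
        ultimately show ?thesis using nz by (simp add: order_root_poly)
      next
        case False
        then have "{l. l < n \<and> c l = a} = {}" by (auto simp: A_def)
        then have "card {l. l < n \<and> c l = a} = 0" by (simp only: card.empty)
        then show ?thesis by (simp only: count_proots[OF root_poly_nz] order_root_poly le0)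
      qed
    qed
    then have "n \<le> size (proots H)" using size_mset_mono by (fastforce simp: proots_root_poly)
    also have "\<dots> \<le> degree H" by (rule size_proots_le)
    also have "\<dots> \<le> n - 1"
    proof (rule degree_le, intro allI impI)
      fix m assume "n - 1 < m"
      then obtain k where k: "m = Suc k" "k \<ge> n - 1" by (cases m) auto
      then show "coeff H m = 0" using coeff_root_poly_deriv[OF n sum0 k(2)] by (simp add: coeffH D_def)
    qed
    finally show False using n by simp
  qed
  show ?thesis
  proof (cases "i = n")
    case True
    then show ?thesis using coeffH[of 0] H0 by simp
  next
    case False
    then have i: "i < n" using i by simp
    have "smult (of_nat (Suc n)) D = 0" using pdH H0 by simp
    then have "D = 0" by (simp del: of_nat_Suc)
    moreover have "R \<noteq> 0" using A by (simp add: R_def)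
    ultimately have "S = 0" using D by simp
    define K where "K = (\<Prod>b\<in>A - {c i}. c i - b)"
    have "K \<noteq> 0" using A by (auto simp: K_def)
    \<comment> \<open>At \<open>c i\<close> only the summands of the group of \<open>i\<close>
      survive. By \<open>grp\<close> they are all equal, so they cannot cancel.\<close>
    have "0 = (\<Sum>j<n. u j * (\<Prod>b\<in>A - {c j}. c i - b))"
      using arg_cong[OF \<open>S = 0\<close>, of "\<lambda>p. poly p (c i)"] unfolding S_def poly_sum poly_smult poly_prod by simp
    also have "\<dots> = (\<Sum>j<n. if c j = c i then u i * K else 0)"
    proof (rule sum.cong[OF refl])
      fix j assume j: "j \<in> {..<n}"
      show "u j * (\<Prod>b\<in>A - {c j}. c i - b) = (if c j = c i then u i * K else 0)"
      proof (cases "c j = c i")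
        case True
        then show ?thesis using grp[of j i] i j by (simp add: K_def)
      next
        case False
        then have "c i \<in> A - {c j}" using i by (auto simp: A_def)
        then show ?thesis using False A by (auto simp: prod_zero_iff)
      qed
    qed
    also have "\<dots> = of_nat (card {j. j < n \<and> c j = c i}) * (u i * K)"
      by (simp add: sum.If_cases Int_def)
    finally have "card {j. j < n \<and> c j = c i} = 0 \<or> u i = 0" using \<open>K \<noteq> 0\<close> by auto
    moreover have "card {j. j < n \<and> c j = c i} \<noteq> 0" using i by auto
    ultimately show ?thesis by blast
  qed
qed

section \<open>Sequences of tuples and local rigidity\<close>

lemma tendsto_coordinate:
  fixes x :: "nat \<Rightarrow> nat \<Rightarrow> complex"
  assumes "x \<longlonglongrightarrow> c"
  shows "(\<lambda>k. x k i) \<longlonglongrightarrow> c i"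
proof -
  have "isCont (\<lambda>f :: nat \<Rightarrow> complex. f i) c"
    by (metis UNIV_I continuous_on_eq_continuous_at continuous_on_product_coordinates open_UNIV)
  from isCont_tendsto_compose[OF this assms] show ?thesis .
qed

text \<open>A product of countably many discs is metrizable, so here compactness does give a
  convergent subsequence.\<close>

lemma bounded_tuples_subsequence:
  fixes x :: "nat \<Rightarrow> nat \<Rightarrow> complex"
  assumes "\<And>k i. norm (x k i) \<le> R i"
  shows "\<exists>c r. strict_mono (r :: nat \<Rightarrow> nat) \<and> (\<forall>i. (\<lambda>k. x (r k) i) \<longlonglongrightarrow> c i)"
proof -
  have "compactin (product_topology (\<lambda>_. euclidean) UNIV) (Pi\<^sub>E UNIV (\<lambda>i::nat. cball (0::complex) (R i)))"
    unfolding compactin_PiE by (simp add: compactin_euclidean_iff)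
  then have "seq_compact (Pi\<^sub>E UNIV (\<lambda>i::nat. cball (0::complex) (R i)))"
    by (simp add: euclidean_product_topology compactin_euclidean_iff compact_imp_seq_compact)
  moreover have "x k \<in> Pi\<^sub>E UNIV (\<lambda>i::nat. cball (0::complex) (R i))" for k
    using assms by auto
  ultimately obtain c r where "strict_mono (r :: nat \<Rightarrow> nat)" "(x \<circ> r) \<longlonglongrightarrow> c"
    by (meson seq_compactE)
  then show ?thesis using tendsto_coordinate[of "x \<circ> r" c] by (auto simp: o_def)
qed

lemma tuple_eqI_crit_space:
  assumes "x \<in> crit_space n" "y \<in> crit_space n" "\<And>i. i \<le> n \<Longrightarrow> x i = y i"
  shows "x = y"
proof
  show "x i = y i" for i using assms by (cases "i \<le> n") (auto simp: crit_space_def)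
qed

lemma crit_space_closed:
  assumes "\<And>k. x k \<in> crit_space n" "\<And>i. (\<lambda>k. x k i) \<longlonglongrightarrow> c i"
  shows "c \<in> crit_space n"
proof -
  have "c i = 0" if "i > n" for i
    using assms that by (auto simp: crit_space_def intro!: LIMSEQ_unique[of "\<lambda>k. x k i"])
  moreover have "(\<lambda>k. \<Sum>i<n. x k i) \<longlonglongrightarrow> (\<Sum>i<n. c i)" by (intro tendsto_intros assms)
  then have "(\<Sum>i<n. c i) = 0"
    using assms(1) LIMSEQ_unique[of "\<lambda>k. \<Sum>i<n. x k i" _ 0] by (auto simp: crit_space_def)
  ultimately show ?thesis by (simp add: crit_space_def)
qed

text \<open>By \<open>eventually_crit_points_merge\<close> the critical points merge in the pattern of \<open>c\<close>, so the normalized differences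
  converge to a direction constant on groups, killed by the derivative and hence zero by \<open>crit_poly_deriv_injective\<close>.\<close>
lemma eventually_eq_if_crit_val_eq:
  fixes x y :: "nat \<Rightarrow> nat \<Rightarrow> complex"
  assumes n: "n \<ge> 1" and xs: "\<And>k. x k \<in> crit_space n" and ys: "\<And>k. y k \<in> crit_space n"
    and xl: "\<And>i. i \<le> n \<Longrightarrow> (\<lambda>k. x k i) \<longlonglongrightarrow> c i" and yl: "\<And>i. i \<le> n \<Longrightarrow> (\<lambda>k. y k i) \<longlonglongrightarrow> c i"
    and eq: "\<And>k i. i < n \<Longrightarrow> crit_val n (x k) i = crit_val n (y k) i"
    and grp: "\<And>k i j. i < n \<Longrightarrow> j < n \<Longrightarrow> c i = c j \<Longrightarrow> crit_val n (x k) i = crit_val n (x k) j"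
  shows "\<forall>\<^sub>F k in sequentially. x k = y k"
proof (rule ccontr)
  assume neg: "\<not> ?thesis"
  define M where "M k \<longleftrightarrow> (\<forall>i\<in>{..<n}. \<forall>j\<in>{..<n}. c i = c j \<longrightarrow> x k i = x k j \<and> y k i = y k j)" for k
  have "\<forall>\<^sub>F k in sequentially. c i = c j \<longrightarrow> x k i = x k j \<and> y k i = y k j" if "i \<in> {..<n}" "j \<in> {..<n}" for i j
  proof (cases "c i = c j")
    case True
    have "\<forall>\<^sub>F k in sequentially. x k i = x k j"
      by (rule eventually_crit_points_merge[OF xl _ _ True]) (use that grp in auto)
    moreover have "\<forall>\<^sub>F k in sequentially. y k i = y k j"
    proof (rule eventually_crit_points_merge[OF yl _ _ True])
      show "crit_val n (y k) l = crit_val n (y k) i" if "l < n" "c l = c i" for k l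
        using eq[of l k] eq[of i k] grp[of l i k] that \<open>i \<in> {..<n}\<close> by simp
    qed (use that in auto)
    ultimately show ?thesis by eventually_elim blast
  qed simp
  then have "\<forall>\<^sub>F k in sequentially. M k" unfolding M_def by (simp add: eventually_ball_finite_distrib)
  then have "\<forall>\<^sub>F k in sequentially. x k = y k" if "\<forall>\<^sub>F k in sequentially. \<not> (M k \<and> x k \<noteq> y k)"
    using that by eventually_elim blast
  then have "\<not> (\<forall>\<^sub>F k in sequentially. \<not> (M k \<and> x k \<noteq> y k))" using neg by blast
  \<comment> \<open>Unequal pairs occur infinitely often and \<open>M\<close> holds from some index
    on, so one subsequence has both.\<close>
  then obtain r :: "nat \<Rightarrow> nat" where r: "strict_mono r" "\<And>k. M (r k)" "\<And>k. x (r k) \<noteq> y (r k)"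
    by (blast dest: not_eventually_sequentiallyD)
  \<comment> \<open>The constant term is included, so \<open>\<delta> k\<close> vanishes only for
    equal tuples. The normalized differences have norms summing to 1, and this passes to their limit
    \<open>u\<close>.\<close>
  define \<delta> where "\<delta> k = (\<Sum>i\<le>n. norm (x (r k) i - y (r k) i))" for k
  have d0: "\<delta> k > 0" for k
  proof -
    obtain i where "i \<le> n" "x (r k) i \<noteq> y (r k) i"
      using tuple_eqI_crit_space[OF xs ys] r(3) by blast
    then show ?thesis unfolding \<delta>_def by (intro sum_pos2[of _ i]) auto
  qed
  define v where "v k i = (x (r k) i - y (r k) i) / of_real (\<delta> k)" for k i
  have vs: "(\<Sum>i\<le>n. norm (v k i)) = 1" for k
    using d0[of k] by (simp add: v_def norm_divide sum_divide_distrib[symmetric]) (simp add: \<delta>_def)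
  have vb: "norm (v k i) \<le> 1" for k i
  proof (cases "i \<le> n")
    case True
    then have "norm (v k i) \<le> (\<Sum>i\<le>n. norm (v k i))" by (intro member_le_sum) auto
    then show ?thesis using vs by simp
  next
    case False
    then show ?thesis using xs[of "r k"] ys[of "r k"] by (simp add: v_def crit_space_def)
  qed
  obtain u s where s: "strict_mono (s :: nat \<Rightarrow> nat)" "\<And>i. (\<lambda>k. v (s k) i) \<longlonglongrightarrow> u i"
    using bounded_tuples_subsequence[of v "\<lambda>_. 1"] vb by blast
  have rs: "strict_mono (\<lambda>k. r (s k))" using r(1) s(1) by (simp add: strict_mono_def)
  have "u i = 0" if "i \<le> n" for i
  proof (rule crit_poly_deriv_injective[OF n _ _ _ that, of c])
    show "u i = u j" if "i < n" "j < n" "c i = c j" for i j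
    proof -
      have "v k i = v k j" for k
        using r(2)[of k] that unfolding M_def v_def by (metis lessThan_iff)
      then have "(\<lambda>k. v (s k) j) \<longlonglongrightarrow> u i" using s(2)[of i] by simp
      then show ?thesis by (rule LIMSEQ_unique[OF _ s(2)])
    qed
    have "(\<lambda>k. \<Sum>i<n. v (s k) i) \<longlonglongrightarrow> (\<Sum>i<n. u i)" by (intro tendsto_intros s)
    moreover have "(\<Sum>i<n. v k i) = 0" for k
      using xs[of "r k"] ys[of "r k"]
      by (simp add: v_def sum_divide_distrib[symmetric] sum_subtractf crit_space_def)
    ultimately show "(\<Sum>i<n. u i) = 0" using LIMSEQ_unique[of "\<lambda>k. \<Sum>i<n. v (s k) i" _ 0] by simp
    show "poly (crit_poly_deriv n c u) (c i) = 0" if "i < n" for i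
    proof -
      have "(\<lambda>k. (crit_val n (x (r (s k))) i - crit_val n (y (r (s k))) i) / of_real (\<delta> (s k))) \<longlonglongrightarrow> poly (crit_poly_deriv n c u) (c i)"
      proof (rule crit_val_difference_quotient)
        show "(\<lambda>k. (x (r (s k)) i - y (r (s k)) i) / of_real (\<delta> (s k))) \<longlonglongrightarrow> u i" for i
          using s(2)[of i] by (simp add: v_def)
        show "(\<lambda>k. x (r (s k)) i) \<longlonglongrightarrow> c i" if "i \<le> n" for i
          using LIMSEQ_subseq_LIMSEQ[OF xl[OF that] rs] by (simp add: o_def)
        show "(\<lambda>k. y (r (s k)) i) \<longlonglongrightarrow> c i" if "i \<le> n" for i
          using LIMSEQ_subseq_LIMSEQ[OF yl[OF that] rs] by (simp add: o_def)
      qed (rule that)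
      then show ?thesis using eq[OF that] LIMSEQ_unique[OF _ tendsto_const] by simp
    qed
  qed
  moreover have "(\<lambda>k. \<Sum>i\<le>n. norm (v (s k) i)) \<longlonglongrightarrow> (\<Sum>i\<le>n. norm (u i))"
    by (intro tendsto_intros s)
  then have "(\<Sum>i\<le>n. norm (u i)) = 1" using vs LIMSEQ_unique[OF _ tendsto_const] by simp
  ultimately show False by simp
qed

text \<open>Rigidity against the constant sequence \<open>c\<close>. The values are fixed, and
  indices whose points coincide in \<open>c\<close> have equal entries in \<open>w\<close>, so the
  grouping hypothesis holds.\<close>

lemma crit_val_fiber_isolated:
  fixes x :: "nat \<Rightarrow> nat \<Rightarrow> complex"
  assumes n: "n \<ge> 1" and xs: "\<And>k. x k \<in> crit_space n"
    and xl: "\<And>i. (\<lambda>k. x k i) \<longlonglongrightarrow> c i"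
    and eq: "\<And>k i. i < n \<Longrightarrow> crit_val n (x k) i = w i"
  shows "\<forall>\<^sub>F k in sequentially. x k = c"
proof -
  have c: "c \<in> crit_space n" by (rule crit_space_closed[OF xs xl])
  have w: "crit_val n c i = w i" if "i < n" for i
    using tendsto_crit_val[of n x c sequentially i] xl that eq[OF that] LIMSEQ_unique[OF _ tendsto_const]
    by simp
  show ?thesis
  proof (rule eventually_eq_if_crit_val_eq[OF n xs c xl])
    show "crit_val n (x k) i = crit_val n (x k) j" if "i < n" "j < n" "c i = c j" for k i j
      using that w[of i] w[of j] by (simp add: eq) (simp add: crit_val_def)
  qed (use w eq in auto)
qed

text \<open>Passing from \<open>p(t)\<close> to \<open>s^(n+1) p(t/s)\<close> gives critical points
  the weight 1, and the constant term and the critical values the weight \<open>n + 1\<close>.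
  Composition with \<open>[:0, s:]\<close> expresses this without division.\<close>

lemma crit_val_scale:
  assumes i: "i < n"
  shows "crit_val n (\<lambda>i. if i < n then s * x i else s ^ Suc n * x i) i = s ^ Suc n * crit_val n x i"
proof -
  define z where "z = (\<lambda>i. if i < n then s * x i else s ^ Suc n * x i)"
  have "pcompose (crit_poly n z) [:0, s:] = smult (s ^ Suc n) (crit_poly n x)"
  proof (rule poly_eq_if_pderiv_eq)
    have "poly (pcompose (root_poly n z) [:0, s:]) t = poly (smult (s ^ n) (root_poly n x)) t" for t
    proof -
      have "(\<Prod>i<n. t * s - z i) = (\<Prod>i<n. s * (t - x i))"
        by (intro prod.cong) (auto simp: z_def algebra_simps)
      then show ?thesis by (simp add: poly_pcompose poly_root_poly prod.distrib)
    qed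
    then have "pcompose (root_poly n z) [:0, s:] = smult (s ^ n) (root_poly n x)"
      by (simp add: poly_eq_poly_eq_iff[symmetric] fun_eq_iff)
    then show "pderiv (pcompose (crit_poly n z) [:0, s:]) = pderiv (smult (s ^ Suc n) (crit_poly n x))"
      by (simp add: pderiv_pcompose pderiv_smult pderiv_pCons pcompose_smult ac_simps del: of_nat_Suc)
    show "coeff (pcompose (crit_poly n z) [:0, s:]) 0 = coeff (smult (s ^ Suc n) (crit_poly n x)) 0"
      by (simp add: coeff_pcompose_0 poly_0_coeff_0 coeff_crit_poly z_def)
  qed
  then have "poly (pcompose (crit_poly n z) [:0, s:]) (x i) = poly (smult (s ^ Suc n) (crit_poly n x)) (x i)" by simp
  then show ?thesis using i by (simp add: poly_pcompose crit_val_def z_def mult.commute)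
qed

text \<open>Rescaling reduces properness to the fact that a nonzero tuple does not have all critical values 0.\<close>
lemma crit_val_proper:
  assumes n: "n \<ge> 1"
  shows "\<exists>B. \<forall>x\<in>crit_space n. (\<forall>i<n. norm (crit_val n x i) \<le> R) \<longrightarrow> (\<forall>i\<le>n. norm (x i) \<le> B)"
proof (rule ccontr)
  assume neg: "\<not> ?thesis"
  \<comment> \<open>A gauge adapted to the weights: the root of order \<open>n + 1\<close> makes the
    constant term scale like a critical point, so \<open>N\<close> is homogeneous of degree 1 under
    positive scaling.\<close>
  define N where "N x = (\<Sum>i<n. norm (x i)) + root (Suc n) (norm (x n))" for x :: "nat \<Rightarrow> complex"
  have "\<exists>x. x \<in> crit_space n \<and> (\<forall>i<n. norm (crit_val n x i) \<le> R) \<and> real (Suc k) \<le> N x" for k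
  proof -
    \<comment> \<open>The bound \<open>(k+1)^(n+1)\<close> serves both kinds of coordinates: for the
      constant term its root is \<open>k + 1\<close>, and for a critical point the power dominates
      \<open>k + 1\<close>.\<close>
    obtain x i where x: "x \<in> crit_space n" "\<forall>i<n. norm (crit_val n x i) \<le> R" "i \<le> n" "real (Suc k) ^ Suc n < norm (x i)"
      using neg by (meson not_le)
    have s: "0 \<le> (\<Sum>i<n. norm (x i))" by (intro sum_nonneg) auto
    have "real (Suc k) \<le> N x"
    proof (cases "i = n")
      case True
      have "real (Suc k) = root (Suc n) (real (Suc k) ^ Suc n)" by (intro real_root_power_cancel[symmetric]) auto
      also have "\<dots> \<le> root (Suc n) (norm (x n))" using x(4) True by (intro real_root_le_mono) auto
      finally show ?thesis using s by (simp add: N_def)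
    next
      case False
      have "real (Suc k) \<le> real (Suc k) ^ Suc n" by (intro self_le_power) auto
      also have "\<dots> \<le> norm (x i)" using x(4) by simp
      also have "\<dots> \<le> (\<Sum>i<n. norm (x i))" using False x(3) by (intro member_le_sum) auto
      also have "\<dots> \<le> N x" by (simp add: N_def)
      finally show ?thesis .
    qed
    then show ?thesis using x by blast
  qed
  then obtain x where x: "\<And>k. x k \<in> crit_space n" "\<And>k i. i < n \<Longrightarrow> norm (crit_val n (x k) i) \<le> R"
      "\<And>k. real (Suc k) \<le> N (x k)" by metis
  define s where "s k = 1 / N (x k)" for k
  have s: "s k > 0" "s k \<le> inverse (real (Suc k))" for k
  proof -
    have "0 < real (Suc k)" by simp
    then show "s k > 0" unfolding s_def using x(3)[of k] by (intro divide_pos_pos) linarith+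
    show "s k \<le> inverse (real (Suc k))" unfolding s_def using x(3)[of k] by (simp add: field_simps frac_le)
  qed
  define z where "z k = (\<lambda>i. if i < n then of_real (s k) * x k i else of_real (s k) ^ Suc n * x k i)" for k
  have zs: "z k \<in> crit_space n" for k
    using x(1)[of k] by (auto simp: crit_space_def z_def sum_distrib_left[symmetric])
  have Nz: "N (z k) = 1" for k
  proof -
    have "root (Suc n) (s k ^ Suc n * norm (x k n)) = s k * root (Suc n) (norm (x k n))"
      using s(1)[of k] by (simp add: real_root_mult real_root_power_cancel del: power_Suc)
    then have "N (z k) = s k * N (x k)"
      using s(1)[of k] by (simp add: N_def z_def norm_mult norm_power distrib_left sum_distrib_left)
    then show ?thesis using s(1)[of k] by (auto simp: s_def)
  qed
  have zb: "norm (z k i) \<le> 1" for k i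
  proof -
    have s: "0 \<le> (\<Sum>i<n. norm (z k i))" "0 \<le> root (Suc n) (norm (z k n))" by (auto intro: sum_nonneg)
    consider "i < n" | "i = n" | "i > n" by linarith
    then show ?thesis
    proof cases
      case 1
      then have "norm (z k i) \<le> (\<Sum>i<n. norm (z k i))" by (intro member_le_sum) auto
      then show ?thesis using Nz[of k] s unfolding N_def by linarith
    next
      case 2
      have "root (Suc n) (norm (z k n)) \<le> 1" using Nz[of k] s unfolding N_def by linarith
      then show ?thesis using 2 by (simp add: real_root_le_1_iff)
    next
      case 3
      then show ?thesis using zs[of k] by (simp add: crit_space_def)
    qed
  qed
  obtain c r where r: "strict_mono (r :: nat \<Rightarrow> nat)" "\<And>i. (\<lambda>k. z (r k) i) \<longlonglongrightarrow> c i"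
    using bounded_tuples_subsequence[of z "\<lambda>_. 1"] zb by blast
  have cs: "c \<in> crit_space n" by (rule crit_space_closed[OF zs r(2)])
  have s0: "s \<longlonglongrightarrow> 0"
    by (rule Lim_null_comparison[OF _ LIMSEQ_inverse_real_of_nat])
       (use s(2) less_imp_le[OF s(1)] in \<open>simp add: eventuallyI\<close>)
  have cv0: "crit_val n c i = 0" if i: "i < n" for i
  proof -
    have eq: "crit_val n (z k) i = of_real (s k) ^ Suc n * crit_val n (x k) i" for k
      unfolding z_def by (rule crit_val_scale[OF i])
    have "(\<lambda>k. \<bar>R\<bar> * s k ^ Suc n) \<longlonglongrightarrow> \<bar>R\<bar> * 0 ^ Suc n" by (intro tendsto_intros s0)
    then have l0: "(\<lambda>k. \<bar>R\<bar> * s k ^ Suc n) \<longlonglongrightarrow> 0" by simp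
    have nb: "norm (crit_val n (z k) i) \<le> \<bar>R\<bar> * s k ^ Suc n" for k
    proof -
      have "norm (crit_val n (z k) i) = s k ^ Suc n * norm (crit_val n (x k) i)"
        unfolding eq using s(1)[of k] by (simp add: norm_mult norm_power)
      also have "\<dots> \<le> s k ^ Suc n * \<bar>R\<bar>"
        using x(2)[OF i, of k] s(1)[of k] by (intro mult_left_mono) auto
      finally show ?thesis by (simp only: mult.commute)
    qed
    have "(\<lambda>k. crit_val n (z k) i) \<longlonglongrightarrow> 0" by (rule Lim_null_comparison[OF eventuallyI[OF nb] l0])
    then have "(\<lambda>k. crit_val n (z (r k)) i) \<longlonglongrightarrow> 0"
      using LIMSEQ_subseq_LIMSEQ[OF _ r(1)] by (fastforce simp: o_def)
    moreover have "(\<lambda>k. crit_val n (z (r k)) i) \<longlonglongrightarrow> crit_val n c i" by (intro tendsto_crit_val r i)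
    ultimately show ?thesis by (rule LIMSEQ_unique[rotated])
  qed
  have c0: "c i = 0" if "i < n" for i
    by (rule crit_points_zero_if_values_equal[OF cs cv0 that])
  \<comment> \<open>With all critical points at 0 the constant term is itself a critical value;
    there is one to use because \<open>n \<ge> 1\<close>.\<close>
  have "c n = coeff (crit_poly n c) 0" by (simp add: coeff_crit_poly)
  also have "\<dots> = crit_val n c 0" using c0[of 0] n by (simp add: crit_val_def poly_0_coeff_0)
  also have "\<dots> = 0" using cv0 n by simp
  finally have "N c = 0" using c0 by (simp add: N_def)
  moreover have "(\<lambda>k. N (z (r k))) \<longlonglongrightarrow> N c" unfolding N_def by (intro tendsto_intros r tendsto_real_root)
  then have "N c = 1" using Nz LIMSEQ_unique[OF _ tendsto_const] by simp
  ultimately show False by simp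
qed

section \<open>Openness of the critical value map\<close>

text \<open>The injectivity argument run backwards: the prescribed values are interpolated by a
  polynomial \<open>H\<close> of degree below \<open>n\<close>, and the direction is read off from
  its derivative. That derivative has no coefficient at \<open>n - 1\<close>, which makes the
  direction centred.\<close>

lemma crit_val_linearly_surjective:
  fixes c h :: "nat \<Rightarrow> complex"
  assumes n: "n \<ge> 1" and inj: "inj_on c {..<n}"
  obtains u where "(\<Sum>i<n. u i) = 0" "\<And>i. i > n \<Longrightarrow> u i = 0"
    "\<And>i. i < n \<Longrightarrow> poly (crit_poly_deriv n c u) (c i) = h i"
proof -
  define L where "L j = (\<Prod>l\<in>{..<n}-{j}. [:- c l, 1:])" for j
  define K where "K j = (\<Prod>l\<in>{..<n}-{j}. c j - c l)" for j
  have Knz: "K j \<noteq> 0" if "j < n" for j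
    using inj that by (auto simp: K_def prod_zero_iff inj_on_def)
  have Lval: "poly (L j) (c i) = (if i = j then K j else 0)" if "i < n" "j < n" for i j
  proof -
    have "poly (L j) (c i) = (\<Prod>l\<in>{..<n}-{j}. c i - c l)" by (simp add: L_def poly_prod)
    then show ?thesis using that by (auto simp: K_def prod_zero_iff)
  qed
  have degL: "degree (L j) \<le> n - 1" if "j < n" for j
    unfolding L_def using that by (subst degree_prod_eq_sum_degree) auto
  have agree: "p = q" if pq: "degree p \<le> n - 1" "degree q \<le> n - 1" "\<And>i. i < n \<Longrightarrow> poly p (c i) = poly q (c i)" for p q
  proof (rule ccontr)
    assume "p \<noteq> q"
    then have nz: "p - q \<noteq> 0" by simp
    have "c ` {..<n} \<subseteq> {z. poly (p - q) z = 0}" using pq(3) by auto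
    then have "card (c ` {..<n}) \<le> card {z. poly (p - q) z = 0}"
      by (rule card_mono[OF poly_roots_finite[OF nz]])
    also have "\<dots> \<le> degree (p - q)" by (rule card_poly_roots_bound[OF nz])
    also have "\<dots> \<le> n - 1" by (rule degree_diff_le[OF pq(1,2)])
    finally show False using inj n by (simp add: card_image)
  qed
  define H where "H = (\<Sum>j<n. smult (h j / K j) (L j))"
  have degH: "degree H \<le> n - 1" unfolding H_def
    by (intro degree_sum_le order_trans[OF degree_smult_le]) (use degL in auto)
  have Hval: "poly H (c i) = h i" if "i < n" for i
  proof -
    have "poly H (c i) = (\<Sum>j<n. if i = j then h i else 0)"
      unfolding H_def poly_sum poly_smult by (intro sum.cong refl) (use that Lval Knz in auto)
    also have "\<dots> = h i" using that by simp
    finally show ?thesis .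
  qed
  define D where "D = smult (1 / of_nat (Suc n)) (pderiv H)"
  have degD: "degree D \<le> n - 1"
    unfolding D_def using degH by (intro order_trans[OF degree_smult_le]) (simp add: degree_pderiv)
  \<comment> \<open>At \<open>c i\<close> only the product omitting \<open>i\<close> survives, with
    value \<open>K i\<close>; this gives the quotient. The entry at \<open>n\<close> restores the
    constant term that differentiation loses.\<close>
  define u where "u i = (if i < n then - poly D (c i) / K i else if i = n then coeff H 0 else 0)" for i
  have Deq: "root_poly_deriv n c u = D"
  proof (rule agree[OF _ degD])
    have eq: "root_poly_deriv n c u = - (\<Sum>j<n. smult (u j) (L j))" by (simp add: root_poly_deriv_def L_def)
    show "degree (root_poly_deriv n c u) \<le> n - 1" unfolding eq degree_minus
      by (intro degree_sum_le order_trans[OF degree_smult_le]) (use degL in auto)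
    fix i assume i: "i < n"
    have "poly (root_poly_deriv n c u) (c i) = - (\<Sum>j<n. if i = j then - poly D (c i) else 0)"
      unfolding eq poly_minus poly_sum poly_smult
      by (intro arg_cong[of _ _ uminus] sum.cong refl) (use i Lval Knz in \<open>auto simp: u_def\<close>)
    also have "\<dots> = poly D (c i)" using i by simp
    finally show "poly (root_poly_deriv n c u) (c i) = poly D (c i)" .
  qed
  have "crit_poly_deriv n c u = H"
  proof -
    have "smult (of_nat (Suc n)) D = pderiv H" by (simp add: D_def del: of_nat_Suc)
    then show ?thesis unfolding crit_poly_deriv_def Deq by (simp add: integral_poly_pderiv u_def)
  qed
  moreover have "(\<Sum>i<n. u i) = 0"
  proof -
    have lc: "coeff (L j) (n - 1) = 1" if "j < n" for j
    proof -
      have "degree (L j) = n - 1" unfolding L_def using that by (subst degree_prod_eq_sum_degree) auto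
      moreover have "lead_coeff (L j) = 1" unfolding L_def by (simp only: lead_coeff_prod) simp
      ultimately show ?thesis by simp
    qed
    have "coeff D (n - 1) = 0"
      using degH n by (simp add: D_def coeff_pderiv coeff_eq_0 del: of_nat_Suc)
    then have "coeff (root_poly_deriv n c u) (n - 1) = 0" by (simp only: Deq)
    moreover have "coeff (root_poly_deriv n c u) (n - 1) = - (\<Sum>j<n. u j)"
      unfolding root_poly_deriv_def L_def[symmetric] using lc by (simp add: coeff_sum)
    ultimately show ?thesis by simp
  qed
  ultimately show ?thesis using that[of u] Hval by (auto simp: u_def)
qed

text \<open>The box is closed and hence sequentially compact, so minimizers and limits of solutions
  stay inside. Coordinates beyond \<open>n\<close> vanish on \<open>crit_space n\<close> and need no
  bound.\<close>

definition crit_box :: "nat \<Rightarrow> (nat \<Rightarrow> complex) \<Rightarrow> real \<Rightarrow> (nat \<Rightarrow> complex) set" where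
  "crit_box n c r = {y \<in> crit_space n. \<forall>i\<le>n. norm (y i - c i) \<le> r}"

lemma crit_box_subsequence:
  fixes y :: "nat \<Rightarrow> nat \<Rightarrow> complex"
  assumes "\<And>k. y k \<in> crit_box n c \<rho>"
  shows "\<exists>z r. strict_mono (r :: nat \<Rightarrow> nat) \<and> (\<forall>i. (\<lambda>k. y (r k) i) \<longlonglongrightarrow> z i) \<and> z \<in> crit_box n c \<rho>"
proof -
  have ys: "y k \<in> crit_space n" for k using assms by (auto simp: crit_box_def)
  have "norm (y k i) \<le> norm (c i) + \<bar>\<rho>\<bar>" for k i
  proof (cases "i \<le> n")
    case True
    then have "norm (y k i - c i) \<le> \<rho>" using assms by (auto simp: crit_box_def)
    then show ?thesis using norm_triangle_sub[of "y k i" "c i"] by linarith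
  next
    case False
    then show ?thesis using ys[of k] by (simp add: crit_space_def)
  qed
  then obtain z r where r: "strict_mono (r :: nat \<Rightarrow> nat)" "\<And>i. (\<lambda>k. y (r k) i) \<longlonglongrightarrow> z i"
    using bounded_tuples_subsequence[of y "\<lambda>i. norm (c i) + \<bar>\<rho>\<bar>"] by blast
  have "norm (z i - c i) \<le> \<rho>" if "i \<le> n" for i
  proof (rule Lim_bounded)
    show "(\<lambda>k. norm (y (r k) i - c i)) \<longlonglongrightarrow> norm (z i - c i)" by (intro tendsto_intros r)
    show "\<forall>k\<ge>0. norm (y (r k) i - c i) \<le> \<rho>" using assms that by (auto simp: crit_box_def)
  qed
  moreover have "z \<in> crit_space n" using crit_space_closed[of "\<lambda>k. y (r k)"] ys r(2) by blast
  ultimately show ?thesis using r by (auto simp: crit_box_def)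
qed

lemma crit_val_isolated_box:
  assumes n: "n \<ge> 1" and c: "c \<in> crit_space n"
  shows "\<exists>r>0. \<forall>y\<in>crit_box n c r. (\<forall>i<n. crit_val n y i = crit_val n c i) \<longrightarrow> y = c"
proof (rule ccontr)
  assume neg: "\<not> ?thesis"
  have "\<exists>y. y \<in> crit_box n c (inverse (real (Suc k))) \<and> (\<forall>i<n. crit_val n y i = crit_val n c i) \<and> y \<noteq> c" for k
  proof -
    have "inverse (real (Suc k)) > 0" by simp
    then show ?thesis using neg by blast
  qed
  then obtain y where y: "\<And>k. y k \<in> crit_box n c (inverse (real (Suc k)))"
     "\<And>k i. i < n \<Longrightarrow> crit_val n (y k) i = crit_val n c i" "\<And>k. y k \<noteq> c" by metis
  have ys: "y k \<in> crit_space n" for k using y(1) by (auto simp: crit_box_def)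
  have "(\<lambda>k. y k i) \<longlonglongrightarrow> c i" for i
  proof (cases "i \<le> n")
    case True
    then have "norm (y k i - c i) \<le> inverse (real (Suc k))" for k using y(1)[of k] by (auto simp: crit_box_def)
    then have "(\<lambda>k. y k i - c i) \<longlonglongrightarrow> 0"
      by (rule Lim_null_comparison[OF eventuallyI LIMSEQ_inverse_real_of_nat])
    then show ?thesis by (simp only: LIM_zero_iff)
  next
    case False
    then have "y k i = c i" for k using ys[of k] c by (simp add: crit_space_def)
    then show ?thesis by simp
  qed
  from crit_val_fiber_isolated[OF n ys this y(2)] have "\<forall>\<^sub>F k in sequentially. y k = c" by blast
  then show False using y(3) by simp
qed

lemma crit_box_mono: "r \<le> s \<Longrightarrow> crit_box n c r \<subseteq> crit_box n c s"
  by (force simp: crit_box_def)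

text \<open>First-order expansion of the squared norm when the steps \<open>e k\<close> point
  asymptotically in the direction \<open>- a\<close>.\<close>

lemma descent_limit:
  fixes a :: complex and e :: "nat \<Rightarrow> complex"
  assumes "(\<lambda>k. e k / of_real (s k)) \<longlonglongrightarrow> - a" "s \<longlonglongrightarrow> 0" "\<And>k. s k > 0"
  shows "(\<lambda>k. ((norm (a + e k))\<^sup>2 - (norm a)\<^sup>2) / s k) \<longlonglongrightarrow> - 2 * (norm a)\<^sup>2"
proof -
  have eq: "((norm (a + e k))\<^sup>2 - (norm a)\<^sup>2) / s k = 2 * (a \<bullet> (e k / of_real (s k))) + s k * (norm (e k / of_real (s k)))\<^sup>2" for k
  proof -
    have "(norm (a + e k))\<^sup>2 - (norm a)\<^sup>2 = 2 * (a \<bullet> e k) + (norm (e k))\<^sup>2"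
      by (simp add: power2_norm_eq_inner inner_add inner_commute)
    moreover have "e k / of_real (s k) = (1 / s k) *\<^sub>R e k" by (simp add: scaleR_conv_of_real)
    then have "a \<bullet> (e k / of_real (s k)) = (a \<bullet> e k) / s k" by simp
    moreover have "(norm (e k / of_real (s k)))\<^sup>2 = (norm (e k))\<^sup>2 / (s k)\<^sup>2"
      using assms(3)[of k] by (simp add: norm_divide power_divide)
    ultimately show ?thesis using assms(3)[of k] by (simp add: add_divide_distrib power2_eq_square)
  qed
  have "(\<lambda>k. 2 * (a \<bullet> (e k / of_real (s k))) + s k * (norm (e k / of_real (s k)))\<^sup>2) \<longlonglongrightarrow> 2 * (a \<bullet> (- a)) + 0 * (norm (- a))\<^sup>2"
    by (intro tendsto_intros assms)
  then show ?thesis unfolding eq by (simp add: power2_norm_eq_inner)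
qed

text \<open>At a tuple with distinct critical points the squared distance to a target value has no positive
  local minimum, since the derivative is onto; its minimizer near \<open>c\<close> thus attains the target.\<close>
lemma crit_val_open_at_distinct:
  assumes n: "n \<ge> 1" and c: "c \<in> crit_space n" and inj: "inj_on c {..<n}" and r: "r > 0"
  shows "\<exists>\<epsilon>>0. \<forall>w. (\<forall>i<n. norm (w i - crit_val n c i) < \<epsilon>) \<longrightarrow> (\<exists>y\<in>crit_box n c r. \<forall>i<n. crit_val n y i = w i)"
proof (rule ccontr)
  assume neg: "\<not> ?thesis"
  obtain r0 where r0: "r0 > 0" "\<And>y. y\<in>crit_box n c r0 \<Longrightarrow> (\<And>i. i<n \<Longrightarrow> crit_val n y i = crit_val n c i) \<Longrightarrow> y = c"
    using crit_val_isolated_box[OF n c] by blast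
  \<comment> \<open>In this box \<open>c\<close> is the only tuple with its values, which will
    identify the limit of the minimizers.\<close>
  define q where "q = min r r0"
  have q: "q > 0" "q \<le> r" "q \<le> r0" using r r0(1) by (auto simp: q_def)
  have "\<exists>w. (\<forall>i<n. norm (w i - crit_val n c i) < inverse (real (Suc k))) \<and> \<not> (\<exists>y\<in>crit_box n c r. \<forall>i<n. crit_val n y i = w i)" for k
  proof -
    have "inverse (real (Suc k)) > 0" by simp
    then show ?thesis using neg by blast
  qed
  then obtain w where w: "\<And>k i. i<n \<Longrightarrow> norm (w k i - crit_val n c i) < inverse (real (Suc k))"
    "\<And>k y. y\<in>crit_box n c r \<Longrightarrow> \<not> (\<forall>i<n. crit_val n y i = w k i)" by metis
  define f where "f k y = (\<Sum>i<n. (norm (crit_val n y i - w k i))\<^sup>2)" for k y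
  have cbox: "c \<in> crit_box n c q" using c q by (simp add: crit_box_def)
  have ftend: "(\<lambda>j. f k (y j)) \<longlonglongrightarrow> f k z" if "\<And>i. (\<lambda>j. y j i) \<longlonglongrightarrow> z i" for k y z
    unfolding f_def by (intro tendsto_intros tendsto_crit_val that) auto
  have min: "\<exists>y\<in>crit_box n c q. \<forall>z\<in>crit_box n c q. f k y \<le> f k z" for k
  proof -
    define I where "I = Inf (f k ` crit_box n c q)"
    have bdd: "bdd_below (f k ` crit_box n c q)"
      by (rule bdd_belowI[of _ 0]) (auto simp: f_def intro: sum_nonneg)
    have "\<exists>y\<in>crit_box n c q. f k y < I + inverse (real (Suc j))" for j
    proof -
      have "Inf (f k ` crit_box n c q) < I + inverse (real (Suc j))" by (simp add: I_def)
      then show ?thesis using cInf_lessD[of "f k ` crit_box n c q"] cbox by blast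
    qed
    then obtain y where y: "\<And>j. y j \<in> crit_box n c q" "\<And>j. f k (y j) < I + inverse (real (Suc j))" by metis
    obtain z t where z: "strict_mono (t :: nat \<Rightarrow> nat)" "\<And>i. (\<lambda>j. y (t j) i) \<longlonglongrightarrow> z i" "z \<in> crit_box n c q"
      using crit_box_subsequence[of y] y(1) by blast
    have "f k z \<le> I"
    proof (rule LIMSEQ_le)
      show "(\<lambda>j. f k (y (t j))) \<longlonglongrightarrow> f k z" by (rule ftend[OF z(2)])
      have "(\<lambda>j. I + inverse (real (Suc j))) \<longlonglongrightarrow> I + 0" by (intro tendsto_intros LIMSEQ_inverse_real_of_nat)
      from LIMSEQ_subseq_LIMSEQ[OF this z(1)] show "(\<lambda>j. I + inverse (real (Suc (t j)))) \<longlonglongrightarrow> I" by (simp add: o_def)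
      show "\<exists>N. \<forall>j\<ge>N. f k (y (t j)) \<le> I + inverse (real (Suc (t j)))" using y(2) less_imp_le by blast
    qed
    moreover have "I \<le> f k x" if "x \<in> crit_box n c q" for x
      unfolding I_def by (rule cInf_lower[OF _ bdd]) (use that in auto)
    ultimately show ?thesis using z(3) by (meson order_trans)
  qed
  then obtain y where y: "\<And>k. y k \<in> crit_box n c q" "\<And>k z. z \<in> crit_box n c q \<Longrightarrow> f k (y k) \<le> f k z" by metis
  obtain z t where z: "strict_mono (t :: nat \<Rightarrow> nat)" "\<And>i. (\<lambda>j. y (t j) i) \<longlonglongrightarrow> z i" "z \<in> crit_box n c q"
    using crit_box_subsequence[of y] y(1) by blast
  have wlim: "(\<lambda>j. w j i) \<longlonglongrightarrow> crit_val n c i" if "i < n" for i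
  proof -
    have "(\<lambda>j. w j i - crit_val n c i) \<longlonglongrightarrow> 0"
      by (rule Lim_null_comparison[OF eventuallyI LIMSEQ_inverse_real_of_nat]) (rule less_imp_le[OF w(1)[OF that]])
    then show ?thesis by (simp only: LIM_zero_iff)
  qed
  have wlim': "(\<lambda>j. w (t j) i) \<longlonglongrightarrow> crit_val n c i" if "i < n" for i
    using LIMSEQ_subseq_LIMSEQ[OF wlim[OF that] z(1)] by (simp add: o_def)
  \<comment> \<open>The minimizers do at least as well as \<open>c\<close>, whose distance to the
    targets tends to 0, so their limit has the values of \<open>c\<close>.\<close>
  have zc: "z = c"
  proof (rule r0(2))
    show "z \<in> crit_box n c r0" using z(3) crit_box_mono[OF q(3)] by blast
    have "(\<lambda>j. f (t j) (y (t j))) \<longlonglongrightarrow> (\<Sum>i<n. (norm (crit_val n z i - crit_val n c i))\<^sup>2)"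
      unfolding f_def by (intro tendsto_intros tendsto_crit_val z wlim') auto
    moreover have "(\<lambda>j. f (t j) c) \<longlonglongrightarrow> (\<Sum>i<n. (norm (crit_val n c i - crit_val n c i))\<^sup>2)"
      unfolding f_def by (intro tendsto_intros wlim') auto
    ultimately have "(\<Sum>i<n. (norm (crit_val n z i - crit_val n c i))\<^sup>2) \<le> (\<Sum>i<n. (norm (crit_val n c i - crit_val n c i))\<^sup>2)"
      by (rule LIMSEQ_le) (use y(2)[OF cbox] in blast)
    then have "(\<Sum>i<n. (norm (crit_val n z i - crit_val n c i))\<^sup>2) = 0"
      by (intro antisym sum_nonneg) auto
    then show "crit_val n z i = crit_val n c i" if "i < n" for i
      using that by (subst (asm) sum_nonneg_eq_0_iff) auto
  qed
  obtain d0 where d0: "d0 > 0" "\<And>i j. i < n \<Longrightarrow> j < n \<Longrightarrow> dist (c i) (c j) < d0 \<Longrightarrow> c i = c j"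
    using finite_separation[of "c ` {..<n}"] by (metis finite_imageI finite_lessThan imageI lessThan_iff)
  \<comment> \<open>\<open>e < q\<close> keeps the minimizer inside the box, so that small moves are
    admissible; \<open>2 * e \<le> d0\<close> keeps its critical points distinct, so that the
    derivative is onto.\<close>
  define e where "e = min (q/2) (d0/2)"
  have e: "e > 0" "e < q" "2 * e \<le> d0" using q d0(1) by (auto simp: e_def)
  have "\<forall>\<^sub>F j in sequentially. \<forall>i\<in>{..n}. dist (y (t j) i) (c i) < e"
    using z(2) e(1) tendstoD unfolding zc by (intro eventually_ball_finite) blast+
  then obtain j where j: "\<And>i. i \<le> n \<Longrightarrow> dist (y (t j) i) (c i) < e"
    using eventually_happens'[OF sequentially_bot] by (metis (no_types, lifting) atMost_iff)
  define b where "b = y (t j)"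
  define v where "v = w (t j)"
  have bbox: "b \<in> crit_box n c q" using y(1) by (simp add: b_def)
  then have bs: "b \<in> crit_space n" by (simp add: crit_box_def)
  have bc: "norm (b i - c i) < e" if "i \<le> n" for i using j[OF that] by (simp add: b_def dist_norm)
  have binj: "inj_on b {..<n}"
  proof (rule inj_onI)
    fix i l assume il: "i \<in> {..<n}" "l \<in> {..<n}" "b i = b l"
    have "dist (c i) (c l) \<le> norm (b i - c i) + norm (b l - c l)"
      using norm_triangle_ineq4[of "b l - c l" "b i - c i"] il(3) by (simp add: dist_norm)
    also have "\<dots> < d0" using bc[of i] bc[of l] il e by auto
    finally show "i = l" using d0(2)[of i l] inj il by (auto simp: inj_on_def)
  qed
  \<comment> \<open>The direction that moves every value straight towards its target. To first order
    the squared distance \<open>f\<close> then changes at the rate \<open>- 2 * f\<close>, which an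
    interior minimum permits only for \<open>f = 0\<close>.\<close>
  obtain u where u: "(\<Sum>i<n. u i) = 0" "\<And>i. i > n \<Longrightarrow> u i = 0"
    "\<And>i. i < n \<Longrightarrow> poly (crit_poly_deriv n b u) (b i) = - (crit_val n b i - v i)"
    using crit_val_linearly_surjective[OF n binj, of "\<lambda>i. - (crit_val n b i - v i)"] by blast
  define s where "s k = inverse (real (Suc k))" for k
  have s: "s \<longlonglongrightarrow> 0" "\<And>k. s k > 0" unfolding s_def by (rule LIMSEQ_inverse_real_of_nat) simp
  define x where "x k i = b i + of_real (s k) * u i" for k i
  have xl: "(\<lambda>k. x k i) \<longlonglongrightarrow> b i" for i
    unfolding x_def using tendsto_add[OF tendsto_const tendsto_mult[OF tendsto_of_real[OF s(1)] tendsto_const], of "b i" "u i"] by simp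
  have xs: "x k \<in> crit_space n" for k
    using bs u by (simp add: crit_space_def x_def sum.distrib sum_distrib_left[symmetric])
  have quot: "(\<lambda>k. (crit_val n (x k) i - crit_val n b i) / of_real (s k)) \<longlonglongrightarrow> - (crit_val n b i - v i)" if "i < n" for i
    unfolding u(3)[OF that, symmetric]
  proof (rule crit_val_difference_quotient[OF _ xl tendsto_const that])
    have "(x k i - b i) / of_real (s k) = u i" for k i using s(2)[of k] by (simp add: x_def)
    then show "(\<lambda>k. (x k i - b i) / of_real (s k)) \<longlonglongrightarrow> u i" for i by simp
  qed
  have "(\<lambda>k. \<Sum>i<n. ((norm ((crit_val n b i - v i) + (crit_val n (x k) i - crit_val n b i)))\<^sup>2 - (norm (crit_val n b i - v i))\<^sup>2) / s k)
     \<longlonglongrightarrow> (\<Sum>i<n. - 2 * (norm (crit_val n b i - v i))\<^sup>2)"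
    by (intro tendsto_sum descent_limit quot s) auto
  then have "(\<lambda>k. (f (t j) (x k) - f (t j) b) / s k) \<longlonglongrightarrow> - 2 * f (t j) b"
    by (simp add: f_def v_def sum_divide_distrib[symmetric] sum_subtractf sum_distrib_left sum_negf)
  moreover have "\<forall>\<^sub>F k in sequentially. 0 \<le> (f (t j) (x k) - f (t j) b) / s k"
  proof -
    have "\<forall>\<^sub>F k in sequentially. \<forall>i\<in>{..n}. dist (x k i) (b i) < q - e"
      using e(2) by (intro eventually_ball_finite ballI tendstoD[OF xl]) auto
    then show ?thesis
    proof eventually_elim
      case (elim k)
      have "norm (x k i - c i) \<le> q" if "i \<le> n" for i
        using elim that bc[OF that] norm_triangle_ineq[of "x k i - b i" "b i - c i"] by (force simp: dist_norm)
      then have "x k \<in> crit_box n c q" using xs by (simp add: crit_box_def)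
      then have "f (t j) b \<le> f (t j) (x k)" unfolding b_def by (rule y(2))
      then show ?case using s(2)[of k] by simp
    qed
  qed
  ultimately have "0 \<le> - 2 * f (t j) b" by (rule tendsto_lowerbound) simp
  then have "f (t j) b \<le> 0" by simp
  moreover have "0 \<le> f (t j) b" unfolding f_def by (intro sum_nonneg) auto
  ultimately have "f (t j) b = 0" by simp
  then have "\<forall>i<n. crit_val n b i = w (t j) i"
    unfolding f_def by (subst (asm) sum_nonneg_eq_0_iff) auto
  then show False using w(2) bbox crit_box_mono[OF q(2)] by blast
qed

text \<open>For each pair, either the entries of \<open>a\<close> differ and continue to do so for
  small \<open>s k\<close>, or they agree and \<open>d\<close> separates them.\<close>

lemma eventually_perturbation_inj:
  fixes a d :: "nat \<Rightarrow> complex" and s :: "nat \<Rightarrow> complex"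
  assumes "inj_on d {..<n}" "s \<longlonglongrightarrow> 0" "\<And>k. s k \<noteq> 0"
  shows "\<forall>\<^sub>F k in sequentially. inj_on (\<lambda>i. a i + s k * d i) {..<n}"
proof -
  have "\<forall>\<^sub>F k in sequentially. a i + s k * d i = a j + s k * d j \<longrightarrow> i = j"
    if "i \<in> {..<n}" "j \<in> {..<n}" for i j
  proof (cases "a i = a j")
    case True
    have "i = j" if "a i + s k * d i = a j + s k * d j" for k
      using that True assms(1,3) \<open>i \<in> {..<n}\<close> \<open>j \<in> {..<n}\<close> by (simp add: inj_on_def)
    then show ?thesis by (intro always_eventually) blast
  next
    case False
    have "(\<lambda>k. (a i + s k * d i) - (a j + s k * d j)) \<longlonglongrightarrow> (a i + 0 * d i) - (a j + 0 * d j)"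
      by (intro tendsto_intros assms)
    then have "(\<lambda>k. (a i + s k * d i) - (a j + s k * d j)) \<longlonglongrightarrow> a i - a j" by simp
    then have "\<forall>\<^sub>F k in sequentially. (a i + s k * d i) - (a j + s k * d j) \<noteq> 0"
      by (rule tendsto_imp_eventually_ne) (use False in simp)
    then show ?thesis by eventually_elim simp
  qed
  then have "\<forall>\<^sub>F k in sequentially. \<forall>i\<in>{..<n}. \<forall>j\<in>{..<n}. a i + s k * d i = a j + s k * d j \<longrightarrow> i = j"
    by (simp add: eventually_ball_finite_distrib)
  then show ?thesis by eventually_elim (simp add: inj_on_def)
qed

text \<open>No tuple on the compact boundary of the box has the values of \<open>c\<close>.
  Solutions for targets close to those values are therefore interior and cannot escape from the box
  while the target moves.\<close>

lemma crit_box_boundary_values: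
  assumes n: "n \<ge> 1" and c: "c \<in> crit_space n" and q: "q > 0"
    and iso: "\<And>y. y \<in> crit_box n c q \<Longrightarrow> (\<And>i. i < n \<Longrightarrow> crit_val n y i = crit_val n c i) \<Longrightarrow> y = c"
  shows "\<exists>\<epsilon>>0. \<forall>y\<in>crit_box n c q. (\<forall>i<n. norm (crit_val n y i - crit_val n c i) < \<epsilon>) \<longrightarrow> (\<forall>i\<le>n. norm (y i - c i) < q)"
proof (rule ccontr)
  assume neg: "\<not> ?thesis"
  have "\<exists>y. y \<in> crit_box n c q \<and> (\<forall>i<n. norm (crit_val n y i - crit_val n c i) < inverse (real (Suc k))) \<and> \<not> (\<forall>i\<le>n. norm (y i - c i) < q)" for k
  proof -
    have "inverse (real (Suc k)) > 0" by simp
    then show ?thesis using neg by blast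
  qed
  then obtain y where y: "\<And>k. y k \<in> crit_box n c q"
     "\<And>k i. i < n \<Longrightarrow> norm (crit_val n (y k) i - crit_val n c i) < inverse (real (Suc k))"
     "\<And>k. \<not> (\<forall>i\<le>n. norm (y k i - c i) < q)" by metis
  obtain z t where z: "strict_mono (t :: nat \<Rightarrow> nat)" "\<And>i. (\<lambda>j. y (t j) i) \<longlonglongrightarrow> z i" "z \<in> crit_box n c q"
    using crit_box_subsequence[of y] y(1) by blast
  have "z = c"
  proof (rule iso[OF z(3)])
    fix i assume i: "i < n"
    have "(\<lambda>k. crit_val n (y k) i - crit_val n c i) \<longlonglongrightarrow> 0"
      by (rule Lim_null_comparison[OF eventuallyI LIMSEQ_inverse_real_of_nat]) (rule less_imp_le[OF y(2)[OF i]])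
    then have "(\<lambda>k. crit_val n (y k) i) \<longlonglongrightarrow> crit_val n c i" by (simp only: LIM_zero_iff)
    from LIMSEQ_subseq_LIMSEQ[OF this z(1)] have "(\<lambda>j. crit_val n (y (t j)) i) \<longlonglongrightarrow> crit_val n c i" by (simp add: o_def)
    moreover have "(\<lambda>j. crit_val n (y (t j)) i) \<longlonglongrightarrow> crit_val n z i" by (intro tendsto_crit_val z i)
    ultimately show "crit_val n z i = crit_val n c i" by (rule LIMSEQ_unique[rotated])
  qed
  have "(\<lambda>j. \<Sum>i\<le>n. norm (y (t j) i - c i)) \<longlonglongrightarrow> (\<Sum>i\<le>n. norm (z i - c i))" by (intro tendsto_intros z)
  moreover have "q \<le> (\<Sum>i\<le>n. norm (y k i - c i))" for k
  proof -
    obtain i where i: "i \<le> n" "q \<le> norm (y k i - c i)" using y(3)[of k] by (auto simp: not_less)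
    have "norm (y k i - c i) \<le> (\<Sum>i\<le>n. norm (y k i - c i))" using i by (intro member_le_sum) auto
    then show ?thesis using i by simp
  qed
  ultimately have "q \<le> (\<Sum>i\<le>n. norm (z i - c i))" by (intro LIMSEQ_le_const) auto
  then show False using \<open>z = c\<close> q by simp
qed

text \<open>Distinct targets near \<open>crit_val n c\<close> are reached along the complex line from an attained distinct
  target: removing finitely many points from a convex open set of complex numbers leaves it connected.\<close>
lemma crit_val_open:
  assumes n: "n \<ge> 1" and c: "c \<in> crit_space n" and r: "r > 0"
  shows "\<exists>\<epsilon>>0. \<forall>w. (\<forall>i<n. norm (w i - crit_val n c i) < \<epsilon>) \<longrightarrow> (\<exists>y\<in>crit_box n c r. \<forall>i<n. crit_val n y i = w i)"
proof -
  obtain r0 where r0: "r0 > 0" "\<And>y. y\<in>crit_box n c r0 \<Longrightarrow> (\<And>i. i<n \<Longrightarrow> crit_val n y i = crit_val n c i) \<Longrightarrow> y = c"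
    using crit_val_isolated_box[OF n c] by blast
  define q where "q = min r r0"
  have q: "q > 0" "q \<le> r" "q \<le> r0" using r r0(1) by (auto simp: q_def)
  have iso: "y = c" if "y \<in> crit_box n c q" "\<And>i. i < n \<Longrightarrow> crit_val n y i = crit_val n c i" for y
    using r0(2) crit_box_mono[OF q(3)] that by blast
  obtain \<epsilon> where \<epsilon>: "\<epsilon> > 0" "\<And>y i. y \<in> crit_box n c q \<Longrightarrow> (\<And>i. i<n \<Longrightarrow> norm (crit_val n y i - crit_val n c i) < \<epsilon>) \<Longrightarrow> i \<le> n \<Longrightarrow> norm (y i - c i) < q"
    using crit_box_boundary_values[OF n c q(1) iso] by blast
  define s where "s k = complex_of_real (inverse (real (Suc k)))" for k
  have "s \<longlonglongrightarrow> 0"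
    using tendsto_of_real[OF LIMSEQ_inverse_real_of_nat, where ?'a = complex] unfolding s_def of_real_0 .
  moreover have "s k \<noteq> 0" for k unfolding s_def of_real_eq_0_iff by simp
  ultimately have s: "s \<longlonglongrightarrow> 0" "\<And>k. s k \<noteq> 0" by auto
  have injn: "inj_on (\<lambda>i. complex_of_nat i - b) {..<n}" for b by (auto simp: inj_on_def)
  have plim: "(\<lambda>k. a + s k * b) \<longlonglongrightarrow> a" for a b
    using tendsto_add[OF tendsto_const tendsto_mult[OF s(1) tendsto_const], of a b] by simp
  have "\<exists>x0\<in>crit_space n. inj_on x0 {..<n} \<and> (\<forall>i\<le>n. norm (x0 i - c i) < q/2) \<and> (\<forall>i<n. norm (crit_val n x0 i - crit_val n c i) < \<epsilon>)"
  proof -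
    \<comment> \<open>Subtracting the mean keeps the perturbed tuple centred.\<close>
    define d where "d i = (if i < n then complex_of_nat i - (\<Sum>j<n. of_nat j) / of_nat n else 0)" for i
    define x where "x k = (\<lambda>i. c i + s k * d i)" for k
    have "inj_on d {..<n}" using injn[of "(\<Sum>j<n. of_nat j) / of_nat n"] by (simp add: d_def inj_on_def)
    then have e1: "\<forall>\<^sub>F k in sequentially. inj_on (x k) {..<n}"
      unfolding x_def by (rule eventually_perturbation_inj[OF _ s])
    have xl: "(\<lambda>k. x k i) \<longlonglongrightarrow> c i" for i unfolding x_def by (rule plim)
    have xs: "x k \<in> crit_space n" for k
    proof -
      have "(\<Sum>i<n. d i) = 0" using n by (simp add: d_def sum_subtractf)
      then show ?thesis using c by (simp add: crit_space_def x_def d_def sum.distrib sum_distrib_left[symmetric])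
    qed
    have e2: "\<forall>\<^sub>F k in sequentially. \<forall>i\<in>{..n}. dist (x k i) (c i) < q/2"
      using q by (intro eventually_ball_finite ballI tendstoD[OF xl]) auto
    have e3: "\<forall>\<^sub>F k in sequentially. \<forall>i\<in>{..<n}. dist (crit_val n (x k) i) (crit_val n c i) < \<epsilon>"
      using \<epsilon>(1) by (intro eventually_ball_finite ballI tendstoD[OF tendsto_crit_val[OF xl]]) auto
    have "\<forall>\<^sub>F k in sequentially. inj_on (x k) {..<n} \<and> (\<forall>i\<in>{..n}. dist (x k i) (c i) < q/2) \<and>
        (\<forall>i\<in>{..<n}. dist (crit_val n (x k) i) (crit_val n c i) < \<epsilon>)"
      using e1 e2 e3 by eventually_elim blast
    from eventually_happens'[OF sequentially_bot this] obtain k where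
      "inj_on (x k) {..<n}" "\<forall>i\<in>{..n}. dist (x k i) (c i) < q/2" "\<forall>i\<in>{..<n}. dist (crit_val n (x k) i) (crit_val n c i) < \<epsilon>"
      by blast
    then show ?thesis using xs by (intro bexI[of _ "x k"]) (auto simp: dist_norm)
  qed
  then obtain x0 where x0: "x0 \<in> crit_space n" "inj_on x0 {..<n}" "\<And>i. i \<le> n \<Longrightarrow> norm (x0 i - c i) < q/2"
      "\<And>i. i < n \<Longrightarrow> norm (crit_val n x0 i - crit_val n c i) < \<epsilon>" by blast
  have "q/2 > 0" using q by simp
  from crit_val_open_at_distinct[OF n x0(1,2) this] obtain \<epsilon>0 where \<epsilon>0: "\<epsilon>0 > 0"
     "\<And>w. (\<And>i. i<n \<Longrightarrow> norm (w i - crit_val n x0 i) < \<epsilon>0) \<Longrightarrow> \<exists>y\<in>crit_box n x0 (q/2). \<forall>i<n. crit_val n y i = w i"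
    by blast
  have box0: "crit_box n x0 (q/2) \<subseteq> crit_box n c q"
  proof
    fix y assume y: "y \<in> crit_box n x0 (q/2)"
    have "norm (y i - c i) \<le> q" if "i \<le> n" for i
    proof -
      have "norm (y i - x0 i) \<le> q/2" using y that by (auto simp: crit_box_def)
      then show ?thesis using x0(3)[OF that] norm_triangle_ineq[of "y i - x0 i" "x0 i - c i"] by simp
    qed
    then show "y \<in> crit_box n c q" using y by (auto simp: crit_box_def)
  qed
  \<comment> \<open>Distinct critical points may still share a value, so the target is perturbed as
    well, within the values known to be attained near \<open>x0\<close>.\<close>
  have "\<exists>w1. inj_on w1 {..<n} \<and> (\<forall>i<n. norm (w1 i - crit_val n x0 i) < \<epsilon>0) \<and> (\<forall>i<n. norm (w1 i - crit_val n c i) < \<epsilon>)"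
  proof -
    have e1: "\<forall>\<^sub>F k in sequentially. inj_on (\<lambda>i. crit_val n x0 i + s k * (of_nat i - 0)) {..<n}"
      by (rule eventually_perturbation_inj[OF injn s])
    have e2: "\<forall>\<^sub>F k in sequentially. \<forall>i\<in>{..<n}. norm (crit_val n x0 i + s k * (of_nat i - 0) - crit_val n x0 i) < \<epsilon>0"
      using tendstoD[OF plim \<epsilon>0(1)] unfolding dist_norm by (intro eventually_ball_finite) auto
    have e3: "\<forall>\<^sub>F k in sequentially. \<forall>i\<in>{..<n}. norm (crit_val n x0 i + s k * (of_nat i - 0) - crit_val n c i) < \<epsilon>"
    proof (intro eventually_ball_finite ballI)
      fix i assume "i \<in> {..<n}"
      have "(\<lambda>k. norm (crit_val n x0 i + s k * (of_nat i - 0) - crit_val n c i)) \<longlonglongrightarrow> norm (crit_val n x0 i - crit_val n c i)"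
        by (intro tendsto_intros plim)
      then show "\<forall>\<^sub>F k in sequentially. norm (crit_val n x0 i + s k * (of_nat i - 0) - crit_val n c i) < \<epsilon>"
        by (rule order_tendstoD) (use x0(4) \<open>i \<in> {..<n}\<close> in auto)
    qed simp
    have "\<forall>\<^sub>F k in sequentially. inj_on (\<lambda>i. crit_val n x0 i + s k * (of_nat i - 0)) {..<n} \<and>
       (\<forall>i\<in>{..<n}. norm (crit_val n x0 i + s k * (of_nat i - 0) - crit_val n x0 i) < \<epsilon>0) \<and>
       (\<forall>i\<in>{..<n}. norm (crit_val n x0 i + s k * (of_nat i - 0) - crit_val n c i) < \<epsilon>)"
      using e1 e2 e3 by eventually_elim blast
    from eventually_happens'[OF sequentially_bot this] obtain k where
      "inj_on (\<lambda>i. crit_val n x0 i + s k * (of_nat i - 0)) {..<n}"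
       "\<forall>i\<in>{..<n}. norm (crit_val n x0 i + s k * (of_nat i - 0) - crit_val n x0 i) < \<epsilon>0"
       "\<forall>i\<in>{..<n}. norm (crit_val n x0 i + s k * (of_nat i - 0) - crit_val n c i) < \<epsilon>" by blast
    then show ?thesis by (intro exI[of _ "\<lambda>i. crit_val n x0 i + s k * (of_nat i - 0)"]) auto
  qed
  then obtain w1 where w1: "inj_on w1 {..<n}" "\<And>i. i < n \<Longrightarrow> norm (w1 i - crit_val n x0 i) < \<epsilon>0"
      "\<And>i. i < n \<Longrightarrow> norm (w1 i - crit_val n c i) < \<epsilon>" by blast
  have attained_w1: "\<exists>y\<in>crit_box n c q. \<forall>i<n. crit_val n y i = w1 i"
    using \<epsilon>0(2)[of w1] w1(2) box0 by blast
  have distinct_case: "\<exists>y\<in>crit_box n c q. \<forall>i<n. crit_val n y i = w' i"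
    if w': "inj_on w' {..<n}" "\<And>i. i < n \<Longrightarrow> norm (w' i - crit_val n c i) < \<epsilon>" for w'
  proof -
    define L where "L \<sigma> i = w1 i + \<sigma> * (w' i - w1 i)" for \<sigma> :: complex and i
    define U where "U = (\<Inter>i\<in>{..<n}. {\<sigma>. norm (L \<sigma> i - crit_val n c i) < \<epsilon>})"
    define Bad where "Bad = (\<Union>i\<in>{..<n}. \<Union>j\<in>{..<n} - {i}. {\<sigma>. L \<sigma> i = L \<sigma> j})"
    have "open U" unfolding U_def L_def
      by (intro open_INT ballI open_Collect_less continuous_intros) auto
    moreover have "convex U"
      unfolding U_def
    proof (rule convex_INT, rule convexI)
      fix i x y and u v :: real
      assume *: "x \<in> {\<sigma>. norm (L \<sigma> i - crit_val n c i) < \<epsilon>}" "y \<in> {\<sigma>. norm (L \<sigma> i - crit_val n c i) < \<epsilon>}" "0 \<le> u" "0 \<le> v" "u + v = 1"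
      have "complex_of_real u + of_real v = 1" using *(5) by (metis of_real_1 of_real_add)
      then have v: "complex_of_real v = 1 - of_real u" by (simp add: algebra_simps)
      have "L (u *\<^sub>R x + v *\<^sub>R y) i = u *\<^sub>R L x i + v *\<^sub>R L y i"
        by (simp add: L_def scaleR_conv_of_real v algebra_simps)
      moreover have "u *\<^sub>R L x i + v *\<^sub>R L y i \<in> ball (crit_val n c i) \<epsilon>"
        by (rule convexD[OF convex_ball _ _ *(3,4,5)]) (use *(1,2) in \<open>auto simp: dist_norm norm_minus_commute\<close>)
      ultimately show "u *\<^sub>R x + v *\<^sub>R y \<in> {\<sigma>. norm (L \<sigma> i - crit_val n c i) < \<epsilon>}"
        by (simp add: dist_norm norm_minus_commute)
    qed
    moreover have "finite Bad" unfolding Bad_def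
    proof (intro finite_UN_I finite_lessThan finite_Diff)
      fix i j assume ij: "i \<in> {..<n}" "j \<in> {..<n} - {i}"
      \<comment> \<open>The two entries differ at parameter 0, so the affine equation between them
        has at most one solution.\<close>
      then have ne: "w1 i \<noteq> w1 j" using w1(1) by (auto simp: inj_on_def)
      have "{\<sigma>. L \<sigma> i = L \<sigma> j} \<subseteq> {(w1 j - w1 i) / ((w' i - w1 i) - (w' j - w1 j))}"
      proof clarsimp
        fix \<sigma> assume "L \<sigma> i = L \<sigma> j"
        then have "\<sigma> * ((w' i - w1 i) - (w' j - w1 j)) = w1 j - w1 i" by (simp add: L_def algebra_simps)
        moreover from this ne have "(w' i - w1 i) - (w' j - w1 j) \<noteq> 0" by auto
        ultimately show "\<sigma> = (w1 j - w1 i) / (w' i - w1 i - (w' j - w1 j))" by (simp add: nonzero_eq_divide_eq)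
      qed
      then show "finite {\<sigma>. L \<sigma> i = L \<sigma> j}" using finite_subset by blast
    qed
    ultimately have conn: "connected (U - Bad)" and opn: "open (U - Bad)"
      using connected_open_delete_finite[of U Bad] convex_connected[of U] open_Diff[of U Bad] finite_imp_closed[of Bad]
      by auto
    have L01: "L 0 = w1" "L 1 = w'" by (auto simp: L_def)
    have S01: "0 \<in> U - Bad" "1 \<in> U - Bad"
      using w1 w' by (auto simp: U_def Bad_def L01 inj_on_def)
    \<comment> \<open>\<open>T'\<close> is closed since the box is compact. On
      \<open>U - Bad\<close> it is open: distinct values force distinct critical points, and a
      solution with its target in \<open>U\<close> is interior to the box, so openness at distinct
      tuples applies there.\<close>
    define T' where "T' = {\<sigma>. \<exists>y\<in>crit_box n c q. \<forall>i<n. crit_val n y i = L \<sigma> i}"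
    have "closed T'"
      unfolding closed_sequential_limits
    proof (intro allI impI, elim conjE)
      fix \<sigma> l assume *: "\<forall>k. \<sigma> k \<in> T'" "\<sigma> \<longlonglongrightarrow> l"
      then obtain y where y: "\<And>k. y k \<in> crit_box n c q" "\<And>k i. i < n \<Longrightarrow> crit_val n (y k) i = L (\<sigma> k) i"
        unfolding T'_def by simp metis
      obtain z t where z: "strict_mono (t :: nat \<Rightarrow> nat)" "\<And>i. (\<lambda>j. y (t j) i) \<longlonglongrightarrow> z i" "z \<in> crit_box n c q"
        using crit_box_subsequence[of y] y(1) by blast
      have st: "(\<lambda>j. \<sigma> (t j)) \<longlonglongrightarrow> l" using LIMSEQ_subseq_LIMSEQ[OF *(2) z(1)] by (simp add: o_def)
      have "crit_val n z i = L l i" if i: "i < n" for i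
      proof (rule LIMSEQ_unique)
        show "(\<lambda>j. crit_val n (y (t j)) i) \<longlonglongrightarrow> crit_val n z i" by (intro tendsto_crit_val z i)
        show "(\<lambda>j. crit_val n (y (t j)) i) \<longlonglongrightarrow> L l i" unfolding y(2)[OF i] L_def by (intro tendsto_intros st)
      qed
      then show "l \<in> T'" using z(3) by (auto simp: T'_def)
    qed
    then have cl: "closedin (top_of_set (U - Bad)) ((U - Bad) \<inter> T')" by (rule closedin_closed_Int)
    have "open ((U - Bad) \<inter> T')"
      unfolding open_dist
    proof
      fix \<sigma> assume \<sigma>: "\<sigma> \<in> (U - Bad) \<inter> T'"
      then obtain y where y: "y \<in> crit_box n c q" "\<And>i. i < n \<Longrightarrow> crit_val n y i = L \<sigma> i" by (auto simp: T'_def)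
      have ys: "y \<in> crit_space n" using y(1) by (simp add: crit_box_def)
      have int: "norm (y i - c i) < q" if "i \<le> n" for i
        by (rule \<epsilon>(2)[OF y(1) _ that]) (use \<sigma> y(2) in \<open>auto simp: U_def\<close>)
      have yinj: "inj_on y {..<n}"
      proof (rule inj_onI)
        fix i j assume ij: "i \<in> {..<n}" "j \<in> {..<n}" "y i = y j"
        then have "L \<sigma> i = L \<sigma> j" using y(2)[of i] y(2)[of j] by (simp add: crit_val_def)
        then show "i = j" using \<sigma> ij unfolding Bad_def by blast
      qed
      define \<rho> where "\<rho> = Min ((\<lambda>i. q - norm (y i - c i)) ` {..n})"
      have "\<rho> > 0" unfolding \<rho>_def using int by (subst Min_gr_iff) auto
      have \<rho>: "\<rho> \<le> q - norm (y i - c i)" if "i \<le> n" for i unfolding \<rho>_def using that by (intro Min_le) auto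
      have sub: "crit_box n y \<rho> \<subseteq> crit_box n c q"
      proof
        fix x assume x: "x \<in> crit_box n y \<rho>"
        have "norm (x i - c i) \<le> q" if "i \<le> n" for i
        proof -
          have "norm (x i - y i) \<le> \<rho>" using x that by (auto simp: crit_box_def)
          then show ?thesis using \<rho>[OF that] norm_triangle_ineq[of "x i - y i" "y i - c i"] by simp
        qed
        then show "x \<in> crit_box n c q" using x by (auto simp: crit_box_def)
      qed
      obtain \<epsilon>1 where \<epsilon>1: "\<epsilon>1 > 0"
        "\<And>w. (\<And>i. i<n \<Longrightarrow> norm (w i - crit_val n y i) < \<epsilon>1) \<Longrightarrow> \<exists>x\<in>crit_box n y \<rho>. \<forall>i<n. crit_val n x i = w i"
        using crit_val_open_at_distinct[OF n ys yinj \<open>\<rho> > 0\<close>] by blast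
      have "\<forall>\<^sub>F \<tau> in nhds \<sigma>. \<forall>i\<in>{..<n}. norm (L \<tau> i - L \<sigma> i) < \<epsilon>1"
      proof (intro eventually_ball_finite ballI)
        fix i
        have "((\<lambda>\<tau>. L \<tau> i) \<longlongrightarrow> L \<sigma> i) (nhds \<sigma>)"
          unfolding L_def by (intro tendsto_intros filterlim_ident)
        from tendstoD[OF this \<epsilon>1(1)] show "\<forall>\<^sub>F \<tau> in nhds \<sigma>. norm (L \<tau> i - L \<sigma> i) < \<epsilon>1" by (simp add: dist_norm)
      qed simp
      moreover have "\<forall>\<^sub>F \<tau> in nhds \<sigma>. \<tau> \<in> U - Bad" using opn \<sigma> by (intro eventually_nhds_in_open) auto
      ultimately have "\<forall>\<^sub>F \<tau> in nhds \<sigma>. \<tau> \<in> (U - Bad) \<inter> T'"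
      proof eventually_elim
        case (elim \<tau>)
        have "\<exists>x\<in>crit_box n y \<rho>. \<forall>i<n. crit_val n x i = L \<tau> i"
          by (rule \<epsilon>1(2)) (use elim y(2) in auto)
        then show ?case using sub elim by (auto simp: T'_def)
      qed
      then show "\<exists>e>0. \<forall>\<tau>. dist \<tau> \<sigma> < e \<longrightarrow> \<tau> \<in> (U - Bad) \<inter> T'" by (simp add: eventually_nhds_metric)
    qed
    then have "openin (top_of_set (U - Bad)) ((U - Bad) \<inter> T')"
      using openin_open_Int[of "(U - Bad) \<inter> T'" "U - Bad"] by (simp add: Int_absorb2 flip: Int_assoc)
    with cl conn have "(U - Bad) \<inter> T' = {} \<or> (U - Bad) \<inter> T' = U - Bad"
      unfolding connected_clopen by blast
    moreover have "0 \<in> (U - Bad) \<inter> T'" using S01 attained_w1 by (simp add: T'_def L01)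
    ultimately have "1 \<in> T'" using S01 by blast
    then show ?thesis by (simp add: T'_def L01)
  qed
  have "\<exists>y\<in>crit_box n c r. \<forall>i<n. crit_val n y i = w i" if w: "\<forall>i<n. norm (w i - crit_val n c i) < \<epsilon>" for w
  proof -
    \<comment> \<open>An arbitrary target is a limit of targets with distinct entries, and the
      corresponding solutions accumulate in the compact box.\<close>
    define W where "W k = (\<lambda>i. w i + s k * (of_nat i - 0))" for k
    have e1: "\<forall>\<^sub>F k in sequentially. inj_on (W k) {..<n}"
      unfolding W_def by (rule eventually_perturbation_inj[OF injn s])
    have e2: "\<forall>\<^sub>F k in sequentially. \<forall>i\<in>{..<n}. norm (W k i - crit_val n c i) < \<epsilon>"
    proof (intro eventually_ball_finite ballI)
      fix i assume "i \<in> {..<n}"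
      have "(\<lambda>k. norm (W k i - crit_val n c i)) \<longlonglongrightarrow> norm (w i - crit_val n c i)"
        unfolding W_def by (intro tendsto_intros plim)
      then show "\<forall>\<^sub>F k in sequentially. norm (W k i - crit_val n c i) < \<epsilon>"
        by (rule order_tendstoD) (use w \<open>i \<in> {..<n}\<close> in auto)
    qed simp
    have "\<forall>\<^sub>F k in sequentially. \<exists>y\<in>crit_box n c q. \<forall>i<n. crit_val n y i = W k i"
      using e1 e2 by eventually_elim (rule distinct_case; simp)
    then obtain N where "\<forall>k\<ge>N. \<exists>y\<in>crit_box n c q. \<forall>i<n. crit_val n y i = W k i"
      unfolding eventually_sequentially by blast
    then have "\<forall>k. \<exists>y. y \<in> crit_box n c q \<and> (\<forall>i<n. crit_val n y i = W (k + N) i)"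
      by (metis le_add2)
    then obtain y where y: "\<And>k. y k \<in> crit_box n c q" "\<And>k i. i < n \<Longrightarrow> crit_val n (y k) i = W (k + N) i" by metis
    obtain z t where z: "strict_mono (t :: nat \<Rightarrow> nat)" "\<And>i. (\<lambda>j. y (t j) i) \<longlonglongrightarrow> z i" "z \<in> crit_box n c q"
      using crit_box_subsequence[of y] y(1) by blast
    have "crit_val n z i = w i" if i: "i < n" for i
    proof (rule LIMSEQ_unique)
      show "(\<lambda>j. crit_val n (y (t j)) i) \<longlonglongrightarrow> crit_val n z i" by (intro tendsto_crit_val z i)
      have "(\<lambda>k. W (k + N) i) \<longlonglongrightarrow> w i" unfolding W_def by (rule LIMSEQ_ignore_initial_segment[OF plim])
      from LIMSEQ_subseq_LIMSEQ[OF this z(1)]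
      show "(\<lambda>j. crit_val n (y (t j)) i) \<longlonglongrightarrow> w i" unfolding y(2)[OF i] by (simp add: o_def)
    qed
    then show ?thesis using z(3) crit_box_mono[OF q(2)] by blast
  qed
  then show ?thesis using \<epsilon>(1) by blast
qed

section \<open>Multisets of critical values and translation classes\<close>

lemma tendsto_if_coordinates:
  fixes x :: "'k \<Rightarrow> nat \<Rightarrow> complex"
  assumes "\<And>i. ((\<lambda>k. x k i) \<longlongrightarrow> c i) F"
  shows "(x \<longlongrightarrow> c) F"
proof -
  have "limitin (product_topology (\<lambda>i::nat. euclidean) UNIV) x c F"
    unfolding limitin_componentwise using assms by auto
  then show ?thesis by (simp add: euclidean_product_topology)
qed

lemma tuple_to_mset_cong:
  "(\<And>i. i < n \<Longrightarrow> f i = g i) \<Longrightarrow> tuple_to_mset n f = tuple_to_mset n g"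
  unfolding tuple_to_mset_def by (rule image_mset_cong) auto

lemma set_mset_tuple_to_mset [simp]: "set_mset (tuple_to_mset n f) = f ` {..<n}"
  by (simp add: tuple_to_mset_def)

lemma tuple_to_mset_eq_imp_permutes:
  assumes "tuple_to_mset n f = tuple_to_mset n g"
  obtains p where "p permutes {..<n}" "\<And>i. i < n \<Longrightarrow> f i = g (p i)"
  by (rule image_mset_eq_implies_permutes[OF finite_lessThan assms[unfolded tuple_to_mset_def]]) (use that in auto)

lemma tuple_to_mset_permute:
  assumes "p permutes {..<n}" "\<And>i. i < n \<Longrightarrow> f i = g (p i)"
  shows "tuple_to_mset n f = tuple_to_mset n g"
  unfolding tuple_to_mset_def by (rule permutes_implies_image_mset_eq[symmetric, OF assms(1)]) (use assms(2) in auto)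

lemma topspace_Mult_top: "topspace (Mult_top n) = tuple_to_mset n ` ({..<n} \<rightarrow>\<^sub>E UNIV)"
proof -
  let ?X = "product_topology (\<lambda>_. euclidean :: complex topology) {..<n}"
  let ?S = "tuple_to_mset n ` topspace ?X"
  have "{x \<in> topspace ?X. tuple_to_mset n x \<in> ?S} = topspace ?X" by auto
  then have "openin (Mult_top n) ?S"
    unfolding Mult_top_def openin_quotient_topology by (metis openin_topspace order_refl)
  moreover have "U \<subseteq> ?S" if "openin (Mult_top n) U" for U
    using that unfolding Mult_top_def openin_quotient_topology by blast
  ultimately have "topspace (Mult_top n) = ?S" unfolding topspace_def by blast
  then show ?thesis by simp
qed

lemma pathin_Mult_top_ordering:
  assumes "pathin (Mult_top n) \<alpha>" "t \<in> {0..1}"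
  obtains w where "tuple_to_mset n w = \<alpha> t"
proof -
  have "\<alpha> t \<in> topspace (Mult_top n)"
    using assms continuous_map_image_subset_topspace[of "top_of_set {0..1}" "Mult_top n" \<alpha>]
    unfolding pathin_def by auto
  then show ?thesis using that unfolding topspace_Mult_top by auto
qed

text \<open>The quotient map onto multisets is open, since the saturation of an open box is the union of its
  images under coordinate permutations.\<close>
lemma pathin_Mult_top_nearby_ordering:
  assumes \<alpha>: "pathin (Mult_top n) \<alpha>" and t: "t \<in> {0..1}" and w: "tuple_to_mset n w = \<alpha> t" and e: "e > 0"
  shows "\<exists>\<delta>>0. \<forall>s\<in>{0..1}. \<bar>s - t\<bar> < \<delta> \<longrightarrow>
           (\<exists>w'. tuple_to_mset n w' = \<alpha> s \<and> (\<forall>i<n. norm (w' i - w i) < e))"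
proof -
  let ?X = "product_topology (\<lambda>_. euclidean :: complex topology) {..<n}"
  define B where "B p = (\<Pi>\<^sub>E i\<in>{..<n}. ball (w (p i)) e)" for p
  define V where "V = tuple_to_mset n ` B id"
  have oB: "openin ?X (B p)" for p unfolding B_def by (simp add: openin_PiE)
  have "{x \<in> topspace ?X. tuple_to_mset n x \<in> V} = (\<Union>p\<in>{p. p permutes {..<n}}. B p)" (is "?L = ?R")
  proof
    show "?L \<subseteq> ?R"
    proof
      fix x assume x: "x \<in> ?L"
      then obtain g where g: "g \<in> B id" "tuple_to_mset n x = tuple_to_mset n g" by (auto simp: V_def)
      obtain p where p: "p permutes {..<n}" "\<And>i. i < n \<Longrightarrow> x i = g (p i)"
        using tuple_to_mset_eq_imp_permutes[OF g(2)] by blast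
      have "x i \<in> ball (w (p i)) e" if "i < n" for i
        using g(1) p that permutes_in_image[OF p(1), of i] by (auto simp: B_def PiE_iff)
      then have "x \<in> B p" using x by (auto simp: B_def PiE_iff)
      then show "x \<in> ?R" using p by blast
    qed
    show "?R \<subseteq> ?L"
    proof
      fix x assume "x \<in> ?R"
      then obtain p where p: "p permutes {..<n}" "x \<in> B p" by blast
      define g where "g i = (if i < n then x (inv p i) else undefined)" for i
      have "x i = g (p i)" if "i < n" for i
        using that p permutes_in_image[OF p(1), of i] by (simp add: g_def permutes_inverses)
      then have "tuple_to_mset n x = tuple_to_mset n g" by (rule tuple_to_mset_permute[OF p(1)])
      moreover have "g \<in> B id"
      proof -
        have "x (inv p i) \<in> ball (w i) e" if "i < n" for i
        proof -
          have "inv p i \<in> {..<n}" using permutes_in_image[OF permutes_inv[OF p(1)], of i] that by simp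
          then have "x (inv p i) \<in> ball (w (p (inv p i))) e" using p(2) unfolding B_def by blast
          then show ?thesis by (simp only: permutes_inverses(1)[OF p(1)])
        qed
        then show ?thesis by (auto simp: B_def PiE_iff g_def extensional_def)
      qed
      ultimately show "x \<in> ?L" using p(2) by (auto simp: V_def B_def PiE_iff)
    qed
  qed
  then have "openin ?X {x \<in> topspace ?X. tuple_to_mset n x \<in> V}" using oB by auto
  moreover have "V \<subseteq> tuple_to_mset n ` topspace ?X" by (auto simp: V_def B_def PiE_iff)
  ultimately have "openin (Mult_top n) V" unfolding Mult_top_def openin_quotient_topology by blast
  then have "openin (top_of_set {0..1}) {s \<in> topspace (top_of_set {0..1}). \<alpha> s \<in> V}"
    using \<alpha> unfolding pathin_def by (rule openin_continuous_map_preimage[rotated])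
  moreover have "\<alpha> t \<in> V"
  proof -
    have "restrict w {..<n} \<in> B id" using e by (auto simp: B_def)
    moreover have "tuple_to_mset n (restrict w {..<n}) = \<alpha> t" unfolding w[symmetric] by (rule tuple_to_mset_cong) simp
    ultimately show ?thesis unfolding V_def by (metis imageI)
  qed
  ultimately obtain \<delta> where \<delta>: "\<delta> > 0" "\<And>s. s \<in> {0..1} \<Longrightarrow> dist s t < \<delta> \<Longrightarrow> \<alpha> s \<in> V"
    using t unfolding openin_euclidean_subtopology_iff by auto
  show ?thesis
  proof (intro exI[of _ \<delta>] conjI ballI impI \<delta>(1))
    fix s assume "s \<in> {0..1}" "\<bar>s - t\<bar> < \<delta>"
    then have "\<alpha> s \<in> V" using \<delta>(2) by (simp add: dist_real_def)
    then show "\<exists>w'. tuple_to_mset n w' = \<alpha> s \<and> (\<forall>i<n. norm (w' i - w i) < e)"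
      by (force simp: V_def B_def PiE_iff dist_norm norm_minus_commute)
  qed
qed

text \<open>Uniqueness of limits for multisets. A single late index is enough: up to a permutation
  its tuple is close to the ordering \<open>w\<close> of \<open>\<alpha> t\<close>, it is also close
  to \<open>Y\<close>, and the separation \<open>r0\<close> turns closeness into equality.\<close>

lemma pathin_Mult_top_limit:
  assumes \<alpha>: "pathin (Mult_top n) \<alpha>" and tk: "\<And>k. \<tau> k \<in> {0..1}" "\<tau> \<longlonglongrightarrow> t"
    and X: "\<And>k. tuple_to_mset n (X k) = \<alpha> (\<tau> k)" "\<And>i. i < n \<Longrightarrow> (\<lambda>k. X k i) \<longlonglongrightarrow> Y i"
  shows "tuple_to_mset n Y = \<alpha> t"
proof -
  have t: "t \<in> {0..1}" using closed_sequentially[OF closed_atLeastAtMost tk(1) tk(2)] by blast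
  obtain w where w: "tuple_to_mset n w = \<alpha> t" using pathin_Mult_top_ordering[OF \<alpha> t] by blast
  obtain r0 where r0: "r0 > 0" "\<And>a b. a \<in> Y ` {..<n} \<union> w ` {..<n} \<Longrightarrow> b \<in> Y ` {..<n} \<union> w ` {..<n} \<Longrightarrow> dist a b < r0 \<Longrightarrow> a = b"
    using finite_separation[of "Y ` {..<n} \<union> w ` {..<n}"] by blast
  have r2: "r0/2 > 0" using r0(1) by simp
  obtain \<delta> where \<delta>: "\<delta> > 0" "\<And>s. s \<in> {0..1} \<Longrightarrow> \<bar>s - t\<bar> < \<delta> \<Longrightarrow>
           (\<exists>w'. tuple_to_mset n w' = \<alpha> s \<and> (\<forall>i<n. norm (w' i - w i) < r0/2))"
    using pathin_Mult_top_nearby_ordering[OF \<alpha> t w r2] by blast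
  have "\<forall>\<^sub>F k in sequentially. \<forall>i\<in>{..<n}. dist (X k i) (Y i) < r0/2"
    using r2 by (intro eventually_ball_finite ballI tendstoD[OF X(2)]) auto
  moreover have "\<forall>\<^sub>F k in sequentially. dist (\<tau> k) t < \<delta>" by (rule tendstoD[OF tk(2) \<delta>(1)])
  ultimately have "\<forall>\<^sub>F k in sequentially. (\<forall>i\<in>{..<n}. dist (X k i) (Y i) < r0/2) \<and> dist (\<tau> k) t < \<delta>"
    by (rule eventually_conj)
  from eventually_happens'[OF sequentially_bot this] obtain k where
    k: "\<And>i. i < n \<Longrightarrow> dist (X k i) (Y i) < r0/2" "dist (\<tau> k) t < \<delta>" by blast
  obtain w' where w': "tuple_to_mset n w' = \<alpha> (\<tau> k)" "\<And>i. i < n \<Longrightarrow> norm (w' i - w i) < r0/2"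
    using \<delta>(2)[OF tk(1)[of k]] k(2) by (auto simp: dist_real_def)
  obtain p where p: "p permutes {..<n}" "\<And>i. i < n \<Longrightarrow> X k i = w' (p i)"
    using tuple_to_mset_eq_imp_permutes[of n "X k" w'] X(1)[of k] w'(1) by metis
  have "Y i = w (p i)" if i: "i < n" for i
  proof (rule r0(2))
    have pi: "p i < n" using permutes_in_image[OF p(1), of i] i by simp
    then show "w (p i) \<in> Y ` {..<n} \<union> w ` {..<n}" by simp
    show "Y i \<in> Y ` {..<n} \<union> w ` {..<n}" using i by simp
    have "dist (X k i) (w (p i)) < r0/2" using w'(2)[OF pi] p(2)[OF i] by (simp add: dist_norm)
    then show "dist (Y i) (w (p i)) < r0" using k(1)[OF i] dist_triangle3[of "Y i" "w (p i)" "X k i"] by linarith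
  qed
  then show ?thesis using tuple_to_mset_permute[of p n Y w] p(1) w by simp
qed

text \<open>Times with unbounded values would accumulate at some \<open>t\<close>, near which all
  values lie within 1 of an ordering of \<open>\<alpha> t\<close>.\<close>

lemma pathin_Mult_top_bounded:
  assumes \<alpha>: "pathin (Mult_top n) \<alpha>"
  obtains R where "\<And>t v. t \<in> {0..1} \<Longrightarrow> v \<in># \<alpha> t \<Longrightarrow> norm v \<le> R"
proof -
  have "\<exists>R. \<forall>t\<in>{0..1}. \<forall>v\<in>#\<alpha> t. norm v \<le> R"
  proof (rule ccontr)
    assume neg: "\<not> ?thesis"
    have "\<forall>k::nat. \<exists>t v. t \<in> {0..1} \<and> v \<in># \<alpha> t \<and> real k < norm v" using neg by (meson not_le)
    then obtain \<tau> v where tv: "\<And>k::nat. \<tau> k \<in> {0..1}" "\<And>k. v k \<in># \<alpha> (\<tau> k)" "\<And>k. real k < norm (v k)" by metis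
    have "seq_compact {0..1::real}" by (simp add: compact_imp_seq_compact)
    then obtain t r where r: "t \<in> {0..1}" "strict_mono (r :: nat \<Rightarrow> nat)" "(\<tau> \<circ> r) \<longlonglongrightarrow> t"
      using tv(1) by (meson seq_compactE)
    obtain w where w: "tuple_to_mset n w = \<alpha> t" using pathin_Mult_top_ordering[OF \<alpha> r(1)] by blast
    obtain \<delta> where \<delta>: "\<delta> > 0" "\<And>s. s \<in> {0..1} \<Longrightarrow> \<bar>s - t\<bar> < \<delta> \<Longrightarrow>
           (\<exists>w'. tuple_to_mset n w' = \<alpha> s \<and> (\<forall>i<n. norm (w' i - w i) < 1))"
      using pathin_Mult_top_nearby_ordering[OF \<alpha> r(1) w zero_less_one] by blast
    define K where "K = (\<Sum>i<n. norm (w i)) + 1"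
    have "\<forall>\<^sub>F k in sequentially. dist ((\<tau> \<circ> r) k) t < \<delta>" by (rule tendstoD[OF r(3) \<delta>(1)])
    then have "\<forall>\<^sub>F k in sequentially. dist ((\<tau> \<circ> r) k) t < \<delta> \<and> k \<ge> nat \<lceil>K\<rceil>"
      by (intro eventually_conj eventually_ge_at_top)
    from eventually_happens'[OF sequentially_bot this] obtain k where k: "dist (\<tau> (r k)) t < \<delta>" "k \<ge> nat \<lceil>K\<rceil>"
      by auto
    obtain w' where w': "tuple_to_mset n w' = \<alpha> (\<tau> (r k))" "\<And>i. i < n \<Longrightarrow> norm (w' i - w i) < 1"
      using \<delta>(2)[OF tv(1)[of "r k"]] k(1) by (auto simp: dist_real_def)
    obtain i where i: "i < n" "v (r k) = w' i" using tv(2)[of "r k"] unfolding w'(1)[symmetric] by auto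
    have "norm (w' i) \<le> norm (w i) + 1" using w'(2)[OF i(1)] norm_triangle_sub[of "w' i" "w i"] by linarith
    also have "norm (w i) \<le> (\<Sum>i<n. norm (w i))" using i by (intro member_le_sum) auto
    finally have "norm (v (r k)) \<le> K" by (simp add: i K_def)
    moreover have "K \<le> real k" using k(2) by linarith
    moreover have "real k \<le> real (r k)" using seq_suble[OF r(2)] by simp
    ultimately show False using tv(3)[of "r k"] by linarith
  qed
  then show ?thesis using that by blast
qed

section \<open>Critical values in coordinates, and translations\<close>

lemma image_mset_proots:
  fixes q :: "complex poly"
  assumes "q \<noteq> 0"
  shows "(\<Sum>c\<in>{c. poly q c = 0}. replicate_mset (order c q) (f c)) = image_mset f (proots q)"
proof (rule multiset_eqI)
  fix y
  have fin: "finite {c. poly q c = 0}" by (rule poly_roots_finite[OF assms])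
  have "count (\<Sum>c\<in>{c. poly q c = 0}. replicate_mset (order c q) (f c)) y = (\<Sum>c\<in>{c. poly q c = 0}. if f c = y then order c q else 0)"
    unfolding count_sum by (intro sum.cong) auto
  also have "\<dots> = (\<Sum>c\<in>{c \<in> {c. poly q c = 0}. f c = y}. order c q)"
    by (rule sum.inter_filter[symmetric, OF fin])
  also have "\<dots> = count (image_mset f (proots q)) y"
    unfolding count_image_mset using assms by (intro sum.cong) auto
  finally show "count (\<Sum>c\<in>{c. poly q c = 0}. replicate_mset (order c q) (f c)) y = count (image_mset f (proots q)) y" .
qed

lemma cvl_crit_poly: "cvl (crit_poly n x) = tuple_to_mset n (crit_val n x)"
proof -
  have "cvl (crit_poly n x) = image_mset (poly (crit_poly n x)) (proots (pderiv (crit_poly n x)))"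
    unfolding cvl_def by (rule image_mset_proots) (simp del: of_nat_Suc)
  also have "proots (pderiv (crit_poly n x)) = image_mset x (mset_set {..<n})"
    by (simp add: proots_root_poly del: of_nat_Suc)
  finally show ?thesis by (simp add: tuple_to_mset_def crit_val_def[abs_def] multiset.map_comp o_def)
qed

lemma coeff_root_poly_Suc: "coeff (root_poly (Suc m) x) m = - (\<Sum>i\<le>m. x i)"
proof (induction m)
  case 0
  show ?case by (simp add: root_poly_def)
next
  case (Suc m)
  have "coeff (p * [:- a, 1:]) (Suc k) = coeff p k - a * coeff p (Suc k)" for p :: "complex poly" and a k
    by simp
  then show ?case unfolding root_poly_Suc[of "Suc m"] using Suc.IH by (simp only:) simp
qed

lemma ex_crit_poly_eq:
  assumes "monic_deg (Suc n) p"
  obtains x where "crit_poly n x = p" "\<And>i. i > n \<Longrightarrow> x i = 0"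
proof -
  have p: "degree p = Suc n" "coeff p (Suc n) = 1" using assms by (auto simp: monic_deg_def)
  have d: "degree (pderiv p) = n" using p by (simp add: degree_pderiv)
  have lc: "coeff (pderiv p) n = of_nat (Suc n)" using p by (simp add: coeff_pderiv del: of_nat_Suc)
  obtain \<rho> where \<rho>: "smult (lead_coeff (pderiv p)) (\<Prod>i<degree (pderiv p). [:- \<rho> i, 1:]) = pderiv p"
    using complex_poly_decompose' by blast
  define x where "x i = (if i < n then \<rho> i else if i = n then coeff p 0 else 0)" for i
  have "root_poly n x = (\<Prod>i<n. [:- \<rho> i, 1:])" unfolding root_poly_def by (intro prod.cong) (auto simp: x_def)
  then have "pderiv (crit_poly n x) = pderiv p" using \<rho> by (simp add: d lc del: of_nat_Suc)
  then have "crit_poly n x = p" by (rule poly_eq_if_pderiv_eq) (simp add: coeff_crit_poly x_def)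
  then show ?thesis using that[of x] by (auto simp: x_def)
qed

lemma coeff_crit_poly_n:
  assumes "n \<ge> 1"
  shows "coeff (crit_poly n x) n = - (of_nat (Suc n) / of_nat n) * (\<Sum>i<n. x i)"
proof -
  obtain m where m: "n = Suc m" using assms by (cases n) auto
  show ?thesis by (simp add: coeff_crit_poly m coeff_root_poly_Suc lessThan_Suc_atMost del: of_nat_Suc)
qed

lemma centered_monic_crit_poly_iff:
  assumes "n \<ge> 1" "\<And>i. i > n \<Longrightarrow> x i = 0"
  shows "centered_monic (Suc n) (crit_poly n x) \<longleftrightarrow> x \<in> crit_space n"
  using assms by (auto simp: centered_monic_def monic_deg_def coeff_crit_poly_n crit_space_def simp del: of_nat_Suc)

lemma ex_crit_space_if_centered:
  assumes "n \<ge> 1" "centered_monic (Suc n) p"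
  obtains x where "x \<in> crit_space n" "crit_poly n x = p"
proof -
  obtain x where x: "crit_poly n x = p" "\<And>i. i > n \<Longrightarrow> x i = 0"
    using ex_crit_poly_eq[of n p] assms(2) unfolding centered_monic_def by blast
  then show ?thesis using that[of x] centered_monic_crit_poly_iff[of n x] assms by simp
qed

text \<open>The parameters of \<open>p(z + b)\<close>: critical points move by \<open>- b\<close>,
  and the new constant term is \<open>p(b)\<close>.\<close>

definition shift_crit :: "nat \<Rightarrow> complex \<Rightarrow> (nat \<Rightarrow> complex) \<Rightarrow> nat \<Rightarrow> complex" where
  "shift_crit n b y = (\<lambda>i. if i < n then y i - b else if i = n then poly (crit_poly n y) b else 0)"

lemma pcompose_crit_poly: "pcompose (crit_poly n y) [:b, 1:] = crit_poly n (shift_crit n b y)"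
proof (rule poly_eq_if_pderiv_eq)
  have "pcompose (root_poly n y) [:b, 1:] = root_poly n (shift_crit n b y)"
    unfolding root_poly_def pcompose_prod
    by (intro prod.cong) (auto simp: shift_crit_def pcompose_pCons)
  then show "pderiv (pcompose (crit_poly n y) [:b, 1:]) = pderiv (crit_poly n (shift_crit n b y))"
    by (simp add: pderiv_pcompose pderiv_pCons pcompose_smult del: of_nat_Suc)
  show "coeff (pcompose (crit_poly n y) [:b, 1:]) 0 = coeff (crit_poly n (shift_crit n b y)) 0"
    by (simp add: coeff_pcompose_0 coeff_crit_poly shift_crit_def)
qed

lemma cvl_translate:
  assumes "monic_deg (Suc n) p"
  shows "cvl (pcompose p [:b, 1:]) = cvl p"
proof -
  obtain y where y: "crit_poly n y = p" using ex_crit_poly_eq[OF assms] by blast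
  have "crit_val n (shift_crit n b y) i = crit_val n y i" if "i < n" for i
  proof -
    have "crit_val n (shift_crit n b y) i = poly (pcompose (crit_poly n y) [:b, 1:]) (y i - b)"
      unfolding pcompose_crit_poly using that by (simp add: crit_val_def shift_crit_def)
    then show ?thesis by (simp add: poly_pcompose crit_val_def)
  qed
  then show ?thesis unfolding y[symmetric] pcompose_crit_poly cvl_crit_poly by (rule tuple_to_mset_cong)
qed

lemma sum_shift_crit: "(\<Sum>i<n. shift_crit n b y i) = (\<Sum>i<n. y i) - of_nat n * b"
  by (simp add: shift_crit_def sum_subtractf)

lemma centered_translate_exists:
  assumes "n \<ge> 1" "monic_deg (Suc n) p"
  obtains b where "centered_monic (Suc n) (pcompose p [:b, 1:])"
proof -
  obtain y where y: "crit_poly n y = p" using ex_crit_poly_eq[OF assms(2)] by blast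
  \<comment> \<open>The barycentre of the critical points.\<close>
  define b where "b = (\<Sum>i<n. y i) / of_nat n"
  have "shift_crit n b y \<in> crit_space n"
    using assms(1) sum_shift_crit[of n b y] by (auto simp: crit_space_def b_def) (simp add: shift_crit_def)
  then have "centered_monic (Suc n) (crit_poly n (shift_crit n b y))"
    using centered_monic_crit_poly_iff[OF assms(1), of "shift_crit n b y"] by (simp add: shift_crit_def)
  then show ?thesis using that unfolding pcompose_crit_poly[symmetric] y by blast
qed

text \<open>Centring forces \<open>n * b\<close> to be the sum of the critical points. Hence two
  lifts that start in the same class start at the same polynomial.\<close>

lemma centered_translate_unique:
  assumes n: "n \<ge> 1" and p: "monic_deg (Suc n) p"
    and q: "translate_equiv p q" "centered_monic (Suc n) q"
    and q': "translate_equiv p q'" "centered_monic (Suc n) q'"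
  shows "q = q'"
proof -
  obtain y where y: "crit_poly n y = p" using ex_crit_poly_eq[OF p] by blast
  have *: "of_nat n * b = (\<Sum>i<n. y i)" if "centered_monic (Suc n) (pcompose p [:b, 1:])" for b
  proof -
    have "shift_crit n b y \<in> crit_space n"
      using that centered_monic_crit_poly_iff[OF n, of "shift_crit n b y"]
      unfolding pcompose_crit_poly y[symmetric] by (simp add: shift_crit_def)
    then show ?thesis using sum_shift_crit[of n b y] by (simp add: crit_space_def)
  qed
  obtain b b' where "q = pcompose p [:b, 1:]" "q' = pcompose p [:b', 1:]"
    using q(1) q'(1) by (auto simp: translate_equiv_def)
  moreover from this have "of_nat n * b = of_nat n * b'" using * q(2) q'(2) by metis
  then have "b = b'" using n by simp
  ultimately show ?thesis by simp
qed

section \<open>Lifting of paths\<close>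

text \<open>An infinite fibre contains an injective sequence, bounded by properness. A convergent
  subsequence of it would be eventually constant by rigidity.\<close>

lemma crit_val_fiber_finite:
  assumes n: "n \<ge> 1"
  shows "finite {x \<in> crit_space n. \<forall>i<n. crit_val n x i = w i}" (is "finite ?S")
proof (rule ccontr)
  assume "infinite ?S"
  then obtain x :: "nat \<Rightarrow> nat \<Rightarrow> complex" where x: "inj x" "range x \<subseteq> ?S"
    using infinite_countable_subset by blast
  have xs: "x k \<in> crit_space n" and xv: "i < n \<Longrightarrow> crit_val n (x k) i = w i" for k i
    using x(2) by blast+
  define R where "R = (\<Sum>i<n. norm (w i))"
  obtain B where B: "\<And>y. y \<in> crit_space n \<Longrightarrow> (\<And>i. i < n \<Longrightarrow> norm (crit_val n y i) \<le> R) \<Longrightarrow> \<forall>i\<le>n. norm (y i) \<le> B"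
    using crit_val_proper[OF n, of R] by blast
  have "norm (w i) \<le> R" if "i < n" for i unfolding R_def using that by (intro member_le_sum) auto
  then have xb: "\<forall>i\<le>n. norm (x k i) \<le> B" for k using B[OF xs] xv by simp
  have "norm (x k i) \<le> \<bar>B\<bar>" for k i
  proof (cases "i \<le> n")
    case True
    then show ?thesis using xb[of k] by fastforce
  next
    case False
    then show ?thesis using xs[of k] by (simp add: crit_space_def)
  qed
  then obtain c r where r: "strict_mono (r :: nat \<Rightarrow> nat)" "\<And>i. (\<lambda>k. x (r k) i) \<longlonglongrightarrow> c i"
    using bounded_tuples_subsequence[of x "\<lambda>_. \<bar>B\<bar>"] by blast
  have "\<forall>\<^sub>F k in sequentially. x (r k) = c"
    by (rule crit_val_fiber_isolated[OF n xs r(2) xv])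
  then obtain N where N: "\<And>k. k \<ge> N \<Longrightarrow> x (r k) = c" unfolding eventually_sequentially by blast
  then have "x (r N) = x (r (Suc N))" by simp
  then have "r N = r (Suc N)" using x(1) by (simp add: inj_eq)
  then show False using r(1) by (simp add: strict_mono_eq)
qed

text \<open>Links boxes to the metric on the function space in which paths are selected: all but
  finitely many coordinates vanish, so coordinatewise closeness is closeness.\<close>

lemma crit_box_subset_ball:
  assumes x: "x \<in> crit_space n" and e: "e > 0"
  shows "\<exists>r>0. crit_box n x r \<subseteq> ball x e"
proof (rule ccontr)
  assume neg: "\<not> ?thesis"
  have "\<exists>y. y \<in> crit_box n x (inverse (real (Suc k))) \<and> y \<notin> ball x e" for k
  proof -
    have "inverse (real (Suc k)) > 0" by simp
    then show ?thesis using neg by blast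
  qed
  then obtain y where y: "\<And>k. y k \<in> crit_box n x (inverse (real (Suc k)))" "\<And>k. y k \<notin> ball x e" by metis
  have "(\<lambda>k. y k i) \<longlonglongrightarrow> x i" for i
  proof (cases "i \<le> n")
    case True
    then have "norm (y k i - x i) \<le> inverse (real (Suc k))" for k using y(1)[of k] by (auto simp: crit_box_def)
    then have "(\<lambda>k. y k i - x i) \<longlonglongrightarrow> 0"
      by (rule Lim_null_comparison[OF eventuallyI LIMSEQ_inverse_real_of_nat])
    then show ?thesis by (simp only: LIM_zero_iff)
  next
    case False
    then have "y k i = x i" for k using y(1)[of k] x by (simp add: crit_space_def crit_box_def)
    then show ?thesis by simp
  qed
  then have "y \<longlonglongrightarrow> x" by (rule tendsto_if_coordinates)
  from tendstoD[OF this e] obtain k where "dist (y k) x < e"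
    using eventually_happens'[OF sequentially_bot] by blast
  then show False using y(2)[of k] by (simp add: dist_commute)
qed

lemma pathin_Poly_mt_top_crit_poly:
  assumes n: "n \<ge> 1" and g: "continuous_on {0..1} g" "\<And>t. t \<in> {0..1} \<Longrightarrow> g t \<in> crit_space n"
  shows "pathin (Poly_mt_top (Suc n)) (\<lambda>t. crit_poly n (g t))"
  unfolding pathin_def Poly_mt_top_def
proof (rule continuous_map_pullback')
  have "continuous_on {0..1} (\<lambda>t. coeff (crit_poly n (g t)) i)" for i
    unfolding continuous_on_def
  proof
    fix t :: real assume "t \<in> {0..1}"
    then have "((\<lambda>s. g s j) \<longlongrightarrow> g t j) (at t within {0..1})" for j
      using continuous_on_product_then_coordinatewise[OF g(1), of j] by (auto simp: continuous_on_def)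
    then have "coeffs_tendsto (\<lambda>s. crit_poly n (g s)) (crit_poly n (g t)) (at t within {0..1})"
      by (rule coeffs_tendsto_crit_poly)
    then show "((\<lambda>s. coeff (crit_poly n (g s)) i) \<longlongrightarrow> coeff (crit_poly n (g t)) i) (at t within {0..1})"
      by (simp add: coeffs_tendsto_def)
  qed
  then show "continuous_map (top_of_set {0..1}) (product_topology (\<lambda>_. euclidean) UNIV) ((\<lambda>p i. coeff p i) \<circ> (\<lambda>t. crit_poly n (g t)))"
    by (simp add: continuous_map_componentwise_UNIV o_def)
  show "topspace (top_of_set {0..1}) \<subseteq> (\<lambda>t. crit_poly n (g t)) -` {p. centered_monic (Suc n) p}"
  proof
    fix t assume "t \<in> topspace (top_of_set {0..1::real})"
    then have x: "g t \<in> crit_space n" using g(2) by simp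
    then have "g t i = 0" if "i > n" for i using that by (simp add: crit_space_def)
    then show "t \<in> (\<lambda>t. crit_poly n (g t)) -` {p. centered_monic (Suc n) p}"
      using centered_monic_crit_poly_iff[of n "g t"] n x by simp
  qed
qed

text \<open>\<open>F t\<close> holds every labelled tuple whose values form
  \<open>\<alpha> t\<close>, so the selection itself takes care of the labels. Properness makes the
  graph compact, finitely many orderings with finite fibres make \<open>F t\<close> finite, and
  openness supplies neighbours.\<close>

lemma crit_tuple_lift_exists:
  assumes n: "n \<ge> 1" and \<alpha>: "pathin (Mult_top n) \<alpha>"
    and x0: "x0 \<in> crit_space n" "tuple_to_mset n (crit_val n x0) = \<alpha> 0"
  shows "\<exists>g. continuous_on {0..1} g \<and> g 0 = x0 \<and>
           (\<forall>t\<in>{0..1}. g t \<in> crit_space n \<and> tuple_to_mset n (crit_val n (g t)) = \<alpha> t)"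
proof -
  define F where "F t = {x \<in> crit_space n. tuple_to_mset n (crit_val n x) = \<alpha> t}" for t
  obtain R where R: "\<And>t v. t \<in> {0..1} \<Longrightarrow> v \<in># \<alpha> t \<Longrightarrow> norm v \<le> R"
    using pathin_Mult_top_bounded[OF \<alpha>] by blast
  obtain B where B: "\<And>y. y \<in> crit_space n \<Longrightarrow> (\<And>i. i < n \<Longrightarrow> norm (crit_val n y i) \<le> R) \<Longrightarrow> \<forall>i\<le>n. norm (y i) \<le> B"
    using crit_val_proper[OF n, of R] by blast
  have FB: "norm (x i) \<le> \<bar>B\<bar>" if "t \<in> {0..1}" "x \<in> F t" for t x i
  proof (cases "i \<le> n")
    case True
    have "crit_val n x j \<in># \<alpha> t" if "j < n" for j
    proof -
      have "\<alpha> t = tuple_to_mset n (crit_val n x)" using \<open>x \<in> F t\<close> by (simp add: F_def)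
      then show ?thesis using that by simp
    qed
    then have "\<forall>i\<le>n. norm (x i) \<le> B" using B[of x] R[OF that(1)] that(2) by (simp add: F_def)
    then show ?thesis using True by fastforce
  next
    case False
    then show ?thesis using that by (simp add: F_def crit_space_def)
  qed
  have "\<exists>g. continuous_on {0..1} g \<and> g 0 = x0 \<and> (\<forall>t\<in>{0..1}. g t \<in> F t)"
  proof (rule finite_valued_path_selection)
    define E where "E = (SIGMA t:{0..1::real}. F t)"
    have "closed E"
      unfolding closed_sequential_limits
    proof (intro allI impI, elim conjE)
      fix z l assume z: "\<forall>k. z k \<in> E" "z \<longlonglongrightarrow> l"
      obtain t x where l: "l = (t, x)" by (cases l)
      have t: "(\<lambda>k. fst (z k)) \<longlonglongrightarrow> t" using tendsto_fst[OF z(2)] by (simp add: l)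
      have "(\<lambda>k. snd (z k)) \<longlonglongrightarrow> x" using tendsto_snd[OF z(2)] by (simp add: l)
      then have x: "(\<lambda>k. snd (z k) i) \<longlonglongrightarrow> x i" for i by (rule tendsto_coordinate)
      have zk: "fst (z k) \<in> {0..1}" "snd (z k) \<in> crit_space n" "tuple_to_mset n (crit_val n (snd (z k))) = \<alpha> (fst (z k))" for k
        using z(1)[rule_format, of k] by (auto simp: E_def F_def)
      have "t \<in> {0..1}" using closed_sequentially[OF closed_atLeastAtMost zk(1) t] by blast
      moreover have "x \<in> crit_space n" by (rule crit_space_closed[OF zk(2) x])
      moreover have "tuple_to_mset n (crit_val n x) = \<alpha> t"
        by (rule pathin_Mult_top_limit[OF \<alpha> zk(1) t zk(3)]) (intro tendsto_crit_val x)
      ultimately show "l \<in> E" by (simp add: l E_def F_def)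
    qed
    moreover have "compact ({0..1::real} \<times> (Pi\<^sub>E UNIV (\<lambda>_::nat. cball (0::complex) \<bar>B\<bar>)))"
    proof (rule compact_Times)
      have "compactin (product_topology (\<lambda>_. euclidean) UNIV) (Pi\<^sub>E UNIV (\<lambda>i::nat. cball (0::complex) \<bar>B\<bar>))"
        unfolding compactin_PiE by (simp add: compactin_euclidean_iff)
      then show "compact (Pi\<^sub>E UNIV (\<lambda>_::nat. cball (0::complex) \<bar>B\<bar>))"
        by (simp add: euclidean_product_topology compactin_euclidean_iff)
    qed simp
    moreover have "E \<subseteq> {0..1} \<times> (Pi\<^sub>E UNIV (\<lambda>_::nat. cball (0::complex) \<bar>B\<bar>))"
      using FB by (auto simp: E_def)
    ultimately show "compact (SIGMA t:{0..1::real}. F t)"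
      unfolding E_def by (metis compact_Int_closed inf.absorb_iff2)
  next
    fix t :: real assume t: "t \<in> {0..1}"
    obtain w where w: "tuple_to_mset n w = \<alpha> t" using pathin_Mult_top_ordering[OF \<alpha> t] by blast
    have "F t \<subseteq> (\<Union>p\<in>{p. p permutes {..<n}}. {x \<in> crit_space n. \<forall>i<n. crit_val n x i = w (p i)})"
    proof
      fix x assume x: "x \<in> F t"
      then have "tuple_to_mset n (crit_val n x) = tuple_to_mset n w" using w by (simp add: F_def)
      then obtain p where "p permutes {..<n}" "\<And>i. i < n \<Longrightarrow> crit_val n x i = w (p i)"
        using tuple_to_mset_eq_imp_permutes by blast
      then show "x \<in> (\<Union>p\<in>{p. p permutes {..<n}}. {x \<in> crit_space n. \<forall>i<n. crit_val n x i = w (p i)})"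
        using x by (auto simp: F_def)
    qed
    then show "finite (F t)"
      by (rule finite_subset) (intro finite_UN_I finite_permutations finite_lessThan crit_val_fiber_finite n)
  next
    fix t :: real and x and e :: real assume t: "t \<in> {0..1}" and x: "x \<in> F t" and e: "e > 0"
    have xs: "x \<in> crit_space n" and xv: "tuple_to_mset n (crit_val n x) = \<alpha> t" using x by (auto simp: F_def)
    obtain r where r: "r > 0" "crit_box n x r \<subseteq> ball x e" using crit_box_subset_ball[OF xs e] by blast
    obtain \<epsilon> where \<epsilon>: "\<epsilon> > 0" "\<And>w. (\<forall>i<n. norm (w i - crit_val n x i) < \<epsilon>) \<Longrightarrow> (\<exists>y\<in>crit_box n x r. \<forall>i<n. crit_val n y i = w i)"
      using crit_val_open[OF n xs r(1)] by blast
    obtain \<delta> where \<delta>: "\<delta> > 0" "\<And>s. s \<in> {0..1} \<Longrightarrow> \<bar>s - t\<bar> < \<delta> \<Longrightarrow>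
         \<exists>w'. tuple_to_mset n w' = \<alpha> s \<and> (\<forall>i<n. norm (w' i - crit_val n x i) < \<epsilon>)"
      using pathin_Mult_top_nearby_ordering[OF \<alpha> t xv \<epsilon>(1)] by blast
    show "\<exists>\<delta>>0. \<forall>s\<in>{0..1}. \<bar>s - t\<bar> < \<delta> \<longrightarrow> (\<exists>y\<in>F s. dist x y < e)"
    proof (intro exI[of _ \<delta>] conjI ballI impI \<delta>(1))
      fix s :: real assume "s \<in> {0..1}" "\<bar>s - t\<bar> < \<delta>"
      then obtain w' where w': "tuple_to_mset n w' = \<alpha> s" "\<forall>i<n. norm (w' i - crit_val n x i) < \<epsilon>"
        using \<delta>(2) by blast
      obtain y where y: "y \<in> crit_box n x r" "\<forall>i<n. crit_val n y i = w' i" using \<epsilon>(2)[OF w'(2)] by blast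
      have "tuple_to_mset n (crit_val n y) = \<alpha> s" unfolding w'(1)[symmetric] by (rule tuple_to_mset_cong) (use y(2) in blast)
      then have "y \<in> F s" using y(1) by (simp add: F_def crit_box_def)
      moreover have "dist x y < e" using r(2) y(1) by auto
      ultimately show "\<exists>y\<in>F s. dist x y < e" by blast
    qed
  next
    show "x0 \<in> F 0" using x0 by (simp add: F_def)
  qed
  then show ?thesis by (simp add: F_def)
qed

section \<open>Uniqueness of the lift\<close>

lemma size_le_size_sum_mset:
  "(\<And>B. B \<in># P \<Longrightarrow> B \<noteq> {#}) \<Longrightarrow> size P \<le> size (sum_mset P)"
proof (induction P)
  case (add B P)
  have "1 \<le> size B" using add.prems[of B] by (cases B) auto
  moreover have "size P \<le> size (sum_mset P)" using add by simp
  ultimately have "1 + size P \<le> size B + size (sum_mset P)" by (rule add_mono)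
  then show ?case by simp
qed simp

text \<open>A shape has as many parts as the multiset has distinct elements, and summing within
  nonempty blocks cannot increase the number of parts.\<close>

lemma shape_le_imp_card_le:
  assumes "shape_le (Shape M) (Shape N)"
  shows "card (set_mset N) \<le> card (set_mset M)"
proof -
  obtain P where P: "\<forall>B \<in># P. B \<noteq> {#}" "sum_mset P = Shape M" "image_mset sum_mset P = Shape N"
    using assms unfolding shape_le_def by blast
  have "size (Shape N) = size P" using P(3) by (metis size_image_mset)
  also have "\<dots> \<le> size (Shape M)" using size_le_size_sum_mset[of P] P(1,2) by auto
  finally show ?thesis by (simp add: Shape_def)
qed

text \<open>Each entry of \<open>v\<close> attracts at least one value of \<open>f k\<close>. With
  no more values than attractors, each attracts exactly one, and \<open>g k\<close>, having the same
  values, must take that one too.\<close>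

lemma eventually_values_merge:
  fixes f g :: "nat \<Rightarrow> nat \<Rightarrow> complex"
  assumes f: "\<And>i. i < n \<Longrightarrow> (\<lambda>k. f k i) \<longlonglongrightarrow> v i" and g: "\<And>i. i < n \<Longrightarrow> (\<lambda>k. g k i) \<longlonglongrightarrow> v i"
    and eq: "\<And>k. f k ` {..<n} = g k ` {..<n}" and card: "\<And>k. card (f k ` {..<n}) \<le> card (v ` {..<n})"
  shows "\<forall>\<^sub>F k in sequentially. \<forall>i<n. \<forall>j<n. v i = v j \<longrightarrow> f k i = g k j"
proof -
  obtain r0 where r0: "r0 > 0" "\<And>a b. a \<in> v ` {..<n} \<Longrightarrow> b \<in> v ` {..<n} \<Longrightarrow> dist a b < r0 \<Longrightarrow> a = b"
    using finite_separation[of "v ` {..<n}"] by blast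
  have r2: "r0/2 > 0" using r0(1) by simp
  have "\<forall>\<^sub>F k in sequentially. \<forall>i\<in>{..<n}. dist (f k i) (v i) < r0/2"
    using r2 by (intro eventually_ball_finite ballI tendstoD[OF f]) auto
  moreover have "\<forall>\<^sub>F k in sequentially. \<forall>i\<in>{..<n}. dist (g k i) (v i) < r0/2"
    using r2 by (intro eventually_ball_finite ballI tendstoD[OF g]) auto
  ultimately show ?thesis
  proof eventually_elim
    case (elim k)
    have near: "v i = v j" if "i < n" "j < n" "dist z (v i) < r0/2" "dist z (v j) < r0/2" for i j z
      by (rule r0(2)) (use that dist_triangle3[of "v i" "v j" z] in auto)
    \<comment> \<open>\<open>h\<close> sends a value to the entry of \<open>v\<close> that it is
      close to. It maps the values of \<open>f k\<close> onto those of \<open>v\<close>, so the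
      bound on cardinalities makes it injective.\<close>
    define h where "h z = v (SOME i. i < n \<and> f k i = z)" for z
    have hf: "h (f k i) = v i" if i: "i < n" for i
    proof -
      define j where "j = (SOME j. j < n \<and> f k j = f k i)"
      have "j < n \<and> f k j = f k i" unfolding j_def by (rule someI[of _ i]) (use i in simp)
      then have "v j = v i" using near[of j i "f k i"] elim(1) i by (metis lessThan_iff)
      then show ?thesis by (simp add: h_def j_def)
    qed
    have hg: "h (g k j) = v j" if j: "j < n" for j
    proof -
      obtain l where l: "l < n" "g k j = f k l" using eq[of k] j by (metis imageE image_eqI lessThan_iff)
      then have "v l = v j" using near[of l j "g k j"] elim j by (metis lessThan_iff)
      then show ?thesis using hf[OF l(1)] l(2) by simp
    qed
    have "h ` (f k ` {..<n}) = v ` {..<n}" unfolding image_image using hf by (intro image_cong) auto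
    then have "card (h ` (f k ` {..<n})) = card (f k ` {..<n})"
      using card[of k] card_image_le[of "f k ` {..<n}" h] by simp
    then have inj: "inj_on h (f k ` {..<n})" by (intro eq_card_imp_inj_on) auto
    show ?case
    proof (intro allI impI)
      fix i j assume ij: "i < n" "j < n" "v i = v j"
      have "g k j \<in> f k ` {..<n}" "f k i \<in> f k ` {..<n}" using ij eq[of k] by auto
      then show "f k i = g k j" using inj hf[OF ij(1)] hg[OF ij(2)] ij(3) unfolding inj_on_def by metis
    qed
  qed
qed

lemma crit_poly_permute:
  assumes p: "p permutes {..<n}" and xy: "\<And>i. i < n \<Longrightarrow> x i = y (p i)" "x n = y n"
  shows "crit_poly n x = crit_poly n y"
proof -
  have "root_poly n x = (\<Prod>i<n. [:- y (p i), 1:])" unfolding root_poly_def by (intro prod.cong) (use xy in auto)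
  also have "\<dots> = root_poly n y"
    unfolding root_poly_def using prod.permute[OF p, of "\<lambda>i. [:- y i, 1:]"] by (simp add: o_def)
  finally show ?thesis by (simp add: crit_poly_def xy(2))
qed

lemma crit_poly_eq_imp_permutes:
  assumes "crit_poly n x = crit_poly n y"
  obtains p where "p permutes {..<n}" "\<And>i. i < n \<Longrightarrow> x i = y (p i)" "x n = y n"
proof -
  have "smult (of_nat (Suc n)) (root_poly n x) = smult (of_nat (Suc n)) (root_poly n y)"
    using arg_cong[OF assms, of pderiv] by simp
  then have "root_poly n x = root_poly n y" by (simp add: smult_eq_iff del: of_nat_Suc)
  then have "proots (root_poly n x) = proots (root_poly n y)" by (simp only:)
  then have "tuple_to_mset n x = tuple_to_mset n y" unfolding proots_root_poly tuple_to_mset_def .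
  then obtain p where "p permutes {..<n}" "\<And>i. i < n \<Longrightarrow> x i = y (p i)"
    using tuple_to_mset_eq_imp_permutes by blast
  moreover have "x n = y n" using arg_cong[OF assms, of "\<lambda>p. coeff p 0"] by (simp add: coeff_crit_poly)
  ultimately show ?thesis using that by blast
qed

lemma coeffs_tendsto_unique:
  assumes "coeffs_tendsto P p F" "coeffs_tendsto P q F" "F \<noteq> bot"
  shows "p = q"
proof (rule poly_eqI)
  show "coeff p i = coeff q i" for i
    by (rule tendsto_unique[OF assms(3), of "\<lambda>k. coeff (P k) i"]) (use assms in \<open>auto simp: coeffs_tendsto_def\<close>)
qed

lemma bounded_crit_space_subsequence:
  fixes X :: "nat \<Rightarrow> nat \<Rightarrow> complex"
  assumes n: "n \<ge> 1" and X: "\<And>k. X k \<in> crit_space n" "\<And>k i. i < n \<Longrightarrow> norm (crit_val n (X k) i) \<le> R"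
  shows "\<exists>c r. strict_mono (r :: nat \<Rightarrow> nat) \<and> (\<forall>i. (\<lambda>k. X (r k) i) \<longlonglongrightarrow> c i)"
proof -
  obtain B where B: "\<And>y. y \<in> crit_space n \<Longrightarrow> (\<And>i. i < n \<Longrightarrow> norm (crit_val n y i) \<le> R) \<Longrightarrow> \<forall>i\<le>n. norm (y i) \<le> B"
    using crit_val_proper[OF n, of R] by blast
  have "norm (X k i) \<le> \<bar>B\<bar>" for k i
  proof (cases "i \<le> n")
    case True
    then show ?thesis using B[OF X(1)[of k] X(2)] by fastforce
  next
    case False
    then show ?thesis using X(1)[of k] by (simp add: crit_space_def)
  qed
  then show ?thesis by (rule bounded_tuples_subsequence)
qed

lemma pathin_Poly_mt_top_coeffs_tendsto:
  assumes \<gamma>: "pathin (Poly_mt_top d) \<gamma>" and \<tau>: "\<And>k. \<tau> k \<in> {0..1}" "\<tau> \<longlonglongrightarrow> s" "s \<in> {0..1}"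
  shows "coeffs_tendsto (\<lambda>k. \<gamma> (\<tau> k)) (\<gamma> s) sequentially"
proof -
  have "continuous_on {0..1} (\<lambda>t. coeff (\<gamma> t) i)" for i
  proof -
    have "continuous_map (Poly_mt_top d) euclidean ((\<lambda>f. f i) \<circ> (\<lambda>p i. coeff p i))"
      unfolding Poly_mt_top_def by (intro continuous_map_pullback continuous_map_product_projection) simp
    then have "continuous_map (top_of_set {0..1}) euclidean (((\<lambda>f. f i) \<circ> (\<lambda>p i. coeff p i)) \<circ> \<gamma>)"
      using \<gamma> unfolding pathin_def by (rule continuous_map_compose[rotated])
    then show ?thesis by (simp add: o_def)
  qed
  then show ?thesis unfolding coeffs_tendsto_def
    using continuous_on_tendsto_compose[OF _ \<tau>(2,3)] \<tau>(1) by (auto intro!: always_eventually)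
qed

lemma pathin_Poly_mt_top_centered:
  assumes "pathin (Poly_mt_top d) \<gamma>" "t \<in> {0..1}"
  shows "centered_monic d (\<gamma> t)"
proof -
  have "\<gamma> t \<in> topspace (Poly_mt_top d)"
    using assms continuous_map_image_subset_topspace[of "top_of_set {0..1}" "Poly_mt_top d" \<gamma>]
    unfolding pathin_def by auto
  then show ?thesis by (simp add: Poly_mt_top_def topspace_pullback_topology)
qed

text \<open>Convergent labellings of the two lifts describe the same polynomial in the limit, so
  after relabelling one of them the limits agree. The bound on distinct values then matches the
  values label by label and keeps them equal where critical points coincide in the limit, as
  rigidity requires.\<close>

lemma lifts_agree_along_sequence:
  assumes n: "n \<ge> 1" and \<alpha>: "pathin (Mult_top n) \<alpha>"
    and \<tau>: "\<And>k. \<tau> k \<in> {0..1}" "\<tau> \<longlonglongrightarrow> s" "s \<in> {0..1}"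
    and card: "\<And>k. card (set_mset (\<alpha> (\<tau> k))) \<le> card (set_mset (\<alpha> s))"
    and \<gamma>: "pathin (Poly_mt_top (Suc n)) \<gamma>1" "pathin (Poly_mt_top (Suc n)) \<gamma>2"
    and lift: "\<And>t. t \<in> {0..1} \<Longrightarrow> cvl (\<gamma>1 t) = \<alpha> t" "\<And>t. t \<in> {0..1} \<Longrightarrow> cvl (\<gamma>2 t) = \<alpha> t"
    and eq: "\<gamma>1 s = \<gamma>2 s"
  shows "\<exists>k. \<gamma>1 (\<tau> k) = \<gamma>2 (\<tau> k)"
proof -
  have ex: "\<exists>x. x \<in> crit_space n \<and> crit_poly n x = \<gamma> t" if "pathin (Poly_mt_top (Suc n)) \<gamma>" "t \<in> {0..1}" for \<gamma> t
    using ex_crit_space_if_centered[OF n pathin_Poly_mt_top_centered[OF that]] by blast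
  obtain X where X: "\<And>k. X k \<in> crit_space n" "\<And>k. crit_poly n (X k) = \<gamma>1 (\<tau> k)"
    using ex[OF \<gamma>(1) \<tau>(1)] by metis
  obtain Y where Y: "\<And>k. Y k \<in> crit_space n" "\<And>k. crit_poly n (Y k) = \<gamma>2 (\<tau> k)"
    using ex[OF \<gamma>(2) \<tau>(1)] by metis
  have Xv: "tuple_to_mset n (crit_val n (X k)) = \<alpha> (\<tau> k)" for k
    using lift(1)[OF \<tau>(1)[of k]] unfolding X(2)[symmetric] cvl_crit_poly .
  have Yv: "tuple_to_mset n (crit_val n (Y k)) = \<alpha> (\<tau> k)" for k
    using lift(2)[OF \<tau>(1)[of k]] unfolding Y(2)[symmetric] cvl_crit_poly .
  obtain R where R: "\<And>t v. t \<in> {0..1} \<Longrightarrow> v \<in># \<alpha> t \<Longrightarrow> norm v \<le> R"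
    using pathin_Mult_top_bounded[OF \<alpha>] by blast
  have Xb: "norm (crit_val n (X k) i) \<le> R" if "i < n" for k i
    by (rule R[OF \<tau>(1)[of k]]) (use that in \<open>simp flip: Xv\<close>)
  have Yb: "norm (crit_val n (Y k) i) \<le> R" if "i < n" for k i
    by (rule R[OF \<tau>(1)[of k]]) (use that in \<open>simp flip: Yv\<close>)
  obtain x r1 where r1: "strict_mono (r1 :: nat \<Rightarrow> nat)" "\<And>i. (\<lambda>k. X (r1 k) i) \<longlonglongrightarrow> x i"
    using bounded_crit_space_subsequence[OF n, of X R] X(1) Xb by blast
  obtain y r2 where r2: "strict_mono (r2 :: nat \<Rightarrow> nat)" "\<And>i. (\<lambda>k. Y (r1 (r2 k)) i) \<longlonglongrightarrow> y i"
    using bounded_crit_space_subsequence[OF n, of "\<lambda>k. Y (r1 k)" R] Y(1) Yb by blast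
  define r where "r k = r1 (r2 k)" for k
  have r: "strict_mono r" using r1(1) r2(1) by (simp add: r_def strict_mono_def)
  have Xl: "(\<lambda>k. X (r k) i) \<longlonglongrightarrow> x i" for i
    using LIMSEQ_subseq_LIMSEQ[OF r1(2) r2(1)] by (simp add: r_def o_def)
  have Yl: "(\<lambda>k. Y (r k) i) \<longlonglongrightarrow> y i" for i using r2(2) by (simp add: r_def)
  have \<tau>r: "(\<lambda>k. \<tau> (r k)) \<longlonglongrightarrow> s" using LIMSEQ_subseq_LIMSEQ[OF \<tau>(2) r] by (simp add: o_def)
  have xs: "crit_poly n x = \<gamma>1 s"
  proof (rule coeffs_tendsto_unique)
    show "coeffs_tendsto (\<lambda>k. \<gamma>1 (\<tau> (r k))) (crit_poly n x) sequentially"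
      unfolding X(2)[symmetric] by (intro coeffs_tendsto_crit_poly Xl)
    show "coeffs_tendsto (\<lambda>k. \<gamma>1 (\<tau> (r k))) (\<gamma>1 s) sequentially"
      by (rule pathin_Poly_mt_top_coeffs_tendsto[OF \<gamma>(1) \<tau>(1) \<tau>r \<tau>(3)])
  qed simp
  have ys: "crit_poly n y = \<gamma>2 s"
  proof (rule coeffs_tendsto_unique)
    show "coeffs_tendsto (\<lambda>k. \<gamma>2 (\<tau> (r k))) (crit_poly n y) sequentially"
      unfolding Y(2)[symmetric] by (intro coeffs_tendsto_crit_poly Yl)
    show "coeffs_tendsto (\<lambda>k. \<gamma>2 (\<tau> (r k))) (\<gamma>2 s) sequentially"
      by (rule pathin_Poly_mt_top_coeffs_tendsto[OF \<gamma>(2) \<tau>(1) \<tau>r \<tau>(3)])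
  qed simp
  have "crit_poly n x = crit_poly n y" using xs ys eq by simp
  then obtain p where p: "p permutes {..<n}" "\<And>i. i < n \<Longrightarrow> x i = y (p i)" "x n = y n"
    using crit_poly_eq_imp_permutes by blast
  have pn: "p i < n" if "i < n" for i using permutes_in_image[OF p(1), of i] that by simp
  \<comment> \<open>One permutation, taken from the limit, relabels the whole sequence and leaves
    its polynomials unchanged.\<close>
  define Z where "Z k = (\<lambda>i. if i < n then Y (r k) (p i) else Y (r k) i)" for k
  have ZY: "crit_poly n (Z k) = crit_poly n (Y (r k))" for k
    by (rule crit_poly_permute[OF p(1)]) (auto simp: Z_def)
  have Zs: "Z k \<in> crit_space n" for k
  proof -
    have "(\<Sum>i<n. Z k i) = (\<Sum>i<n. Y (r k) (p i))" by (simp add: Z_def)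
    also have "\<dots> = (\<Sum>i<n. Y (r k) i)" using sum.permute[OF p(1), of "Y (r k)"] by (simp add: o_def)
    finally show ?thesis using Y(1)[of "r k"] by (simp add: crit_space_def) (simp add: Z_def)
  qed
  have Zl: "(\<lambda>k. Z k i) \<longlonglongrightarrow> x i" if "i \<le> n" for i
  proof (cases "i < n")
    case True
    then show ?thesis using Yl[of "p i"] p(2) by (simp add: Z_def)
  next
    case False
    then show ?thesis using Yl[of n] p(3) that by (simp add: Z_def)
  qed
  have Zv: "tuple_to_mset n (crit_val n (Z k)) = \<alpha> (\<tau> (r k))" for k
    using Yv[of "r k"] unfolding cvl_crit_poly[symmetric] ZY .
  have xv: "tuple_to_mset n (crit_val n x) = \<alpha> s"
    using lift(1)[OF \<tau>(3)] unfolding xs[symmetric] cvl_crit_poly .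
  have "\<forall>\<^sub>F k in sequentially. \<forall>i<n. \<forall>j<n. crit_val n x i = crit_val n x j \<longrightarrow> crit_val n (X (r k)) i = crit_val n (Z k) j"
  proof (rule eventually_values_merge)
    show "(\<lambda>k. crit_val n (X (r k)) i) \<longlonglongrightarrow> crit_val n x i" if "i < n" for i
      by (intro tendsto_crit_val Xl that)
    show "(\<lambda>k. crit_val n (Z k) i) \<longlonglongrightarrow> crit_val n x i" if "i < n" for i
      by (intro tendsto_crit_val Zl that)
    show "crit_val n (X (r k)) ` {..<n} = crit_val n (Z k) ` {..<n}" for k
      unfolding set_mset_tuple_to_mset[symmetric] Xv Zv ..
    show "card (crit_val n (X (r k)) ` {..<n}) \<le> card (crit_val n x ` {..<n})" for k
      unfolding set_mset_tuple_to_mset[symmetric] Xv xv by (rule card)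
  qed
  then obtain N where N: "\<And>k i j. k \<ge> N \<Longrightarrow> i < n \<Longrightarrow> j < n \<Longrightarrow> crit_val n x i = crit_val n x j \<Longrightarrow>
       crit_val n (X (r k)) i = crit_val n (Z k) j"
    unfolding eventually_sequentially by blast
  \<comment> \<open>Rigidity wants its hypotheses at every index, so the first \<open>N\<close>
    terms are dropped.\<close>
  have "\<forall>\<^sub>F k in sequentially. X (r (k + N)) = Z (k + N)"
  proof (rule eventually_eq_if_crit_val_eq[OF n])
    show "(\<lambda>k. X (r (k + N)) i) \<longlonglongrightarrow> x i" for i by (rule LIMSEQ_ignore_initial_segment[OF Xl])
    show "(\<lambda>k. Z (k + N) i) \<longlonglongrightarrow> x i" if "i \<le> n" for i by (rule LIMSEQ_ignore_initial_segment[OF Zl[OF that]])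
    show "crit_val n (X (r (k + N))) i = crit_val n (Z (k + N)) i" if "i < n" for k i
      by (rule N) (use that in auto)
    show "crit_val n (X (r (k + N))) i = crit_val n (X (r (k + N))) j" if "i < n" "j < n" "x i = x j" for k i j
    proof -
      have "crit_val n x i = crit_val n x j" using that(3) by (simp add: crit_val_def)
      then show ?thesis using N[of "k + N" i j] N[of "k + N" j j] that by simp
    qed
  qed (rule X(1) Zs)+
  from eventually_happens'[OF sequentially_bot this] obtain k where "X (r (k + N)) = Z (k + N)" by blast
  then have "\<gamma>1 (\<tau> (r (k + N))) = \<gamma>2 (\<tau> (r (k + N)))" using X(2) Y(2) ZY by metis
  then show ?thesis by blast
qed

lemma lifts_unique:
  assumes n: "n \<ge> 1" and \<alpha>: "pathin (Mult_top n) \<alpha>" and shape: "weakly_increasing_shape \<alpha>"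
    and \<gamma>: "pathin (Poly_mt_top (Suc n)) \<gamma>1" "pathin (Poly_mt_top (Suc n)) \<gamma>2"
    and lift: "\<And>t. t \<in> {0..1} \<Longrightarrow> cvl (\<gamma>1 t) = \<alpha> t" "\<And>t. t \<in> {0..1} \<Longrightarrow> cvl (\<gamma>2 t) = \<alpha> t"
    and init: "\<gamma>1 0 = \<gamma>2 0" and t: "t \<in> {0..1}"
  shows "\<gamma>1 t = \<gamma>2 t"
proof (rule ccontr)
  assume ne: "\<gamma>1 t \<noteq> \<gamma>2 t"
  \<comment> \<open>Agreement at single times is enough: the supremum \<open>s\<close> turns out to
    be the last agreement up to \<open>t\<close>, and any later one is a contradiction.\<close>
  define A where "A = {s \<in> {0..t}. \<gamma>1 s = \<gamma>2 s}"
  define s where "s = Sup A"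
  have A0: "0 \<in> A" using init t by (simp add: A_def)
  have bdd: "bdd_above A" by (rule bdd_aboveI[of _ t]) (simp add: A_def)
  have s0: "0 \<le> s" unfolding s_def by (rule cSup_upper[OF A0 bdd])
  have st: "s \<le> t" unfolding s_def using A0 by (intro cSup_least) (auto simp: A_def)
  have sI: "s \<in> {0..1}" using s0 st t by auto
  have "\<exists>a\<in>A. s - inverse (real (Suc k)) < a" for k
    using less_cSup_iff[of A "s - inverse (real (Suc k))"] A0 bdd by (auto simp: s_def[symmetric])
  then obtain \<sigma> where \<sigma>: "\<And>k. \<sigma> k \<in> A" "\<And>k. s - inverse (real (Suc k)) < \<sigma> k" by metis
  have \<sigma>s: "\<sigma> k \<le> s" for k unfolding s_def by (rule cSup_upper[OF \<sigma>(1) bdd])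
  have "(\<lambda>k. \<sigma> k - s) \<longlonglongrightarrow> 0"
  proof (rule Lim_null_comparison[OF eventuallyI LIMSEQ_inverse_real_of_nat])
    show "norm (\<sigma> k - s) \<le> inverse (real (Suc k))" for k
      using \<sigma>(2)[of k] \<sigma>s[of k] unfolding real_norm_def by linarith
  qed
  then have \<sigma>l: "\<sigma> \<longlonglongrightarrow> s" using LIM_zero_iff by blast
  have \<sigma>I: "\<sigma> k \<in> {0..1}" for k using \<sigma>(1)[of k] t by (auto simp: A_def)
  have "(\<lambda>k. \<gamma>1 (\<sigma> k)) = (\<lambda>k. \<gamma>2 (\<sigma> k))" using \<sigma>(1) by (auto simp: A_def)
  then have eq: "\<gamma>1 s = \<gamma>2 s"
    using pathin_Poly_mt_top_coeffs_tendsto[OF \<gamma>(1) \<sigma>I \<sigma>l sI] pathin_Poly_mt_top_coeffs_tendsto[OF \<gamma>(2) \<sigma>I \<sigma>l sI]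
      coeffs_tendsto_unique[OF _ _ sequentially_bot] by metis
  then have "s < t" using ne st by (cases "s = t") auto
  \<comment> \<open>Times in the half-open interval from \<open>s\<close> to \<open>t\<close>,
    decreasing to \<open>s\<close>: to the right of \<open>s\<close> the shape hypothesis bounds the
    number of distinct values by the number at \<open>s\<close>.\<close>
  define \<tau> where "\<tau> k = s + (t - s) * inverse (real (Suc k))" for k
  have inv1: "0 < inverse (real (Suc k))" "inverse (real (Suc k)) \<le> 1" for k
    by (auto simp: inverse_le_1_iff)
  have \<tau>: "s < \<tau> k" "\<tau> k \<le> t" for k
  proof -
    show "s < \<tau> k" using \<open>s < t\<close> inv1(1)[of k] by (simp add: \<tau>_def del: of_nat_Suc)
    have "(t - s) * inverse (real (Suc k)) \<le> (t - s) * 1"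
      using \<open>s < t\<close> inv1(2)[of k] by (intro mult_left_mono) auto
    then show "\<tau> k \<le> t" by (simp add: \<tau>_def)
  qed
  have \<tau>I: "\<tau> k \<in> {0..1}" for k using \<tau>[of k] s0 t by auto
  have "(\<lambda>k. s + (t - s) * inverse (real (Suc k))) \<longlonglongrightarrow> s + (t - s) * 0"
    by (intro tendsto_intros LIMSEQ_inverse_real_of_nat)
  then have \<tau>l: "\<tau> \<longlonglongrightarrow> s" by (simp add: \<tau>_def[abs_def])
  have card: "card (set_mset (\<alpha> (\<tau> k))) \<le> card (set_mset (\<alpha> s))" for k
    by (rule shape_le_imp_card_le) (use shape s0 \<tau>[of k] \<tau>I[of k] in \<open>auto simp: weakly_increasing_shape_def\<close>)
  obtain k where "\<gamma>1 (\<tau> k) = \<gamma>2 (\<tau> k)"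
    using lifts_agree_along_sequence[OF n \<alpha> \<tau>I \<tau>l sI card \<gamma> lift eq] by blast
  then have "\<tau> k \<in> A" using \<tau>[of k] s0 by (simp add: A_def)
  then have "\<tau> k \<le> s" unfolding s_def by (rule cSup_upper[OF _ bdd])
  then show False using \<tau>(1)[of k] by simp
qed

theorem theorem8p10:
  fixes d n :: nat and \<alpha> :: "real \<Rightarrow> complex multiset" and p :: "complex poly"
  assumes "d \<ge> 2" and "n = d - 1"
    and "pathin (Mult_top n) \<alpha>"
    and "monic_deg d p"
    and "cvl p = \<alpha> 0"
  shows "(\<exists>\<gamma>. pathin (Poly_mt_top d) \<gamma> \<and> translate_equiv p (\<gamma> 0)
              \<and> (\<forall>t\<in>{0..1}. cvl (\<gamma> t) = \<alpha> t))
       \<and> (weakly_increasing_shape \<alpha> \<longrightarrow>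
            (\<forall>\<gamma>1 \<gamma>2. pathin (Poly_mt_top d) \<gamma>1 \<and> translate_equiv p (\<gamma>1 0)
                       \<and> (\<forall>t\<in>{0..1}. cvl (\<gamma>1 t) = \<alpha> t)
                   \<and> pathin (Poly_mt_top d) \<gamma>2 \<and> translate_equiv p (\<gamma>2 0)
                       \<and> (\<forall>t\<in>{0..1}. cvl (\<gamma>2 t) = \<alpha> t)
                   \<longrightarrow> (\<forall>t\<in>{0..1}. \<gamma>1 t = \<gamma>2 t)))"
proof -
  have n: "n \<ge> 1" and d: "d = Suc n" using assms(1,2) by auto
  have p: "monic_deg (Suc n) p" using assms(4) d by simp
  show ?thesis
  proof (intro conjI impI allI ballI)
    \<comment> \<open>The lift starts at the centred translate of \<open>p\<close>, which has the
      same critical values.\<close>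
    obtain b where b: "centered_monic (Suc n) (pcompose p [:b, 1:])"
      using centered_translate_exists[OF n p] by blast
    obtain x0 where x0: "x0 \<in> crit_space n" "crit_poly n x0 = pcompose p [:b, 1:]"
      using ex_crit_space_if_centered[OF n b] by blast
    have "tuple_to_mset n (crit_val n x0) = \<alpha> 0"
      unfolding cvl_crit_poly[symmetric] x0(2) cvl_translate[OF p] by (rule assms(5))
    then obtain g where g: "continuous_on {0..1} g" "g 0 = x0" "\<And>t. t \<in> {0..1} \<Longrightarrow> g t \<in> crit_space n"
        "\<And>t. t \<in> {0..1} \<Longrightarrow> tuple_to_mset n (crit_val n (g t)) = \<alpha> t"
      using crit_tuple_lift_exists[OF n assms(3) x0(1)] by blast
    show "\<exists>\<gamma>. pathin (Poly_mt_top d) \<gamma> \<and> translate_equiv p (\<gamma> 0) \<and> (\<forall>t\<in>{0..1}. cvl (\<gamma> t) = \<alpha> t)"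
    proof (intro exI conjI ballI)
      show "pathin (Poly_mt_top d) (\<lambda>t. crit_poly n (g t))"
        unfolding d by (rule pathin_Poly_mt_top_crit_poly[OF n g(1,3)])
      show "translate_equiv p (crit_poly n (g 0))"
        unfolding g(2) x0(2) translate_equiv_def by blast
      show "cvl (crit_poly n (g t)) = \<alpha> t" if "t \<in> {0..1}" for t
        unfolding cvl_crit_poly by (rule g(4)[OF that])
    qed
  next
    fix \<gamma>1 \<gamma>2 :: "real \<Rightarrow> complex poly" and t :: real
    assume shape: "weakly_increasing_shape \<alpha>" and t: "t \<in> {0..1}"
      and *: "pathin (Poly_mt_top d) \<gamma>1 \<and> translate_equiv p (\<gamma>1 0) \<and> (\<forall>t\<in>{0..1}. cvl (\<gamma>1 t) = \<alpha> t)
        \<and> pathin (Poly_mt_top d) \<gamma>2 \<and> translate_equiv p (\<gamma>2 0) \<and> (\<forall>t\<in>{0..1}. cvl (\<gamma>2 t) = \<alpha> t)"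
    have \<gamma>: "pathin (Poly_mt_top (Suc n)) \<gamma>1" "pathin (Poly_mt_top (Suc n)) \<gamma>2" using * d by auto
    have "\<gamma>1 0 = \<gamma>2 0"
      using centered_translate_unique[OF n p] pathin_Poly_mt_top_centered[OF \<gamma>(1), of 0]
        pathin_Poly_mt_top_centered[OF \<gamma>(2), of 0] * by auto
    then show "\<gamma>1 t = \<gamma>2 t" using lifts_unique[OF n assms(3) shape \<gamma>] * t by blast
  qed
qed

end
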